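(* Let $G\in\mathbb{C}[x_0,x_1,x_2]$ be homogeneous of degree $n\ge 2$ defining a smooth projective plane curve $X\subset\mathbb{P}^2$, let $G_i=\partial G/\partial x_i$, and let $U_0,U_1,U_2\in\mathbb{C}[x_0,x_1,x_2]$ be homogeneous with $\deg U_0=\deg U_2=2n-3$, $\deg U_1=n-3$, such that $$U_0U_1=\sum_{i=0}^2R_i^{(01)}G_i,\qquad U_1U_2=\sum_{i=0}^2R_i^{(12)}G_i$$ with $R_i^{(01)},R_i^{(12)}$ homogeneous of degree $2n-5$. Let $\langle w_0,w_1,w_2\rangle_{A_X}\in\mathbb{C}$ be the Massey triple product of the classes $w_i=[W_i]$ relative to the defining system $A_X=\{W_0,W_1,W_2,W_{01},W_{12}\}$ determined by these data (see context). Then $\langle w_0,w_1,w_2\rangle_{A_X}=0$ if and only if $$A-B\in J=\langle G_0^2,G_1^2,G_2^2\rangle,$$ where $$A=U_0x_1R_0^{(12)}G_0G_1+U_2x_0R_2^{(01)}G_0G_2+U_0x_0R_0^{(12)}G_0^2,$$ $$B=A_0^{(01)}U_2G_1G_2+U_0A_1^{(12)}G_0G_2+U_0U_1U_2x_0G_0,$$ with $A_0^{(01)}=x_1R_2^{(01)}-x_2R_1^{(01)}$ and $A_1^{(12)}=-x_0R_2^{(12)}+x_2R_0^{(12)}$.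
   Context: The zero polynomial counts as homogeneous of every degree, and it is the only homogeneous polynomial of negative degree; $\mathbb{C}[x_0,x_1,x_2]_m$ is the space of homogeneous polynomials of degree $m$. Let $\mathcal{U}_i=\{x\in\mathbb{P}^2:G_i(x)\ne0\}$; since $X$ is smooth, $\mathcal{U}=\{\mathcal{U}_0,\mathcal{U}_1,\mathcal{U}_2\}$ covers $\mathbb{P}^2$. Put $G_{ij}=G_iG_j$, $G_{012}=G_0G_1G_2$. Čech–de Rham complex: $\mathcal{C}^p_q=\mathcal{C}^q(\mathcal{U}|_X,\Omega_X^p)$ with total differential $D=d+(-1)^p\delta$ on $\mathcal{C}^p_q$, $(\delta\varphi)_{ij}=\varphi_j-\varphi_i$, $(\delta\varphi)_{012}=\varphi_{12}-\varphi_{02}+\varphi_{01}$. For $\alpha\in\mathcal{C}^p_q$, $\beta\in\mathcal{C}^r_s$: $(\alpha\wedge\beta)_{i_0\cdots i_{q+s}}=\alpha_{i_0\cdots i_q}\wedge\beta_{i_q\cdots i_{q+s}}$, $\alpha\bullet\beta=(-1)^{qr}\alpha\wedge\beta$. $\Omega=x_0dx_1\wedge dx_2-x_1dx_0\wedge dx_2+x_2dx_0\wedge dx_1$; $\Omega_i=K_i\Omega$, $\Omega_{ij}=K_jK_i\Omega$, $K_j$ being contraction with $\partial/\partial x_j$; explicitly $\Omega_0=x_2dx_1-x_1dx_2$, $\Omega_1=x_0dx_2-x_2dx_0$, $\Omega_2=x_1dx_0-x_0dx_1$, $\Omega_{01}=x_2$, $\Omega_{02}=-x_1$, $\Omega_{12}=x_0$.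 Cochains on $X$: for $k=0,2$, $W_k\in\mathcal{C}^0_1$ has components $\frac{U_k}{G_{ij}}\Omega_{ij}$ on $\mathcal{U}_i\cap\mathcal{U}_j\cap X$ ($i<j$), with class $w_k\in H^1(X,\mathcal{O}_X)$; $W_1\in\mathcal{C}^1_0$ has components $\frac{U_1}{G_i}\Omega_i$, with class $w_1\in H^0(X,\Omega_X^1)$. For $(k\ell)=(01),(12)$ put $A_0^{(k\ell)}=x_1R_2^{(k\ell)}-x_2R_1^{(k\ell)}$, $A_1^{(k\ell)}=-x_0R_2^{(k\ell)}+x_2R_0^{(k\ell)}$, $A_2^{(k\ell)}=x_0R_1^{(k\ell)}-x_1R_0^{(k\ell)}$. Let $W_{01}\in\mathcal{C}^1_0$ have components $\frac{A_i^{(01)}}{G_i^2}\Omega_i$ and $W_{12}\in\mathcal{C}^1_0$ have components $-\frac{A_i^{(12)}}{G_i^2}\Omega_i$ on $\mathcal{U}_i\cap X$; these satisfy $D(W_{01})=W_0\bullet W_1$, $D(W_{12})=W_1\bullet W_2$. Massey product: $W_{01}\bullet W_2+W_0\bullet W_{12}\in\mathcal{C}^1_1$ is a cocycle with class in $H^1(\mathcal{U}|_X,\Omega_X^1)$, and $$\langle w_0,w_1,w_2\rangle_{A_X}:=\mathrm{Res}_0\big(\tilde\delta[W_{01}\bullet W_2+W_0\bullet W_{12}]\big)\in\mathbb{C}.$$ Here (all forms being algebraic) $\tilde\delta:H^1(\mathcal{U}|_X,\Omega^1_X)\to H^2(\mathbb{P}^2,\Omega^2_{\mathbb{P}^2})$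 is the connecting map of the Poincaré residue sequence $0\to\Omega^2_{\mathbb{P}^2}\to\Omega^2_{\mathbb{P}^2}(\log X)\to\Omega^1_X\to0$, with the residue normalized so that $\omega\wedge\frac{dg}{g}\mapsto\omega|_X$ for $g$ a local equation of $X$: choose a lift $\tilde\varphi\in\mathcal{C}^1(\mathcal{U},\Omega^2_{\mathbb{P}^2}(\log X))$ of a cocycle $\varphi$, and set $\tilde\delta[\varphi]=[\delta\tilde\varphi]$. The Grothendieck residue $\mathrm{Res}_0:H^2(\mathbb{P}^2,\Omega^2_{\mathbb{P}^2})\to\mathbb{C}$ is the isomorphism normalized by: the class of the 2-cocycle $\frac{F}{G_{012}^2}\Omega$ on $\mathcal{U}_0\cap\mathcal{U}_1\cap\mathcal{U}_2$, with $F\in\mathbb{C}[x_0,x_1,x_2]_{6n-9}$, is sent to the unique $R_F\in\mathbb{C}$ with $F-R_F\,\mathrm{Det}_G\in\langle G_0^2,G_1^2,G_2^2\rangle$, where $\mathrm{Det}_G=\det\big(\partial(G_i^2)/\partial x_j\big)_{i,j}$. (Every class has such a representative, $\mathrm{Det}_G\notin\langle G_0^2,G_1^2,G_2^2\rangle$, and $R_F$ exists and is unique because $(\mathbb{C}[x_0,x_1,x_2]/\langle G_0^2,G_1^2,G_2^2\rangle)_{6n-9}\cong\mathbb{C}$.) *)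

theory Defs
  imports
    "HOL-Analysis.Determinants"
    "HOL-Library.Poly_Mapping"
    "HOL-Computational_Algebra.Fraction_Field"
begin

section \<open>Polynomials and rational functions in three variables\<close>

text \<open>
  The index type \<^typ>\<open>3\<close> has exactly the elements \<open>0 < 1 < 2\<close>. A monomial is its exponent
  vector, so multiplication in the monoid algebra below is polynomial multiplication.
\<close>

type_synonym mpoly3 = "(3 \<Rightarrow>\<^sub>0 nat) \<Rightarrow>\<^sub>0 complex"

type_synonym ratfun = "mpoly3 fract"

definition Var :: "3 \<Rightarrow> mpoly3" where
  "Var i = Poly_Mapping.single (Poly_Mapping.single i 1) 1"

definition Const :: "complex \<Rightarrow> mpoly3" where
  "Const c = Poly_Mapping.single 0 c"

definition homogeneous :: "int \<Rightarrow> mpoly3 \<Rightarrow> bool" where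
  "homogeneous d p \<longleftrightarrow>
     (\<forall>m\<in>Poly_Mapping.keys p. int (\<Sum>i\<in>UNIV. Poly_Mapping.lookup m i) = d)"

definition eval_poly :: "mpoly3 \<Rightarrow> complex ^ 3 \<Rightarrow> complex" where
  "eval_poly p v =
     (\<Sum>m\<in>Poly_Mapping.keys p.
        Poly_Mapping.lookup p m * (\<Prod>i\<in>UNIV. v $ i ^ Poly_Mapping.lookup m i))"

lift_definition pd :: "3 \<Rightarrow> mpoly3 \<Rightarrow> mpoly3" is
  "\<lambda>i p m. of_nat (Suc (Poly_Mapping.lookup m i)) * p (m + Poly_Mapping.single i 1)"
proof -
  fix i :: 3 and p :: "(3 \<Rightarrow>\<^sub>0 nat) \<Rightarrow> complex"
  let ?e = "Poly_Mapping.single i (1::nat)"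
  assume "finite {m. p m \<noteq> 0}"
  then have "finite ((\<lambda>m. m + ?e) -` {m. p m \<noteq> 0})"
    by (rule finite_vimageI) (simp add: inj_on_def)
  then show "finite {m. of_nat (Suc (Poly_Mapping.lookup m i)) * p (m + ?e) \<noteq> 0}"
    by (rule rev_finite_subset) auto
qed

lemma pd_add: "pd i (p + q) = pd i p + pd i q"
  by (rule poly_mapping_eqI) (simp add: pd.rep_eq lookup_add algebra_simps)

lemma pd_single:
  "pd i (Poly_Mapping.single m c) =
     Poly_Mapping.single (m - Poly_Mapping.single i 1) (of_nat (Poly_Mapping.lookup m i) * c)"
proof (rule poly_mapping_eqI)
  fix k :: "3 \<Rightarrow>\<^sub>0 nat"
  let ?e = "Poly_Mapping.single i (1::nat)"
  show "Poly_Mapping.lookup (pd i (Poly_Mapping.single m c)) k =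
    Poly_Mapping.lookup (Poly_Mapping.single (m - ?e) (of_nat (Poly_Mapping.lookup m i) * c)) k"
  proof (cases "m = k + ?e")
    case True
    then show ?thesis by (simp add: pd.rep_eq lookup_add)
  next
    case False
    have "m = k + ?e" if "m - ?e = k" "Poly_Mapping.lookup m i \<noteq> 0"
      using that
      by (intro poly_mapping_eqI)
        (auto simp: lookup_add lookup_minus lookup_single when_def)
    with False show ?thesis
      by (auto simp: pd.rep_eq lookup_single when_def)
  qed
qed

lemma pd_zero: "pd i 0 = 0"
  by (rule poly_mapping_eqI) (simp add: pd.rep_eq)

lemma pd_mult_single:
  "pd i (Poly_Mapping.single m c * Poly_Mapping.single k d) =
     pd i (Poly_Mapping.single m c) * Poly_Mapping.single k d
     + Poly_Mapping.single m c * pd i (Poly_Mapping.single k d)"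
proof -
  let ?e = "Poly_Mapping.single i (1::nat)"
  have m: "m + k - ?e = (m - ?e) + k" if "Poly_Mapping.lookup m i \<noteq> 0" for m k :: "3 \<Rightarrow>\<^sub>0 nat"
    using that
    by (intro poly_mapping_eqI) (auto simp: lookup_add lookup_minus lookup_single when_def)
  have 1: "Poly_Mapping.single (m + k - ?e) (of_nat (Poly_Mapping.lookup m i) * (c * d))
        = Poly_Mapping.single ((m - ?e) + k) (of_nat (Poly_Mapping.lookup m i) * (c * d))"
    using m[of m k] by (cases "Poly_Mapping.lookup m i = 0") simp_all
  have 2: "Poly_Mapping.single (m + k - ?e) (of_nat (Poly_Mapping.lookup k i) * (c * d))
        = Poly_Mapping.single (m + (k - ?e)) (of_nat (Poly_Mapping.lookup k i) * (c * d))"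
    using m[of k m] by (cases "Poly_Mapping.lookup k i = 0") (simp_all add: add.commute)
  show ?thesis
    unfolding mult_single pd_single
    using 1 2 by (simp add: lookup_add distrib_right single_add algebra_simps)
qed

lemma poly_mapping_single_induct:
  assumes "P 0" "\<And>m c p. P p \<Longrightarrow> P (Poly_Mapping.single m c + p)"
  shows "P (p :: mpoly3)"
proof (induction "card (Poly_Mapping.keys p)" arbitrary: p)
  case 0
  then show ?case using assms(1) by simp
next
  case (Suc n)
  then obtain m where m: "m \<in> Poly_Mapping.keys p"
    by (metis card.empty ex_in_conv nat.distinct(1))
  let ?s = "Poly_Mapping.single m (Poly_Mapping.lookup p m)"
  have "Poly_Mapping.keys (p - ?s) = Poly_Mapping.keys p - {m}"
    by (auto simp: in_keys_iff lookup_minus lookup_single when_def split: if_splits)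
  with Suc m have "P (p - ?s)" by simp
  from assms(2)[OF this] have "P (?s + (p - ?s))" .
  then show ?case by simp
qed

lemma pd_mult: "pd i (p * q) = pd i p * q + p * pd i q"
proof -
  have s: "pd i (Poly_Mapping.single m c * q) =
     pd i (Poly_Mapping.single m c) * q + Poly_Mapping.single m c * pd i q" for m c
    by (induction q rule: poly_mapping_single_induct)
      (simp_all add: pd_zero pd_add pd_mult_single distrib_left add_ac)
  show ?thesis
    by (induction p rule: poly_mapping_single_induct)
      (simp_all add: pd_zero pd_add s distrib_right add_ac)
qed

lift_definition pd_rat :: "3 \<Rightarrow> ratfun \<Rightarrow> ratfun" is
  "\<lambda>i r. (pd i (fst r) * snd r - fst r * pd i (snd r), snd r * snd r)"
proof -
  fix i and r s :: "mpoly3 \<times> mpoly3"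
  obtain a b a' b' where rs: "r = (a, b)" "s = (a', b')" by fastforce
  assume "fractrel r s"
  with rs have nz: "b \<noteq> 0" "b' \<noteq> 0" and eq: "a * b' = a' * b" by auto
  from arg_cong[OF eq, of "pd i"]
  have deq: "pd i a * b' + a * pd i b' = pd i a' * b + a' * pd i b"
    by (simp add: pd_mult)
  have "(pd i a * b - a * pd i b) * (b' * b') = (pd i a' * b' - a' * pd i b') * (b * b)"
    using eq deq by algebra
  with nz rs show "fractrel (pd i (fst r) * snd r - fst r * pd i (snd r), snd r * snd r)
     (pd i (fst s) * snd s - fst s * pd i (snd s), snd s * snd s)"
    by simp
qed

abbreviation rat :: "mpoly3 \<Rightarrow> ratfun" where
  "rat p \<equiv> Fraction_Field.Fract p 1"

definition smooth_curve :: "mpoly3 \<Rightarrow> bool" where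
  "smooth_curve G \<longleftrightarrow>
     (\<forall>v. v \<noteq> 0 \<and> eval_poly G v = 0 \<longrightarrow> (\<exists>i. eval_poly (pd i G) v \<noteq> 0))"

definition sq_ideal :: "mpoly3 \<Rightarrow> mpoly3 set" where
  "sq_ideal G = {\<Sum>i\<in>UNIV. c i * (pd i G)\<^sup>2 | c. True}"

definition Det_G :: "mpoly3 \<Rightarrow> mpoly3" where
  "Det_G G = det (\<chi> i j. pd j ((pd i G)\<^sup>2))"


section \<open>Algebraic differential forms\<close>

text \<open>
  A rational differential form on affine 3-space (of possibly mixed degree) is given by its
  coefficients: \<open>\<omega> $ {i\<^sub>1 < \<dots> < i\<^sub>p}\<close> is the coefficient of
  \<open>dx\<^bsub>i\<^sub>1\<^esub> \<and> \<dots> \<and> dx\<^bsub>i\<^sub>p\<^esub>\<close>.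
\<close>

type_synonym form = "ratfun ^ (3 set)"

definition wedge :: "form \<Rightarrow> form \<Rightarrow> form"  (infixl \<open>\<and>\<^sub>f\<close> 75) where
  "\<alpha> \<and>\<^sub>f \<beta> = (\<chi> I. \<Sum>J\<in>Pow I.
     (-1) ^ card {(a, b). a \<in> J \<and> b \<in> I - J \<and> b < a} * \<alpha> $ J * \<beta> $ (I - J))"

definition d_fun :: "ratfun \<Rightarrow> form" where
  "d_fun f = (\<chi> I. if card I = 1 then pd_rat (the_elem I) f else 0)"

definition contraction :: "3 \<Rightarrow> form \<Rightarrow> form" where
  "contraction j \<omega> =
     (\<chi> I. if j \<in> I then 0 else (-1) ^ card {k\<in>I. k < j} * \<omega> $ insert j I)"

definition euler_contraction :: "form \<Rightarrow> form" where
  "euler_contraction \<omega> = (\<Sum>j\<in>UNIV. rat (Var j) *s contraction j \<omega>)"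

text \<open>For a nonzero homogeneous \<open>h\<close>: the degree \<open>m\<close> part of the graded ring
  \<open>\<complex>[x\<^sub>0,x\<^sub>1,x\<^sub>2][1/h]\<close>.\<close>

definition loc :: "mpoly3 \<Rightarrow> int \<Rightarrow> ratfun set" where
  "loc h m = {rat a / rat h ^ k | a k e. homogeneous e h \<and> homogeneous (m + int k * e) a}"

text \<open>
  The regular \<open>p\<close>-forms on the affine open \<open>{h \<noteq> 0}\<close> of the projective plane.
  Pulling back along \<open>\<complex>\<^sup>3 - {0} \<rightarrow> \<P>\<^sup>2\<close> identifies them with the \<open>p\<close>-forms on the cone that
  are homogeneous of total degree \<open>0\<close> (each \<open>dx\<^sub>i\<close> has degree \<open>1\<close>) and are killed by
  contraction with the Euler field (the Euler sequence).
\<close>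

definition Forms :: "mpoly3 \<Rightarrow> nat \<Rightarrow> form set" where
  "Forms h p = {\<omega>. (\<forall>I. \<omega> $ I \<in> loc h (- int (card I))) \<and>
                   (\<forall>I. card I \<noteq> p \<longrightarrow> \<omega> $ I = 0) \<and> euler_contraction \<omega> = 0}"

text \<open>A local equation, on \<open>{x\<^sub>k \<noteq> 0}\<close>, of the curve \<open>X = {G = 0}\<close> of degree \<open>n\<close>.\<close>

definition local_eq :: "nat \<Rightarrow> mpoly3 \<Rightarrow> 3 \<Rightarrow> ratfun" where
  "local_eq n G k = rat G / rat (Var k) ^ n"

text \<open>
  \<open>\<Omega>\<^sub>X\<^sup>p\<close> is the quotient of \<open>\<Omega>\<^sup>p\<close> by the subsheaf locally generated by \<open>g\<alpha>\<close> and
  \<open>dg \<and> \<beta>\<close>, \<open>g\<close> a local equation. As \<open>{h \<noteq> 0}\<close> is affine, every section of \<open>\<Omega>\<^sub>X\<^sup>p\<close> over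
  \<open>X \<inter> {h \<noteq> 0}\<close> is the restriction of a form on \<open>{h \<noteq> 0}\<close>. So forms on \<open>X\<close> are handled
  below through representatives, equality on \<open>X\<close> meaning that the difference restricts to zero.
\<close>

definition restricts_to_zero :: "nat \<Rightarrow> mpoly3 \<Rightarrow> mpoly3 \<Rightarrow> nat \<Rightarrow> form \<Rightarrow> bool" where
  "restricts_to_zero n G h p \<omega> \<longleftrightarrow>
     (\<forall>k. \<exists>\<alpha>\<in>Forms (h * Var k) p.
        \<exists>\<beta>\<in>(case p of 0 \<Rightarrow> {0} | Suc q \<Rightarrow> Forms (h * Var k) q).
        \<omega> = local_eq n G k *s \<alpha> + d_fun (local_eq n G k) \<and>\<^sub>f \<beta>)"

text \<open>
  \<open>\<psi>\<close> is a section of \<open>\<Omega>\<^sup>p\<^sup>+\<^sup>1(log X)\<close> over \<open>{h \<noteq> 0}\<close> whose Poincare residue is \<open>\<phi>|\<^sub>X\<close>: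
  locally \<open>\<psi> = \<omega> \<and> dg/g + \<eta>\<close> with \<open>\<omega>, \<eta>\<close> regular and \<open>\<omega>|\<^sub>X = \<phi>|\<^sub>X\<close>.
\<close>

definition log_form_with_residue ::
    "nat \<Rightarrow> mpoly3 \<Rightarrow> mpoly3 \<Rightarrow> nat \<Rightarrow> form \<Rightarrow> form \<Rightarrow> bool" where
  "log_form_with_residue n G h p \<psi> \<phi> \<longleftrightarrow>
     (\<forall>k. \<exists>\<omega>\<in>Forms (h * Var k) p. \<exists>\<eta>\<in>Forms (h * Var k) (Suc p).
        \<psi> = \<omega> \<and>\<^sub>f (inverse (local_eq n G k) *s d_fun (local_eq n G k)) + \<eta> \<and>
        restricts_to_zero n G (h * Var k) p (\<omega> - \<phi>))"


section \<open>Cech cochains for the cover by the sets where a partial derivative is nonzero\<close>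

text \<open>Only the values of a \<open>q\<close>-cochain at \<open>[i\<^sub>0, \<dots>, i\<^sub>q]\<close> with \<open>i\<^sub>0 < \<dots> < i\<^sub>q\<close> matter.\<close>

type_synonym cochain = "3 list \<Rightarrow> form"

definition simplices :: "nat \<Rightarrow> 3 list set" where
  "simplices q = {s. sorted_wrt (<) s \<and> length s = Suc q}"

text \<open>\<open>U\<^bsub>i\<^sub>0\<^esub> \<inter> \<dots> \<inter> U\<^bsub>i\<^sub>q\<^esub>\<close> is the set where the following polynomial is nonzero.\<close>

definition cover_poly :: "mpoly3 \<Rightarrow> 3 list \<Rightarrow> mpoly3" where
  "cover_poly G s = prod_list (map (\<lambda>i. pd i G) s)"

definition Cochains :: "mpoly3 \<Rightarrow> nat \<Rightarrow> nat \<Rightarrow> cochain set" where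
  "Cochains G p q = {c. \<forall>s\<in>simplices q. c s \<in> Forms (cover_poly G s) p}"

definition cech_delta :: "cochain \<Rightarrow> cochain" where
  "cech_delta c s = (\<Sum>k<length s. (-1) ^ k *s c (take k s @ drop (Suc k) s))"

text \<open>The products of a \<open>q\<close>-cochain \<open>\<alpha>\<close> of forms with a cochain \<open>\<beta>\<close> of \<open>r\<close>-forms.\<close>

definition cochain_wedge :: "nat \<Rightarrow> cochain \<Rightarrow> cochain \<Rightarrow> cochain" where
  "cochain_wedge q \<alpha> \<beta> s = \<alpha> (take (Suc q) s) \<and>\<^sub>f \<beta> (drop q s)"

definition bullet :: "nat \<Rightarrow> nat \<Rightarrow> cochain \<Rightarrow> cochain \<Rightarrow> cochain" where
  "bullet q r \<alpha> \<beta> s = (-1) ^ (q * r) *s cochain_wedge q \<alpha> \<beta> s"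

text \<open>
  A class in \<open>H\<^sup>1(\<U>|\<^sub>X, \<Omega>\<^sub>X\<^sup>1)\<close> is the set of all cochains on the plane that restrict to a
  representative of it; a class in \<open>H\<^sup>2(\<P>\<^sup>2, \<Omega>\<^sup>2)\<close> is the set of its representatives
  (for three open sets every 2-cochain is a cocycle).
\<close>

definition H1_class_on_curve :: "nat \<Rightarrow> mpoly3 \<Rightarrow> cochain \<Rightarrow> cochain set" where
  "H1_class_on_curve n G \<phi> =
     {\<phi>' \<in> Cochains G 1 1. \<exists>\<beta>\<in>Cochains G 1 0. \<forall>s\<in>simplices 1.
        restricts_to_zero n G (cover_poly G s) 1 (\<phi>' s - \<phi> s - cech_delta \<beta> s)}"

definition H2_class :: "mpoly3 \<Rightarrow> cochain \<Rightarrow> cochain set" where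
  "H2_class G c =
     {c' \<in> Cochains G 2 2. \<exists>\<eta>\<in>Cochains G 2 1. \<forall>s\<in>simplices 2. c' s - c s = cech_delta \<eta> s}"

definition log_lift :: "nat \<Rightarrow> mpoly3 \<Rightarrow> cochain \<Rightarrow> cochain \<Rightarrow> bool" where
  "log_lift n G \<phi> \<psi> \<longleftrightarrow>
     (\<forall>s\<in>simplices 1. log_form_with_residue n G (cover_poly G s) 1 (\<psi> s) (\<phi> s))"

definition connecting :: "nat \<Rightarrow> mpoly3 \<Rightarrow> cochain set \<Rightarrow> cochain set" where
  "connecting n G \<xi> =
     (THE \<zeta>. \<exists>\<phi>\<in>\<xi>. \<exists>\<psi>. log_lift n G \<phi> \<psi> \<and> \<zeta> = H2_class G (cech_delta \<psi>))"

definition Omega :: form where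
  "Omega = rat (Var 0) *s (d_fun (rat (Var 1)) \<and>\<^sub>f d_fun (rat (Var 2)))
         - rat (Var 1) *s (d_fun (rat (Var 0)) \<and>\<^sub>f d_fun (rat (Var 2)))
         + rat (Var 2) *s (d_fun (rat (Var 0)) \<and>\<^sub>f d_fun (rat (Var 1)))"

text \<open>\<open>\<Omega>\<^bsub>i\<^sub>0\<dots>i\<^sub>q\<^esub> = K\<^bsub>i\<^sub>q\<^esub> \<dots> K\<^bsub>i\<^sub>0\<^esub> \<Omega>\<close>\<close>

definition Omega_at :: "3 list \<Rightarrow> form" where
  "Omega_at s = fold contraction s Omega"

definition Res0 :: "nat \<Rightarrow> mpoly3 \<Rightarrow> cochain set \<Rightarrow> complex" where
  "Res0 n G \<zeta> = (THE r. \<exists>F. homogeneous (6 * int n - 9) F \<and>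
     (\<lambda>s. (rat F / rat (cover_poly G s) ^ 2) *s Omega) \<in> \<zeta> \<and>
     F - Const r * Det_G G \<in> sq_ideal G)"


section \<open>The Massey triple product\<close>

text \<open>
  For \<open>U = U\<^sub>0, U\<^sub>2\<close> (on pairs) and \<open>U = U\<^sub>1\<close> (on single indices) this is the cochain
  \<open>W\<^sub>0, W\<^sub>2\<close> and \<open>W\<^sub>1\<close>, respectively.
\<close>

definition W :: "mpoly3 \<Rightarrow> mpoly3 \<Rightarrow> cochain" where
  "W G U s = (rat U / rat (cover_poly G s)) *s Omega_at s"

definition A_poly :: "(3 \<Rightarrow> mpoly3) \<Rightarrow> 3 \<Rightarrow> mpoly3" where
  "A_poly R i =
     (if i = 0 then Var 1 * R 2 - Var 2 * R 1
      else if i = 1 then - Var 0 * R 2 + Var 2 * R 0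
      else Var 0 * R 1 - Var 1 * R 0)"

definition W01 :: "mpoly3 \<Rightarrow> (3 \<Rightarrow> mpoly3) \<Rightarrow> cochain" where
  "W01 G R01 s = (rat (A_poly R01 (hd s)) / rat (pd (hd s) G) ^ 2) *s Omega_at s"

definition W12 :: "mpoly3 \<Rightarrow> (3 \<Rightarrow> mpoly3) \<Rightarrow> cochain" where
  "W12 G R12 s = - ((rat (A_poly R12 (hd s)) / rat (pd (hd s) G) ^ 2) *s Omega_at s)"

text \<open>
  The Massey product of a defining system \<open>(w\<^sub>0, w\<^sub>1, w\<^sub>2, w\<^sub>0\<^sub>1, w\<^sub>1\<^sub>2)\<close> with
  \<open>w\<^sub>0, w\<^sub>2\<close> in bidegree \<open>(0,1)\<close> and \<open>w\<^sub>1, w\<^sub>0\<^sub>1, w\<^sub>1\<^sub>2\<close> in bidegree \<open>(1,0)\<close>. The cochain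
  \<open>w\<^sub>1\<close> enters only through the equations \<open>D(w\<^sub>0\<^sub>1) = w\<^sub>0 \<bullet> w\<^sub>1\<close> and \<open>D(w\<^sub>1\<^sub>2) = w\<^sub>1 \<bullet> w\<^sub>2\<close>.
\<close>

definition massey_triple ::
    "nat \<Rightarrow> mpoly3 \<Rightarrow> cochain \<Rightarrow> cochain \<Rightarrow> cochain \<Rightarrow> cochain \<Rightarrow> cochain \<Rightarrow> complex" where
  "massey_triple n G w0 w1 w2 w01 w12 =
     Res0 n G (connecting n G (H1_class_on_curve n G
       (\<lambda>s. bullet 0 0 w01 w2 s + bullet 1 1 w0 w12 s)))"

end

theory Submission
  imports
    Defs
    "HOL-Analysis.Continuum_Not_Denumerable"
    "HOL-Computational_Algebra.Fundamental_Theorem_Algebra"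
begin

text \<open>
  On \<open>U\<^sub>i \<inter> U\<^sub>j\<close> the Massey cocycle is \<open>c \<Omega>\<^sub>i + c' \<Omega>\<^sub>j\<close> with rational functions \<open>c, c'\<close>. As
  \<open>\<Omega>\<^sub>i \<and> dg/g\<close> equals \<open>- G\<^sub>i \<Omega>/G\<close> up to a regular form, \<open>- (c G\<^sub>i + c' G\<^sub>j) \<Omega>/G\<close> is a logarithmic
  lift. By Euler's relation and the two relations defining \<open>R\<^bsup>(01)\<^esup>\<close> and \<open>R\<^bsup>(12)\<^esup>\<close>, the
  denominator \<open>G\<close> cancels in its coboundary, which is \<open>n (A - B) \<Omega>/(G\<^sub>0G\<^sub>1G\<^sub>2)\<^sup>2\<close> on the nose. So the
  Massey product is the residue of \<open>n (A - B)\<close>.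

  For this residue to be well defined one needs that \<open>Det\<^sub>G\<close> spans the degree \<open>6n-9\<close> part of
  \<open>\<complex>[x]/J\<close>. By the Nullstellensatz \<open>x\<^sup>N = A F\<close> for a matrix \<open>A\<close>, where \<open>F = (G\<^sub>0\<^sup>2,G\<^sub>1\<^sup>2,G\<^sub>2\<^sup>2)\<close>, and
  multiplication by \<open>det A\<close> embeds \<open>\<complex>[x]/(F)\<close> into \<open>\<complex>[x]/(x\<^sup>N)\<close>, whose socle is spanned by the
  monomial \<open>(x\<^sub>0x\<^sub>1x\<^sub>2)\<^bsup>N-1\<^esup>\<close>. That \<open>Det\<^sub>G\<close> does not vanish there follows by applying the same
  embedding to \<open>x\<^sup>N = P x\<close>, where Euler's relation makes \<open>det P\<close> a multiple of \<open>det A Det\<^sub>G\<close>. Using the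
  powers \<open>G\<^sub>i\<^sup>K\<close> in place of the squares shows that the residue depends only on the cohomology class.
\<close>

section \<open>Enumeration and order of the index type\<close>

lemma UNIV_3_012: "(UNIV :: 3 set) = {0, 1, 2}"
proof -
  have "(3::3) = 0" by simp
  then show ?thesis using UNIV_3 by auto
qed

lemma sum_UNIV_3: "(\<Sum>i\<in>(UNIV::3 set). f i) = f 0 + f 1 + f 2"
  unfolding UNIV_3_012 by (simp add: add_ac)

lemma less_3 [simp]:
  "(0::3) < 1" "(1::3) < 2" "(0::3) < 2" "\<not> (1::3) < 0" "\<not> (2::3) < 1" "\<not> (2::3) < 0"
  by (simp_all add: less_bit1_def bit1.Rep_0 bit1.Rep_1 bit1.Rep_numeral)

lemma forall_3_012: "(\<forall>i::3. P i) \<longleftrightarrow> P 0 \<and> P 1 \<and> P 2"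
  using UNIV_3_012 by (metis UNIV_I insertE singletonD)

subsection \<open>Homogeneous components\<close>

definition mdeg :: "(3 \<Rightarrow>\<^sub>0 nat) \<Rightarrow> int" where
  "mdeg m = int (\<Sum>i\<in>UNIV. Poly_Mapping.lookup m i)"

lemma mdeg_add: "mdeg (m + k) = mdeg m + mdeg k"
  by (simp add: mdeg_def lookup_add sum.distrib)

lemma mdeg_nonneg: "0 \<le> mdeg m"
  unfolding mdeg_def by (rule of_nat_0_le_iff)

lemma mdeg_zero [simp]: "mdeg 0 = 0"
  by (simp add: mdeg_def)

lemma mdeg_single [simp]: "mdeg (Poly_Mapping.single i k) = int k"
  by (simp add: mdeg_def lookup_single when_def)

lemma homogeneous_mdeg: "homogeneous d p \<longleftrightarrow> (\<forall>m\<in>Poly_Mapping.keys p. mdeg m = d)"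
  by (simp add: homogeneous_def mdeg_def)

lemma homogeneous_0 [simp]: "homogeneous d 0"
  by (simp add: homogeneous_def)

lemma homogeneous_add: "homogeneous d p \<Longrightarrow> homogeneous d q \<Longrightarrow> homogeneous d (p + q)"
  using keys_add[of p q] by (auto simp: homogeneous_mdeg)

lemma homogeneous_uminus: "homogeneous d p \<Longrightarrow> homogeneous d (- p)"
  by (simp add: homogeneous_mdeg in_keys_iff)

lemma homogeneous_diff: "homogeneous d p \<Longrightarrow> homogeneous d q \<Longrightarrow> homogeneous d (p - q)"
  using homogeneous_add[of d p "- q"] homogeneous_uminus[of d q] by simp

lemma homogeneous_mult: "homogeneous d p \<Longrightarrow> homogeneous e q \<Longrightarrow> homogeneous (d + e) (p * q)"
  using keys_mult[of p q] by (force simp: homogeneous_mdeg mdeg_add)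

lemma homogeneous_single [simp]: "homogeneous (mdeg m) (Poly_Mapping.single m c)"
  by (simp add: homogeneous_mdeg)

lemma homogeneous_Const [simp]: "homogeneous 0 (Const c)"
  using homogeneous_single[of 0 c] by (simp add: Const_def)

lemma homogeneous_1 [simp]: "homogeneous 0 1"
  using homogeneous_Const[of 1] by (simp add: Const_def)

lemma homogeneous_Var: "homogeneous 1 (Var i)"
  using homogeneous_single[of "Poly_Mapping.single i 1" 1] by (simp add: Var_def del: homogeneous_single)

lemma homogeneous_power: "homogeneous d p \<Longrightarrow> homogeneous (int k * d) (p ^ k)"
proof (induction k)
  case (Suc k)
  then show ?case
    using homogeneous_mult[of d p "int k * d" "p ^ k"] by (simp add: algebra_simps)
qed simp

lemma homogeneous_mult': 
  "homogeneous d p \<Longrightarrow> homogeneous e q \<Longrightarrow> d + e = f \<Longrightarrow> homogeneous f (p * q)"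
  using homogeneous_mult by blast

lemma homogeneous_unique: "homogeneous d p \<Longrightarrow> homogeneous e p \<Longrightarrow> p \<noteq> 0 \<Longrightarrow> d = e"
  by (metis homogeneous_mdeg keys_eq_empty all_not_in_conv)

lemma homogeneous_pd:
  assumes "homogeneous d p" shows "homogeneous (d - 1) (pd i p)"
  unfolding homogeneous_mdeg
proof
  fix m assume "m \<in> Poly_Mapping.keys (pd i p)"
  then have "m + Poly_Mapping.single i 1 \<in> Poly_Mapping.keys p"
    by (auto simp: in_keys_iff pd.rep_eq)
  then show "mdeg m = d - 1" using assms by (force simp: homogeneous_mdeg mdeg_add)
qed

text \<open>The homogeneous component of degree \<open>d\<close>. Degrees are integers, so the shift
  \<open>d - e\<close> in \<open>hcomp_mult\<close> never truncates; components of negative degree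
  are zero.\<close>

definition hcomp :: "int \<Rightarrow> mpoly3 \<Rightarrow> mpoly3" where
  "hcomp d p = Poly_Mapping.mapp (\<lambda>m c. c when mdeg m = d) p"

lemma lookup_hcomp: "Poly_Mapping.lookup (hcomp d p) m = (Poly_Mapping.lookup p m when mdeg m = d)"
  by (auto simp: hcomp_def lookup_mapp when_def in_keys_iff)

lemma hcomp_add: "hcomp d (p + q) = hcomp d p + hcomp d q"
  by (rule poly_mapping_eqI) (simp add: lookup_hcomp lookup_add when_def)

lemma hcomp_diff: "hcomp d (p - q) = hcomp d p - hcomp d q"
  by (rule poly_mapping_eqI) (simp add: lookup_hcomp lookup_minus when_def)

lemma hcomp_0 [simp]: "hcomp d 0 = 0"
  by (rule poly_mapping_eqI) (simp add: lookup_hcomp)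

lemma hcomp_sum: "hcomp d (sum f I) = (\<Sum>i\<in>I. hcomp d (f i))"
  by (induction I rule: infinite_finite_induct) (auto simp: hcomp_add)

lemma homogeneous_hcomp [simp]: "homogeneous d (hcomp d p)"
  by (auto simp: homogeneous_mdeg in_keys_iff lookup_hcomp)

lemma hcomp_homogeneous: "homogeneous e p \<Longrightarrow> hcomp d p = (if d = e then p else 0)"
  by (rule poly_mapping_eqI) (auto simp: lookup_hcomp when_def homogeneous_mdeg in_keys_iff)

lemma hcomp_neg: "d < 0 \<Longrightarrow> hcomp d p = 0"
  using mdeg_nonneg by (intro poly_mapping_eqI) (auto simp: lookup_hcomp when_def not_less[symmetric])

text \<open>By additivity it suffices to take a monomial for \<open>p\<close>. This is what makes
  the coefficients of an ideal relation between homogeneous polynomials homogeneous.\<close>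

lemma hcomp_mult:
  assumes "homogeneous e q" shows "hcomp d (q * p) = q * hcomp (d - e) p"
proof (induction p rule: poly_mapping_single_induct)
  case (2 m c p)
  have "homogeneous (e + mdeg m) (q * Poly_Mapping.single m c)"
    by (intro homogeneous_mult assms homogeneous_single)
  from hcomp_homogeneous[OF this, of d] hcomp_homogeneous[OF homogeneous_single, of "d - e" m c]
  have "hcomp d (q * Poly_Mapping.single m c) = q * hcomp (d - e) (Poly_Mapping.single m c)"
    by auto
  then show ?case using 2 by (simp add: distrib_left hcomp_add)
qed simp

lemma hcomp_eventually_0: "\<exists>n. \<forall>k\<ge>n. hcomp (int k) p = 0"
proof -
  obtain n where n: "\<forall>m\<in>Poly_Mapping.keys p. nat (mdeg m) < n"
    using finite_nat_set_iff_bounded[of "(nat \<circ> mdeg) ` Poly_Mapping.keys p"] by auto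
  have "hcomp (int k) p = 0" if "k \<ge> n" for k
    using n that by (intro poly_mapping_eqI) (force simp: lookup_hcomp when_def in_keys_iff)
  then show ?thesis by blast
qed

subsection \<open>Evaluation and partial derivatives\<close>

lemma eval_poly_superset:
  assumes "finite S" "Poly_Mapping.keys p \<subseteq> S"
  shows "eval_poly p v =
    (\<Sum>m\<in>S. Poly_Mapping.lookup p m * (\<Prod>i\<in>UNIV. v $ i ^ Poly_Mapping.lookup m i))"
  unfolding eval_poly_def
  by (rule sum.mono_neutral_left) (use assms in \<open>auto simp: in_keys_iff\<close>)

lemma eval_poly_add: "eval_poly (p + q) v = eval_poly p v + eval_poly q v"
proof -
  let ?S = "Poly_Mapping.keys p \<union> Poly_Mapping.keys q"
  have "finite ?S" "Poly_Mapping.keys (p + q) \<subseteq> ?S" by (auto simp: keys_add)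
  then show ?thesis
    by (simp add: eval_poly_superset[of ?S] lookup_add distrib_right sum.distrib)
qed

lemma eval_poly_single:
  "eval_poly (Poly_Mapping.single m c) v = c * (\<Prod>i\<in>UNIV. v $ i ^ Poly_Mapping.lookup m i)"
  by (simp add: eval_poly_def)

lemma eval_poly_0 [simp]: "eval_poly 0 v = 0"
  by (simp add: eval_poly_def)

lemma eval_poly_mult: "eval_poly (p * q) v = eval_poly p v * eval_poly q v"
proof -
  have s: "eval_poly (Poly_Mapping.single m c * q) v
      = eval_poly (Poly_Mapping.single m c) v * eval_poly q v" for m c
    by (induction q rule: poly_mapping_single_induct)
      (simp_all add: distrib_left eval_poly_add mult_single eval_poly_single lookup_add power_add
        prod.distrib)
  show ?thesis
    by (induction p rule: poly_mapping_single_induct)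
      (simp_all add: distrib_right eval_poly_add s)
qed

lemma eval_poly_Const [simp]: "eval_poly (Const c) v = c"
  by (simp add: Const_def eval_poly_single)

lemma eval_poly_1 [simp]: "eval_poly 1 v = 1"
  using eval_poly_Const[of 1 v] by (simp add: Const_def)

lemma eval_poly_Var [simp]: "eval_poly (Var j) v = v $ j"
  by (simp add: Var_def eval_poly_single lookup_single when_def if_distrib[of "\<lambda>k. _ ^ k"] prod.delta
      cong: if_cong)

lemma eval_poly_power: "eval_poly (p ^ k) v = eval_poly p v ^ k"
  by (induction k) (simp_all add: eval_poly_mult)

lemma eval_poly_sum: "eval_poly (sum f I) v = (\<Sum>i\<in>I. eval_poly (f i) v)"
  by (induction I rule: infinite_finite_induct) (simp_all add: eval_poly_add)

lemma Const_0 [simp]: "Const 0 = 0"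
  and Const_1 [simp]: "Const 1 = 1"
  and Const_add: "Const (a + b) = Const a + Const b"
  and Const_diff: "Const (a - b) = Const a - Const b"
  and Const_uminus: "Const (- a) = - Const a"
  and Const_mult: "Const (a * b) = Const a * Const b"
  by (simp_all add: Const_def single_add single_diff single_uminus mult_single)

lemma Const_of_nat: "Const (of_nat n) = of_nat n"
  by (simp add: Const_def)

lemma lookup_Const_mult: "Poly_Mapping.lookup (Const c * p) m = c * Poly_Mapping.lookup p m"
proof (induction p rule: poly_mapping_single_induct)
  case (2 k d p)
  then show ?case
    by (simp add: Const_def mult_single distrib_left lookup_add lookup_single when_def)
qed simp

lemma pd_power: "pd i (p ^ k) = of_nat k * p ^ (k - 1) * pd i p"
proof (induction k)
  case (Suc k)
  then show ?case by (cases k) (simp_all add: pd_mult algebra_simps)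
next
  case 0
  show ?case using pd_single[of i 0 1] by simp
qed

lemma pd_Var: "pd i (Var j) = (if i = j then 1 else 0)"
  by (auto simp: Var_def pd_single lookup_single when_def)

lemma Var_times_pd_single:
  "Var i * pd i (Poly_Mapping.single m c) = of_nat (Poly_Mapping.lookup m i) * Poly_Mapping.single m c"
proof (cases "Poly_Mapping.lookup m i = 0")
  case False
  have "Poly_Mapping.single i 1 + (m - Poly_Mapping.single i 1) = m"
    using False by (intro poly_mapping_eqI) (auto simp: lookup_add lookup_minus lookup_single when_def)
  then show ?thesis
    by (simp add: Var_def pd_single mult_single flip: single_of_nat)
qed (simp add: pd_single)

text \<open>Monomials are eigenvectors of the Euler operator, with their degree as eigenvalue.
  Stated per coefficient, this holds for every polynomial.\<close>

lemma lookup_euler: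
  "Poly_Mapping.lookup (\<Sum>i\<in>UNIV. Var i * pd i p) m = of_int (mdeg m) * Poly_Mapping.lookup p m"
proof (induction p rule: poly_mapping_single_induct)
  case (2 k c p)
  have "(\<Sum>i\<in>UNIV. Var i * pd i (Poly_Mapping.single k c + p))
      = Const (of_int (mdeg k)) * Poly_Mapping.single k c + (\<Sum>i\<in>UNIV. Var i * pd i p)"
    by (simp add: pd_add distrib_left sum.distrib Var_times_pd_single mdeg_def Const_of_nat
        flip: sum_distrib_right of_nat_sum)
  then show ?case
    by (simp add: lookup_add 2 lookup_Const_mult distrib_left lookup_single when_def)
qed (simp add: pd_zero)

lemma euler_identity:
  assumes "homogeneous (int d) p"
  shows "(\<Sum>i\<in>UNIV. Var i * pd i p) = of_nat d * p"
proof (rule poly_mapping_eqI)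
  fix m
  show "Poly_Mapping.lookup (\<Sum>i\<in>UNIV. Var i * pd i p) m = Poly_Mapping.lookup (of_nat d * p) m"
  proof (cases "Poly_Mapping.lookup p m = 0")
    case False
    then have "mdeg m = int d" using assms by (auto simp: homogeneous_mdeg in_keys_iff)
    then show ?thesis by (simp add: lookup_euler lookup_Const_mult flip: Const_of_nat)
  qed (simp add: lookup_euler lookup_Const_mult flip: Const_of_nat)
qed

subsection \<open>Ideals generated by powers of the variables\<close>

definition pow_ideal :: "nat \<Rightarrow> 3 set \<Rightarrow> mpoly3 set" where
  "pow_ideal N S = {\<Sum>i\<in>S. c i * Var i ^ N | c. True}"

lemma pow_idealI: "p = (\<Sum>i\<in>S. c i * Var i ^ N) \<Longrightarrow> p \<in> pow_ideal N S"
  by (auto simp: pow_ideal_def)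

lemma Var_power: "Var i ^ N = Poly_Mapping.single (Poly_Mapping.single i N) 1"
  by (induction N) (simp_all add: Var_def mult_single flip: single_add single_one)

lemma lookup_single_mult:
  "Poly_Mapping.lookup (Poly_Mapping.single k c * p) (k + m) = c * Poly_Mapping.lookup (p :: mpoly3) m"
  by (induction p rule: poly_mapping_single_induct)
    (simp_all add: mult_single distrib_left lookup_add lookup_single when_def)

lemma lookup_Var_power_mult:
  "Poly_Mapping.lookup (Var i ^ N * p) (Poly_Mapping.single i N + m) = Poly_Mapping.lookup p m"
  by (simp add: Var_power lookup_single_mult)

lemma keys_mult_Var_power:
  "m \<in> Poly_Mapping.keys (p * Var i ^ N) \<Longrightarrow> N \<le> Poly_Mapping.lookup m i"
  using keys_mult[of p "Var i ^ N"] by (auto simp: Var_power lookup_add)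

lemma single_eq_mult_Var_power:
  assumes "N \<le> Poly_Mapping.lookup m i"
  shows "Poly_Mapping.single m c
    = Poly_Mapping.single (m - Poly_Mapping.single i N) c * Var i ^ N"
proof -
  have "m - Poly_Mapping.single i N + Poly_Mapping.single i N = m"
    using assms by (intro poly_mapping_eqI) (auto simp: lookup_add lookup_minus lookup_single when_def)
  then show ?thesis by (simp add: Var_power mult_single)
qed

lemma pow_ideal_add:
  assumes "p \<in> pow_ideal N S" "q \<in> pow_ideal N S"
  shows "p + q \<in> pow_ideal N S"
proof -
  obtain c d where "p = (\<Sum>i\<in>S. c i * Var i ^ N)" "q = (\<Sum>i\<in>S. d i * Var i ^ N)"
    using assms by (auto simp: pow_ideal_def)
  then have "p + q = (\<Sum>i\<in>S. (c i + d i) * Var i ^ N)"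
    by (simp add: distrib_right sum.distrib)
  then show ?thesis by (rule pow_idealI)
qed

lemma pow_ideal_mult:
  assumes "p \<in> pow_ideal N S" shows "r * p \<in> pow_ideal N S"
proof -
  obtain c where "p = (\<Sum>i\<in>S. c i * Var i ^ N)" using assms by (auto simp: pow_ideal_def)
  then have "r * p = (\<Sum>i\<in>S. (r * c i) * Var i ^ N)"
    by (simp add: sum_distrib_left mult.assoc)
  then show ?thesis by (rule pow_idealI)
qed

lemma pow_ideal_Var_mult:
  assumes "i \<in> S" shows "r * Var i ^ N \<in> pow_ideal N S"
proof -
  have "r * Var i ^ N = (\<Sum>j\<in>S. (if j = i then r else 0) * Var j ^ N)"
    using assms by (simp add: if_distrib[of "\<lambda>x. x * _"] cong: if_cong)
  then show ?thesis by (rule pow_idealI)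
qed

text \<open>A monomial ideal is spanned by the monomials it contains. The converse direction strips
  one monomial of \<open>p\<close> at a time.\<close>

lemma pow_ideal_iff:
  "p \<in> pow_ideal N S \<longleftrightarrow> (\<forall>m\<in>Poly_Mapping.keys p. \<exists>i\<in>S. N \<le> Poly_Mapping.lookup m i)"
proof
  assume "p \<in> pow_ideal N S"
  then obtain c where p: "p = (\<Sum>i\<in>S. c i * Var i ^ N)" by (auto simp: pow_ideal_def)
  show "\<forall>m\<in>Poly_Mapping.keys p. \<exists>i\<in>S. N \<le> Poly_Mapping.lookup m i"
  proof
    fix m assume "m \<in> Poly_Mapping.keys p"
    then have "(\<Sum>i\<in>S. Poly_Mapping.lookup (c i * Var i ^ N) m) \<noteq> 0"
      by (simp add: p in_keys_iff lookup_sum)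
    then obtain i where "i \<in> S" "Poly_Mapping.lookup (c i * Var i ^ N) m \<noteq> 0"
      by (meson sum.neutral)
    then show "\<exists>i\<in>S. N \<le> Poly_Mapping.lookup m i"
      using keys_mult_Var_power by (metis in_keys_iff)
  qed
next
  assume "\<forall>m\<in>Poly_Mapping.keys p. \<exists>i\<in>S. N \<le> Poly_Mapping.lookup m i"
  then show "p \<in> pow_ideal N S"
  proof (induction "card (Poly_Mapping.keys p)" arbitrary: p)
    case 0
    then have "p = 0" by simp
    then have "p = (\<Sum>i\<in>S. 0 * Var i ^ N)" by simp
    then show ?case by (rule pow_idealI)
  next
    case (Suc n)
    then obtain m where m: "m \<in> Poly_Mapping.keys p"
      by (metis card.empty ex_in_conv nat.distinct(1))
    let ?s = "Poly_Mapping.single m (Poly_Mapping.lookup p m)"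
    have "Poly_Mapping.keys (p - ?s) = Poly_Mapping.keys p - {m}"
      by (auto simp: in_keys_iff lookup_minus lookup_single when_def split: if_splits)
    with Suc m have "p - ?s \<in> pow_ideal N S" by simp
    moreover have "?s \<in> pow_ideal N S"
      using Suc.prems m single_eq_mult_Var_power pow_ideal_Var_mult by metis
    ultimately show ?case using pow_ideal_add by fastforce
  qed
qed

text \<open>Multiplication by \<open>Var j ^ K\<close> raises only the exponent of \<open>j\<close>,
  whereas membership depends only on exponents with index in \<open>S\<close>.\<close>

lemma pow_ideal_cancel_Var:
  assumes "Var j ^ K * p \<in> pow_ideal N S" "j \<notin> S"
  shows "p \<in> pow_ideal N S"
  unfolding pow_ideal_iff
proof
  fix m assume "m \<in> Poly_Mapping.keys p"
  then have "Poly_Mapping.single j K + m \<in> Poly_Mapping.keys (Var j ^ K * p)"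
    by (simp add: in_keys_iff lookup_Var_power_mult)
  then obtain i where "i \<in> S" "N \<le> Poly_Mapping.lookup (Poly_Mapping.single j K + m) i"
    using assms(1) unfolding pow_ideal_iff by blast
  then show "\<exists>i\<in>S. N \<le> Poly_Mapping.lookup m i"
    using assms(2) by (auto simp: lookup_add lookup_single when_def split: if_splits)
qed

lemma pow_ideal_UNIV: "p \<in> pow_ideal N UNIV \<longleftrightarrow> (\<exists>a b c. p = a * Var 0 ^ N + b * Var 1 ^ N + c * Var 2 ^ N)"
proof
  assume "p \<in> pow_ideal N UNIV"
  then show "\<exists>a b c. p = a * Var 0 ^ N + b * Var 1 ^ N + c * Var 2 ^ N"
    by (auto simp: pow_ideal_def sum_UNIV_3)
next
  assume "\<exists>a b c. p = a * Var 0 ^ N + b * Var 1 ^ N + c * Var 2 ^ N"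
  then show "p \<in> pow_ideal N UNIV"
    by (auto intro!: pow_ideal_add pow_ideal_Var_mult)
qed

text \<open>The two regularity conditions of \<open>wiebe\<close> for the sequence of
  \<open>N\<close>-th powers of the variables.\<close>

lemma Var_powers_regular:
  shows "Var 1 ^ N * p = Var 0 ^ N * a \<Longrightarrow> \<exists>c. p = Var 0 ^ N * c"
    and "Var 2 ^ N * p = Var 0 ^ N * a + Var 1 ^ N * b \<Longrightarrow> \<exists>c d. p = Var 0 ^ N * c + Var 1 ^ N * d"
proof -
  have 0: "q \<in> pow_ideal N {0} \<longleftrightarrow> (\<exists>c. q = Var 0 ^ N * c)" for q
    by (auto simp: pow_ideal_def mult.commute intro: exI[of _ "\<lambda>_. _"])
  have 1: "q \<in> pow_ideal N {0, 1} \<longleftrightarrow> (\<exists>c d. q = Var 0 ^ N * c + Var 1 ^ N * d)" for q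
  proof
    assume "\<exists>c d. q = Var 0 ^ N * c + Var 1 ^ N * d"
    then obtain c d where "q = c * Var 0 ^ N + d * Var 1 ^ N" by (auto simp: mult.commute)
    then show "q \<in> pow_ideal N {0, 1}"
      by (auto intro!: pow_ideal_add pow_ideal_Var_mult)
  qed (auto simp: pow_ideal_def mult.commute)
  show "\<exists>c. p = Var 0 ^ N * c" if "Var 1 ^ N * p = Var 0 ^ N * a"
    using pow_ideal_cancel_Var[of 1 N p N "{0}"] that by (auto simp: 0)
  show "\<exists>c d. p = Var 0 ^ N * c + Var 1 ^ N * d" if "Var 2 ^ N * p = Var 0 ^ N * a + Var 1 ^ N * b"
    using pow_ideal_cancel_Var[of 2 N p N "{0, 1}"] that by (auto simp: 1)
qed

text \<open>Coprimality of powers of distinct variables, with independent exponents, as needed to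
  compare two fractions in \<open>loc_glue\<close>.\<close>

lemma Var_power_dvd:
  assumes "Var i ^ K * p = Var j ^ N * a" "i \<noteq> j"
  shows "\<exists>c. p = Var j ^ N * c"
proof -
  have 0: "q \<in> pow_ideal N {j} \<longleftrightarrow> (\<exists>c. q = Var j ^ N * c)" for q
    by (auto simp: pow_ideal_def mult.commute intro: exI[of _ "\<lambda>_. _"])
  show ?thesis
    using pow_ideal_cancel_Var[of i K p N "{j}"] assms by (auto simp: 0)
qed

lemma Var_neq_0 [simp]: "Var i \<noteq> 0"
  by (metis eval_poly_0 eval_poly_Var one_index one_neq_zero)

lemma homogeneous_Var_power_cancel:
  assumes "homogeneous (d + int K) (Var i ^ K * p)"
  shows "homogeneous d p"
  unfolding homogeneous_mdeg
proof
  fix m assume "m \<in> Poly_Mapping.keys p"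
  then have "Poly_Mapping.single i K + m \<in> Poly_Mapping.keys (Var i ^ K * p)"
    by (simp add: in_keys_iff lookup_Var_power_mult)
  then show "mdeg m = d" using assms by (force simp: homogeneous_mdeg mdeg_add)
qed

text \<open>The socle of \<open>\<complex>[x\<^sub>0,x\<^sub>1,x\<^sub>2]/(x\<^sub>0\<^sup>N,x\<^sub>1\<^sup>N,x\<^sub>2\<^sup>N)\<close> is spanned by
  \<open>(x\<^sub>0x\<^sub>1x\<^sub>2)\<^bsup>N-1\<^esup>\<close>.\<close>

lemma pow_ideal_socle:
  assumes "homogeneous (3 * int N - 3) p" "N > 0"
  shows "\<exists>c. p - Const c * (Var 0 * Var 1 * Var 2) ^ (N - 1) \<in> pow_ideal N UNIV"
proof -
  define k :: "3 \<Rightarrow>\<^sub>0 nat" where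
    "k = Poly_Mapping.single 0 (N-1) + Poly_Mapping.single 1 (N-1) + Poly_Mapping.single 2 (N-1)"
  have s: "Const c * (Var 0 * Var 1 * Var 2) ^ (N - 1) = Poly_Mapping.single k c" for c
    by (simp add: power_mult_distrib Var_power mult_single k_def Const_def)
  let ?q = "p - Poly_Mapping.single k (Poly_Mapping.lookup p k)"
  have "\<exists>i. N \<le> Poly_Mapping.lookup m i" if m: "m \<in> Poly_Mapping.keys ?q" for m
  proof (rule ccontr)
    assume "\<not> ?thesis"
    then have lt: "Poly_Mapping.lookup m i < N" for i by (meson not_le)
    have "m \<noteq> k" and "m \<in> Poly_Mapping.keys p"
      using m by (auto simp: in_keys_iff lookup_minus lookup_single when_def split: if_splits)
    then have "mdeg m = 3 * int N - 3" using assms(1) by (simp add: homogeneous_mdeg)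
    then have "int (Poly_Mapping.lookup m 0 + Poly_Mapping.lookup m 1 + Poly_Mapping.lookup m 2) = 3 * int N - 3"
      by (simp add: mdeg_def sum_UNIV_3)
    then have "\<forall>i. Poly_Mapping.lookup m i = N - 1"
      unfolding forall_3_012 using lt[of 0] lt[of 1] lt[of 2] assms(2) by linarith
    moreover have "\<forall>i. Poly_Mapping.lookup k i = N - 1"
      unfolding forall_3_012 by (simp add: k_def lookup_add lookup_single)
    ultimately have "m = k" by (intro poly_mapping_eqI) simp
    with \<open>m \<noteq> k\<close> show False by simp
  qed
  then have "?q \<in> pow_ideal N UNIV" by (simp add: pow_ideal_iff)
  then show ?thesis using s by metis
qed

subsection \<open>A Nullstellensatz for homogeneous polynomials\<close>

definition is_ideal :: "'a::comm_ring_1 set \<Rightarrow> bool" where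
  "is_ideal I \<longleftrightarrow> 0 \<in> I \<and> (\<forall>p\<in>I. \<forall>q\<in>I. p + q \<in> I) \<and> (\<forall>p\<in>I. \<forall>r. r * p \<in> I)"

lemma is_idealD:
  assumes "is_ideal I"
  shows is_ideal_0: "0 \<in> I"
    and is_ideal_add: "p \<in> I \<Longrightarrow> q \<in> I \<Longrightarrow> p + q \<in> I"
    and is_ideal_mult: "p \<in> I \<Longrightarrow> r * p \<in> I"
    and is_ideal_mult_right: "p \<in> I \<Longrightarrow> p * r \<in> I"
    and is_ideal_uminus: "p \<in> I \<Longrightarrow> - p \<in> I"
    and is_ideal_diff: "p \<in> I \<Longrightarrow> q \<in> I \<Longrightarrow> p - q \<in> I"
proof -
  show 0: "0 \<in> I" and add: "p \<in> I \<Longrightarrow> q \<in> I \<Longrightarrow> p + q \<in> I" 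
    and mult: "p \<in> I \<Longrightarrow> r * p \<in> I" for p q r
    using assms by (auto simp: is_ideal_def)
  show "p \<in> I \<Longrightarrow> p * r \<in> I" for p r using mult[of p r] by (simp add: mult.commute)
  show um: "p \<in> I \<Longrightarrow> - p \<in> I" for p using mult[of p "-1"] by simp
  show "p \<in> I \<Longrightarrow> q \<in> I \<Longrightarrow> p - q \<in> I" for p q using add[of p "- q"] um by simp
qed

lemma is_ideal_sum: "is_ideal I \<Longrightarrow> (\<And>i. i \<in> A \<Longrightarrow> f i \<in> I) \<Longrightarrow> sum f A \<in> I"
  by (induction A rule: infinite_finite_induct) (auto simp: is_ideal_0 is_ideal_add)

definition gen_ideal :: "('i::finite \<Rightarrow> 'a::comm_ring_1) \<Rightarrow> 'a set" where
  "gen_ideal F = {\<Sum>i\<in>UNIV. c i * F i | c. True}"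

lemma gen_idealI: "p = (\<Sum>i\<in>UNIV. c i * F i) \<Longrightarrow> p \<in> gen_ideal F"
  by (auto simp: gen_ideal_def)

lemma is_ideal_gen_ideal: "is_ideal (gen_ideal F)"
  unfolding is_ideal_def
proof (intro conjI ballI allI)
  show "0 \<in> gen_ideal F" by (rule gen_idealI[where c = "\<lambda>_. 0"]) simp
next
  fix p q assume "p \<in> gen_ideal F" "q \<in> gen_ideal F"
  then obtain c d where "p = (\<Sum>i\<in>UNIV. c i * F i)" "q = (\<Sum>i\<in>UNIV. d i * F i)"
    by (auto simp: gen_ideal_def)
  then show "p + q \<in> gen_ideal F"
    by (intro gen_idealI[where c = "\<lambda>i. c i + d i"]) (simp add: distrib_right sum.distrib)
next
  fix p r assume "p \<in> gen_ideal F"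
  then obtain c where "p = (\<Sum>i\<in>UNIV. c i * F i)"
    by (auto simp: gen_ideal_def)
  then show "r * p \<in> gen_ideal F"
    by (intro gen_idealI[where c = "\<lambda>i. r * c i"]) (simp add: sum_distrib_left mult.assoc)
qed

lemma generator_in_gen_ideal: "F i \<in> gen_ideal F"
  by (rule gen_idealI[where c = "\<lambda>j. if j = i then 1 else 0"])
    (simp add: if_distrib[of "\<lambda>x. x * _"] cong: if_cong)

definition adjoin :: "'a::comm_ring_1 set \<Rightarrow> 'a \<Rightarrow> 'a set" where
  "adjoin I f = {p + r * f | p r. p \<in> I}"

lemma adjoinI: "p \<in> I \<Longrightarrow> p + r * f \<in> adjoin I f"
  by (auto simp: adjoin_def)

lemma is_ideal_adjoin: "is_ideal I \<Longrightarrow> is_ideal (adjoin I f)"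
  unfolding is_ideal_def[of "adjoin I f"]
proof (intro conjI ballI allI)
  assume I: "is_ideal I"
  show "0 \<in> adjoin I f" using adjoinI[OF is_ideal_0[OF I], of 0] by simp
  fix p q r assume "p \<in> adjoin I f" 
  then obtain p' a where p: "p = p' + a * f" "p' \<in> I" by (auto simp: adjoin_def)
  have "r * p = r * p' + (r * a) * f" unfolding p(1) by (simp add: algebra_simps)
  then show "r * p \<in> adjoin I f"
    using adjoinI[OF is_ideal_mult[OF I p(2)]] by metis
  assume "q \<in> adjoin I f" 
  then obtain q' b where q: "q = q' + b * f" "q' \<in> I" by (auto simp: adjoin_def)
  have "p + q = (p' + q') + (a + b) * f" unfolding p(1) q(1) by (simp add: algebra_simps)
  then show "p + q \<in> adjoin I f"
    using adjoinI[OF is_ideal_add[OF I p(2) q(2)]] by metis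
qed

lemma adjoin_superset: "I \<subseteq> adjoin I f"
  using adjoinI[of _ I 0 f] by auto

lemma adjoin_generator: "is_ideal I \<Longrightarrow> f \<in> adjoin I f"
  using adjoinI[OF is_ideal_0, of I 1 f] by simp

text \<open>The value of a one-variable polynomial at \<open>X\<close>: the ring homomorphism from
  C[T] to the polynomials in three variables that sends T to \<open>X\<close>.\<close>

definition subst_var :: "mpoly3 \<Rightarrow> complex poly \<Rightarrow> mpoly3" where
  "subst_var X g = poly (map_poly Const g) X"

lemma subst_var_0 [simp]: "subst_var X 0 = 0"
  by (simp add: subst_var_def)

lemma subst_var_pCons: "subst_var X (pCons a p) = Const a + X * subst_var X p"
  by (simp add: subst_var_def map_poly_pCons)

lemma subst_var_add: "subst_var X (p + q) = subst_var X p + subst_var X q"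
proof -
  have "map_poly Const (p + q) = map_poly Const p + map_poly Const q"
    by (rule poly_eqI) (simp add: coeff_map_poly Const_add)
  then show ?thesis by (simp add: subst_var_def)
qed

lemma subst_var_smult: "subst_var X (smult c p) = Const c * subst_var X p"
proof -
  have "map_poly Const (smult c p) = smult (Const c) (map_poly Const p)"
    by (rule poly_eqI) (simp add: coeff_map_poly Const_mult)
  then show ?thesis by (simp add: subst_var_def)
qed

lemma subst_var_mult: "subst_var X (p * q) = subst_var X p * subst_var X q"
  by (induction p)
    (simp_all add: subst_var_pCons subst_var_add subst_var_smult distrib_right mult.assoc)

lemma subst_var_sum: "subst_var X (sum f A) = (\<Sum>a\<in>A. subst_var X (f a))"
  by (induction A rule: infinite_finite_induct) (simp_all add: subst_var_add)

lemma subst_var_prod: "subst_var X (prod f A) = (\<Prod>a\<in>A. subst_var X (f a))"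
  by (induction A rule: infinite_finite_induct)
    (simp_all add: subst_var_mult, simp_all add: one_pCons subst_var_pCons)

lemma subst_var_linear: "subst_var X [:- a, 1:] = X - Const a"
  by (simp add: subst_var_pCons Const_uminus)

text \<open>Over the complex numbers \<open>g\<close> is a product of linear factors, and each of
  them becomes a unit modulo \<open>I\<close>. The induction on the degree splits off one
  root.\<close>

lemma subst_var_invertible:
  assumes I: "is_ideal I" and inv: "\<And>a. \<exists>q. q * (X - Const a) - 1 \<in> I" and "g \<noteq> 0"
  shows "\<exists>q. q * subst_var X g - 1 \<in> I"
  using \<open>g \<noteq> 0\<close>
proof (induction "degree g" arbitrary: g)
  case 0
  then obtain c where "g = [:c:]" "c \<noteq> 0" by (metis degree_eq_zeroE pCons_0_0)
  then have "Const (1 / c) * subst_var X g - 1 = 0"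
    by (simp add: subst_var_pCons flip: Const_mult)
  then show ?case using is_ideal_0[OF I] by metis
next
  case (Suc n)
  then obtain b where "poly g b = 0"
    by (metis constant_degree fundamental_theorem_of_algebra nat.distinct(1))
  then obtain h where h: "g = [:- b, 1:] * h" by (auto simp: poly_eq_0_iff_dvd)
  then have "h \<noteq> 0" using Suc by auto
  then have "degree g = Suc (degree h)" unfolding h by (subst degree_mult_eq) auto
  with Suc \<open>h \<noteq> 0\<close> obtain q where q: "q * subst_var X h - 1 \<in> I" by auto
  obtain r where r: "r * (X - Const b) - 1 \<in> I" using inv by blast
  have "(q * r) * subst_var X g - 1
      = (r * (X - Const b)) * (q * subst_var X h - 1) + (r * (X - Const b) - 1)"
    unfolding h subst_var_mult subst_var_linear by (simp add: algebra_simps)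
  also have "\<dots> \<in> I" using q r I by (intro is_ideal_add is_ideal_mult)
  finally show ?case by blast
qed

lemma uncountable_complex: "uncountable (UNIV :: complex set)"
proof
  assume "countable (UNIV :: complex set)"
  then have "countable (range complex_of_real)" by (rule countable_subset[rotated]) simp
  then have "countable (UNIV :: real set)"
    by (rule countable_image_inj_on) (simp add: inj_of_real)
  then show False using uncountable_UNIV_real by simp
qed

lemma finite_mdeg_le: "finite {m. mdeg m \<le> int k}"
proof (rule inj_on_finite)
  show "inj_on Poly_Mapping.lookup {m. mdeg m \<le> int k}"
    by (auto intro!: inj_onI poly_mapping_eqI)
  have "Poly_Mapping.lookup m i \<le> k" if "mdeg m \<le> int k" for m i
  proof -
    have "Poly_Mapping.lookup m i \<le> (\<Sum>i\<in>UNIV. Poly_Mapping.lookup m i)"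
      by (rule member_le_sum) auto
    then show ?thesis using that unfolding mdeg_def by linarith
  qed
  then show "Poly_Mapping.lookup ` {m. mdeg m \<le> int k} \<subseteq> PiE UNIV (\<lambda>_. {..k})"
    by (auto simp: PiE_def)
qed (auto intro: finite_PiE)

text \<open>Polynomials form a complex vector space of countable dimension, whereas \<open>\<complex>\<close> is
  uncountable.\<close>

lemma complex_family_dependent:
  fixes q :: "complex \<Rightarrow> mpoly3"
  assumes "inj q"
  shows "\<exists>A c. finite A \<and> (\<exists>a\<in>A. c a \<noteq> 0) \<and> (\<Sum>a\<in>A. Const (c a) * q a) = 0"
proof -
  interpret V: vector_space "\<lambda>c p. Const c * p"
    by unfold_locales (simp_all add: Const_add Const_mult algebra_simps)
  define T where "T k = {t. \<forall>m\<in>Poly_Mapping.keys (q t). mdeg m \<le> int k}" for k :: nat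
  have "\<exists>k. t \<in> T k" for t
  proof -
    obtain n where "\<forall>m\<in>Poly_Mapping.keys (q t). nat (mdeg m) < n"
      using finite_nat_set_iff_bounded[of "(nat \<circ> mdeg) ` Poly_Mapping.keys (q t)"] by auto
    then have "t \<in> T n" by (force simp: T_def)
    then show ?thesis by blast
  qed
  \<comment> \<open>Countably many sets \<open>T k\<close> cover an uncountable set, so one of them
    is infinite; the corresponding \<open>q t\<close> all lie in the finite-dimensional space of
    polynomials of degree at most \<open>k\<close>.\<close>
  then have "(\<Union>k. T k) = UNIV" by blast
  then obtain k where k: "infinite (T k)"
    using uncountable_complex by (metis countable_UN countable_finite countableI_type)
  define B where "B = (\<lambda>m. Poly_Mapping.single m (1::complex)) ` {m. mdeg m \<le> int k}"
  have fB: "finite B" unfolding B_def by (intro finite_imageI finite_mdeg_le)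
  have "q ` T k \<subseteq> V.span B"
  proof
    fix p assume "p \<in> q ` T k"
    then have deg: "Poly_Mapping.single m 1 \<in> B" if "m \<in> Poly_Mapping.keys p" for m
      using that by (auto simp: T_def B_def)
    have "p = (\<Sum>m\<in>Poly_Mapping.keys p. Const (Poly_Mapping.lookup p m) * Poly_Mapping.single m 1)"
      by (rule poly_mapping_eqI)
        (auto simp: lookup_sum lookup_Const_mult lookup_single when_def in_keys_iff sum.delta
          if_distrib[of "\<lambda>x. _ * x"] cong: if_cong)
    also have "\<dots> \<in> V.span B"
      by (intro V.span_sum V.span_scale V.span_base deg)
    finally show "p \<in> V.span B" .
  qed
  moreover have "infinite (q ` T k)"
    using k assms by (metis finite_imageD inj_on_subset subset_UNIV)
  ultimately have "V.dependent (q ` T k)"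
    using V.independent_span_bound[OF fB] by blast
  then obtain t u where t: "finite t" "t \<subseteq> q ` T k" "(\<Sum>v\<in>t. Const (u v) * v) = 0" "\<exists>v\<in>t. u v \<noteq> 0"
    unfolding V.dependent_explicit by blast
  then obtain A where A: "finite A" "t = q ` A" by (meson finite_subset_image)
  have "inj_on q A" using assms by (rule inj_on_subset) simp
  then have "(\<Sum>a\<in>A. Const (u (q a)) * q a) = 0" using t(3) A by (simp add: sum.reindex)
  then show ?thesis using A t(4) by (intro exI[of _ A] exI[of _ "u \<circ> q"]) auto
qed

text \<open>Otherwise every \<open>X - Const a\<close> has an inverse \<open>q a\<close> modulo
  \<open>I\<close>. The uncountably many \<open>q a\<close> satisfy a linear relation; clearing
  denominators turns it into a nonzero one-variable polynomial \<open>g\<close> whose value at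
  \<open>X\<close> lies in \<open>I\<close>. But this value is a unit modulo \<open>I\<close>, so
  \<open>I\<close> would contain 1.\<close>

lemma proper_ideal_adjoin_var:
  assumes I: "is_ideal I" and "1 \<notin> I"
  shows "\<exists>a. 1 \<notin> adjoin I (X - Const a)"
proof (rule ccontr)
  assume neg: "\<nexists>a. 1 \<notin> adjoin I (X - Const a)"
  have "\<exists>q. q * (X - Const a) - 1 \<in> I" for a
  proof -
    from neg have "1 \<in> adjoin I (X - Const a)" by blast
    then obtain p r where "1 = p + r * (X - Const a)" "p \<in> I"
      unfolding adjoin_def by blast
    then have "r * (X - Const a) - 1 = - p" "p \<in> I" by (simp_all add: algebra_simps)
    then show ?thesis using is_ideal_uminus[OF I] by metis
  qed
  then obtain q where q: "\<And>a. q a * (X - Const a) - 1 \<in> I" by metis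
  \<comment> \<open>A common inverse of \<open>X - Const a\<close> and \<open>X - Const b\<close>
    would satisfy \<open>q a * (Const b - Const a) \<in> I\<close>, hence lie in \<open>I\<close>,
    and then so would 1.\<close>
  have "inj q"
  proof (rule injI, rule ccontr)
    fix a b assume eq: "q a = q b" and "a \<noteq> b"
    have c: "Const (1 / (b - a)) * (Const b - Const a) = 1"
      using \<open>a \<noteq> b\<close> by (simp flip: Const_diff Const_mult)
    have "(q a * (X - Const a) - 1) - (q b * (X - Const b) - 1) \<in> I"
      using is_ideal_diff[OF I q q] .
    moreover have "(q a * (X - Const a) - 1) - (q b * (X - Const b) - 1) = q a * (Const b - Const a)"
      unfolding eq by (simp add: algebra_simps)
    ultimately have "Const (1 / (b - a)) * (q a * (Const b - Const a)) \<in> I"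
      using is_ideal_mult[OF I] by metis
    then have "q a \<in> I" using c by (simp add: mult.left_commute)
    from is_ideal_diff[OF I is_ideal_mult_right[OF I this, of "X - Const a"] q[of a]]
    show False using \<open>1 \<notin> I\<close> by simp
  qed
  from complex_family_dependent[OF this] obtain A c a0
    where A: "finite A" "a0 \<in> A" "c a0 \<noteq> 0" "(\<Sum>a\<in>A. Const (c a) * q a) = 0" by blast
  \<comment> \<open>The numerator of the sum of the fractions \<open>c a / (T - a)\<close>. At the
    point \<open>a0\<close> only the summand with index \<open>a0\<close> survives, which shows that
    \<open>g\<close> is nonzero.\<close>
  define g where "g = (\<Sum>a\<in>A. smult (c a) (\<Prod>l\<in>A - {a}. [:- l, 1:]))"
  have "poly g a0 = (\<Sum>a\<in>A. c a * (\<Prod>l\<in>A - {a}. a0 - l))"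
    by (simp add: g_def poly_sum poly_prod)
  also have "\<dots> = c a0 * (\<Prod>l\<in>A - {a0}. a0 - l)"
    using A by (subst sum.remove[of _ a0]) (auto intro!: sum.neutral)
  also have "\<dots> \<noteq> 0" using A by auto
  finally have "g \<noteq> 0" by auto
  with subst_var_invertible[OF I] q obtain r where r: "r * subst_var X g - 1 \<in> I" by blast
  define P where "P B = (\<Prod>l\<in>B. X - Const l)" for B
  have P: "P A = (X - Const a) * P (A - {a})" if "a \<in> A" for a
    unfolding P_def using A(1) that by (rule prod.remove)
  have "subst_var X g = (\<Sum>a\<in>A. Const (c a) * P (A - {a}))"
    unfolding g_def P_def by (simp add: subst_var_sum subst_var_smult subst_var_prod subst_var_linear)
  \<comment> \<open>Subtracting zero, in the form of the linear relation multiplied by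
    \<open>P A\<close>, exhibits each summand as a multiple of some
    \<open>q a * (X - Const a) - 1\<close>.\<close>
  also have "\<dots> = (\<Sum>a\<in>A. Const (c a) * P (A - {a})) - P A * (\<Sum>a\<in>A. Const (c a) * q a)"
    by (simp add: A)
  also have "\<dots> = (\<Sum>a\<in>A. (- Const (c a) * P (A - {a})) * (q a * (X - Const a) - 1))"
    unfolding sum_distrib_left sum_subtractf[symmetric]
    by (rule sum.cong) (simp_all add: P algebra_simps)
  also have "\<dots> \<in> I"
    by (intro is_ideal_sum[OF I] is_ideal_mult[OF I] q)
  finally have "subst_var X g \<in> I" .
  from is_ideal_diff[OF I is_ideal_mult[OF I this, of r] r] show False
    using \<open>1 \<notin> I\<close> by simp
qed

lemma prod_UNIV_3: "(\<Prod>i\<in>(UNIV::3 set). f i) = f 0 * f 1 * f 2"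
  unfolding UNIV_3_012 by (simp add: mult_ac)

text \<open>Modulo \<open>I\<close> every variable is a constant, and congruence to constants is
  preserved by powers, products and sums.\<close>

lemma eval_poly_cong_mod_ideal:
  assumes I: "is_ideal I" and v: "\<And>i. Var i - Const (v $ i) \<in> I"
  shows "p - Const (eval_poly p v) \<in> I"
proof (induction p rule: poly_mapping_single_induct)
  case (2 m c p)
  have pw: "Var i ^ k - Const ((v $ i) ^ k) \<in> I" for i k
  proof (induction k)
    case (Suc k)
    have "Var i ^ Suc k - Const ((v $ i) ^ Suc k)
      = Var i * (Var i ^ k - Const ((v $ i) ^ k)) + Const ((v $ i) ^ k) * (Var i - Const (v $ i))"
      by (simp add: Const_mult algebra_simps)
    then show ?case using Suc v I by (simp only: is_ideal_add is_ideal_mult)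
  qed (simp add: is_ideal_0[OF I])
  have mul: "a * b - Const (s * t) \<in> I" if "a - Const s \<in> I" "b - Const t \<in> I" for a b s t
  proof -
    have "a * b - Const (s * t) = a * (b - Const t) + Const t * (a - Const s)"
      by (simp add: Const_mult algebra_simps)
    then show ?thesis using that I by (simp only: is_ideal_add is_ideal_mult)
  qed
  have m: "m = Poly_Mapping.single 0 (Poly_Mapping.lookup m 0) + Poly_Mapping.single 1 (Poly_Mapping.lookup m 1)
      + Poly_Mapping.single 2 (Poly_Mapping.lookup m 2)"
  proof (rule poly_mapping_eqI)
    have "\<forall>k. Poly_Mapping.lookup m k = Poly_Mapping.lookup (Poly_Mapping.single 0 (Poly_Mapping.lookup m 0)
        + Poly_Mapping.single 1 (Poly_Mapping.lookup m 1) + Poly_Mapping.single 2 (Poly_Mapping.lookup m 2)) k"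
      unfolding forall_3_012 by (simp add: lookup_add lookup_single when_def)
    then show "Poly_Mapping.lookup m k = Poly_Mapping.lookup (Poly_Mapping.single 0 (Poly_Mapping.lookup m 0)
        + Poly_Mapping.single 1 (Poly_Mapping.lookup m 1) + Poly_Mapping.single 2 (Poly_Mapping.lookup m 2)) k" for k
      by blast
  qed
  have "Const c * (Var 0 ^ Poly_Mapping.lookup m 0 * Var 1 ^ Poly_Mapping.lookup m 1
     * Var 2 ^ Poly_Mapping.lookup m 2) = Poly_Mapping.single (Poly_Mapping.single 0 (Poly_Mapping.lookup m 0)
        + Poly_Mapping.single 1 (Poly_Mapping.lookup m 1) + Poly_Mapping.single 2 (Poly_Mapping.lookup m 2)) c"
    by (simp add: Var_power mult_single Const_def)
  also have "\<dots> = Poly_Mapping.single m c" by (simp only: m[symmetric])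
  finally have "Poly_Mapping.single m c = Const c * (Var 0 ^ Poly_Mapping.lookup m 0 * Var 1 ^ Poly_Mapping.lookup m 1
     * Var 2 ^ Poly_Mapping.lookup m 2)" by (rule sym)
  also have "\<dots> - Const (c * (v $ 0 ^ Poly_Mapping.lookup m 0 * v $ 1 ^ Poly_Mapping.lookup m 1
     * v $ 2 ^ Poly_Mapping.lookup m 2)) \<in> I"
    by (intro mul pw) (simp add: is_ideal_0[OF I])
  also have "c * (v $ 0 ^ Poly_Mapping.lookup m 0 * v $ 1 ^ Poly_Mapping.lookup m 1
     * v $ 2 ^ Poly_Mapping.lookup m 2) = eval_poly (Poly_Mapping.single m c) v"
    by (simp add: eval_poly_single prod_UNIV_3)
  finally have "Poly_Mapping.single m c - Const (eval_poly (Poly_Mapping.single m c) v) \<in> I" .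
  from is_ideal_add[OF I this 2] show ?case
    by (simp add: eval_poly_add Const_add algebra_simps)
qed (simp add: is_ideal_0[OF I])

text \<open>The weak Nullstellensatz. Adjoining \<open>Var i - Const a\<close> for one variable
  after another keeps the ideal proper, and the constants found are the coordinates of the zero: any
  element of \<open>I\<close> is congruent to its value there, so a nonzero value would be a unit in
  a proper ideal.\<close>

lemma proper_ideal_has_zero:
  assumes I: "is_ideal I" and "1 \<notin> I"
  shows "\<exists>v. \<forall>p\<in>I. eval_poly p v = 0"
proof -
  obtain a where a: "1 \<notin> adjoin I (Var 0 - Const a)"
    using proper_ideal_adjoin_var[OF assms] by blast
  define I1 where "I1 = adjoin I (Var 0 - Const a)"
  have I1: "is_ideal I1" "1 \<notin> I1" using a I by (auto simp: I1_def is_ideal_adjoin)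
  obtain b where b: "1 \<notin> adjoin I1 (Var 1 - Const b)"
    using proper_ideal_adjoin_var[OF I1] by blast
  define I2 where "I2 = adjoin I1 (Var 1 - Const b)"
  have I2: "is_ideal I2" "1 \<notin> I2" using b I1 by (auto simp: I2_def is_ideal_adjoin)
  obtain c where c: "1 \<notin> adjoin I2 (Var 2 - Const c)"
    using proper_ideal_adjoin_var[OF I2] by blast
  define I3 where "I3 = adjoin I2 (Var 2 - Const c)"
  have I3: "is_ideal I3" "1 \<notin> I3" using c I2 by (auto simp: I3_def is_ideal_adjoin)
  have sub: "I \<subseteq> I1" "I1 \<subseteq> I2" "I2 \<subseteq> I3"
    by (simp_all add: I1_def I2_def I3_def adjoin_superset)
  define v :: "complex ^ 3" where "v = (\<chi> i. if i = 0 then a else if i = 1 then b else c)"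
  have "\<forall>i. Var i - Const (v $ i) \<in> I3"
    unfolding forall_3_012
    using sub adjoin_generator[OF I] adjoin_generator[OF I1(1)] adjoin_generator[OF I2(1)]
    by (auto simp: v_def I1_def I2_def I3_def)
  then have cong: "p - Const (eval_poly p v) \<in> I3" for p
    by (intro eval_poly_cong_mod_ideal I3) auto
  have "eval_poly p v = 0" if "p \<in> I" for p
  proof (rule ccontr)
    assume nz: "eval_poly p v \<noteq> 0"
    have "p \<in> I3" using that sub by blast
    from is_ideal_diff[OF I3(1) this cong[of p]] have "Const (eval_poly p v) \<in> I3" by simp
    from is_ideal_mult[OF I3(1) this, of "Const (1 / eval_poly p v)"] nz show False
      using I3(2) by (simp flip: Const_mult)
  qed
  then show ?thesis by blast
qed

lemma hcomp_gen_ideal: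
  assumes "\<And>i. homogeneous d (F i)" "p \<in> gen_ideal F"
  shows "\<exists>c. (\<forall>i. homogeneous (k - d) (c i)) \<and> hcomp k p = (\<Sum>i\<in>UNIV. c i * F i)"
proof -
  obtain c where p: "p = (\<Sum>i\<in>UNIV. F i * c i)"
    using assms(2) by (auto simp: gen_ideal_def mult.commute)
  have "hcomp k p = (\<Sum>i\<in>UNIV. hcomp (k - d) (c i) * F i)"
    unfolding p hcomp_sum hcomp_mult[OF assms(1)] by (simp add: mult.commute)
  then show ?thesis by (intro exI[of _ "\<lambda>i. hcomp (k - d) (c i)"]) simp
qed

text \<open>Dehomogenize at \<open>Var j = 1\<close>: the ideal \<open>I\<close> together with
  \<open>Var j - 1\<close> has no zero, hence contains 1. Comparing the homogeneous components of
  such a representation of 1 brings a power of \<open>Var j\<close> into \<open>I\<close>.\<close>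

lemma homogeneous_nullstellensatz:
  fixes F :: "'i::finite \<Rightarrow> mpoly3"
  assumes hom: "\<And>i. homogeneous d (F i)"
    and zeros: "\<And>v. v \<noteq> 0 \<Longrightarrow> \<exists>i. eval_poly (F i) v \<noteq> 0"
  shows "\<exists>N. Var j ^ N \<in> gen_ideal F"
proof -
  define I where "I = gen_ideal F"
  have I: "is_ideal I" by (simp add: I_def is_ideal_gen_ideal)
  have hI: "hcomp k p \<in> I" if "p \<in> I" for k p
    using hcomp_gen_ideal[OF hom that[unfolded I_def], of k] gen_idealI unfolding I_def by metis
  have "1 \<in> adjoin I (Var j - 1)"
  proof (rule ccontr)
    assume "1 \<notin> adjoin I (Var j - 1)"
    from proper_ideal_has_zero[OF is_ideal_adjoin[OF I] this]
    obtain v where v: "\<forall>p\<in>adjoin I (Var j - 1). eval_poly p v = 0" by blast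
    \<comment> \<open>The zero has \<open>j\<close>-th coordinate 1, so it is not the
      origin.\<close>
    have "eval_poly (Var j + Const (-1)) v = 0"
      using v adjoin_generator[OF I] by (simp add: Const_uminus)
    then have "v \<noteq> 0" unfolding eval_poly_add by auto
    with zeros obtain i where "eval_poly (F i) v \<noteq> 0" by blast
    moreover have "F i \<in> adjoin I (Var j - 1)"
      using adjoin_superset generator_in_gen_ideal unfolding I_def by blast
    ultimately show False using v by blast
  qed
  then obtain f c where f: "f \<in> I" and eq: "1 = f + (Var j * c - c)"
    by (auto simp: adjoin_def algebra_simps)
  \<comment> \<open>The degree \<open>k\<close> part of \<open>eq\<close>; the constant 1
    contributes in degree 0 only.\<close>
  have rec: "hcomp k c = Var j * hcomp (k - 1) c + hcomp k f - (if k = 0 then 1 else 0)" for k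
  proof -
    have "hcomp k 1 = hcomp k f + (Var j * hcomp (k - 1) c - hcomp k c)"
      unfolding hcomp_mult[OF homogeneous_Var, symmetric] hcomp_add[symmetric] hcomp_diff[symmetric]
      using eq by simp
    then show ?thesis by (simp add: hcomp_homogeneous[OF homogeneous_1] algebra_simps)
  qed
  \<comment> \<open>The recursion makes the components of \<open>c\<close> congruent to minus the
    powers of \<open>Var j\<close>. As \<open>c\<close> has only finitely many nonzero components,
    some power lies in \<open>I\<close>.\<close>
  have "hcomp (int k) c + Var j ^ k \<in> I" for k
  proof (induction k)
    case 0
    show ?case using hI[OF f, of 0] rec[of 0] by (simp add: hcomp_neg)
  next
    case (Suc k)
    have "hcomp (int (Suc k)) c + Var j ^ Suc k
      = Var j * (hcomp (int k) c + Var j ^ k) + hcomp (int (Suc k)) f"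
      using rec[of "int (Suc k)"] by (simp add: algebra_simps)
    then show ?case using Suc hI[OF f] I by (simp only: is_ideal_add is_ideal_mult)
  qed
  moreover obtain k where "hcomp (int k) c = 0" using hcomp_eventually_0 by blast
  ultimately have "Var j ^ k \<in> I" by (metis add_0)
  then show ?thesis by (auto simp: I_def)
qed

subsection \<open>The Jacobian determinant generates the socle\<close>

lemma det_UNIV_3:
  fixes A :: "'a::comm_ring_1 ^ 3 ^ 3"
  shows "det A = A $ 0 $ 0 * A $ 1 $ 1 * A $ 2 $ 2 + A $ 0 $ 1 * A $ 1 $ 2 * A $ 2 $ 0
    + A $ 0 $ 2 * A $ 1 $ 0 * A $ 2 $ 1 - A $ 0 $ 0 * A $ 1 $ 2 * A $ 2 $ 1
    - A $ 0 $ 1 * A $ 1 $ 0 * A $ 2 $ 2 - A $ 0 $ 2 * A $ 1 $ 1 * A $ 2 $ 0"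
proof -
  have "(3::3) = 0" by simp
  show ?thesis unfolding det_3 \<open>(3::3) = 0\<close> by (simp add: algebra_simps)
qed

text \<open>
  If \<open>y = A F\<close> for a regular sequence \<open>y\<close>, multiplication by \<open>det A\<close> is injective from
  \<open>R/(F)\<close> to \<open>R/(y)\<close> (Wiebe). The proof descends the Koszul complex of \<open>F\<close>: writing
  \<open>A\<^sub>i\<close> for the rows of \<open>A\<close>, the elements \<open>h det A\<close>, \<open>h (A\<^sub>0 \<times> A\<^sub>1)\<close>, \<open>h A\<^sub>0\<close> and \<open>h\<close>
  are successively boundaries modulo \<open>(y\<^sub>0,y\<^sub>1,y\<^sub>2)\<close>, \<open>(y\<^sub>0,y\<^sub>1)\<close>, \<open>(y\<^sub>0)\<close> and \<open>0\<close>.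
\<close>

lemma wiebe:
  fixes F0 F1 F2 h :: "'a::idom"
  assumes y0: "y0 = a0 * F0 + a1 * F1 + a2 * F2"
    and y1: "y1 = b0 * F0 + b1 * F1 + b2 * F2"
    and y2: "y2 = c0 * F0 + c1 * F1 + c2 * F2"
    and "y0 \<noteq> 0"
    and reg1: "\<And>p a. y1 * p = y0 * a \<Longrightarrow> \<exists>c. p = y0 * c"
    and reg2: "\<And>p a b. y2 * p = y0 * a + y1 * b \<Longrightarrow> \<exists>c d. p = y0 * c + y1 * d"
    and h: "h * (c0 * (a1 * b2 - a2 * b1) + c1 * (a2 * b0 - a0 * b2) + c2 * (a0 * b1 - a1 * b0))
      = p0 * y0 + p1 * y1 + p2 * y2"
  shows "\<exists>t0 t1 t2. h = t0 * F0 + t1 * F1 + t2 * F2"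
proof -
  let ?D = "c0 * (a1 * b2 - a2 * b1) + c1 * (a2 * b0 - a0 * b2) + c2 * (a0 * b1 - a1 * b0)"
  have "y2 * (h * (a1 * b2 - a2 * b1) - p2 * F0)
      = y0 * (p0 * F0 - h * (b1 * c2 - b2 * c1)) + y1 * (p1 * F0 + h * (a1 * c2 - a2 * c1))"
  proof -
    have "y2 * (h * (a1 * b2 - a2 * b1)) 
      = F0 * (h * ?D) - h * (y0 * (b1 * c2 - b2 * c1) - y1 * (a1 * c2 - a2 * c1))"
      unfolding y0 y1 y2 by (simp add: algebra_simps)
    then show ?thesis unfolding h by (simp add: algebra_simps)
  qed
  from reg2[OF this] obtain s0 q0 where w0: "h * (a1 * b2 - a2 * b1) = p2 * F0 + y0 * s0 + y1 * q0"
    by (auto simp: algebra_simps)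
  have "y2 * (h * (a2 * b0 - a0 * b2) - p2 * F1)
      = y0 * (p0 * F1 - h * (b2 * c0 - b0 * c2)) + y1 * (p1 * F1 + h * (a2 * c0 - a0 * c2))"
  proof -
    have "y2 * (h * (a2 * b0 - a0 * b2)) 
      = F1 * (h * ?D) - h * (y0 * (b2 * c0 - b0 * c2) - y1 * (a2 * c0 - a0 * c2))"
      unfolding y0 y1 y2 by (simp add: algebra_simps)
    then show ?thesis unfolding h by (simp add: algebra_simps)
  qed
  from reg2[OF this] obtain s1 q1 where w1: "h * (a2 * b0 - a0 * b2) = p2 * F1 + y0 * s1 + y1 * q1"
    by (auto simp: algebra_simps)
  have "y2 * (h * (a0 * b1 - a1 * b0) - p2 * F2)
      = y0 * (p0 * F2 - h * (b0 * c1 - b1 * c0)) + y1 * (p1 * F2 + h * (a0 * c1 - a1 * c0))"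
  proof -
    have "y2 * (h * (a0 * b1 - a1 * b0)) 
      = F2 * (h * ?D) - h * (y0 * (b0 * c1 - b1 * c0) - y1 * (a0 * c1 - a1 * c0))"
      unfolding y0 y1 y2 by (simp add: algebra_simps)
    then show ?thesis unfolding h by (simp add: algebra_simps)
  qed
  from reg2[OF this] obtain s2 q2 where w2: "h * (a0 * b1 - a1 * b0) = p2 * F2 + y0 * s2 + y1 * q2"
    by (auto simp: algebra_simps)
  have "y1 * (h * a0 - (F1 * q2 - F2 * q1)) = y0 * (h * b0 + (F1 * s2 - F2 * s1))"
  proof -
    have "y1 * (h * a0) = y0 * (h * b0) + (F1 * (h * (a0 * b1 - a1 * b0)) - F2 * (h * (a2 * b0 - a0 * b2)))"
      unfolding y0 y1 by (simp add: algebra_simps)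
    then show ?thesis unfolding w1 w2 by (simp add: algebra_simps)
  qed
  from reg1[OF this] obtain t0 where v0: "h * a0 = (F1 * q2 - F2 * q1) + y0 * t0"
    by (auto simp: algebra_simps)
  have "y1 * (h * a1 - (F2 * q0 - F0 * q2)) = y0 * (h * b1 + (F2 * s0 - F0 * s2))"
  proof -
    have "y1 * (h * a1) = y0 * (h * b1) + (F2 * (h * (a1 * b2 - a2 * b1)) - F0 * (h * (a0 * b1 - a1 * b0)))"
      unfolding y0 y1 by (simp add: algebra_simps)
    then show ?thesis unfolding w0 w2 by (simp add: algebra_simps)
  qed
  from reg1[OF this] obtain t1 where v1: "h * a1 = (F2 * q0 - F0 * q2) + y0 * t1"
    by (auto simp: algebra_simps)
  have "y1 * (h * a2 - (F0 * q1 - F1 * q0)) = y0 * (h * b2 + (F0 * s1 - F1 * s0))"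
  proof -
    have "y1 * (h * a2) = y0 * (h * b2) + (F0 * (h * (a2 * b0 - a0 * b2)) - F1 * (h * (a1 * b2 - a2 * b1)))"
      unfolding y0 y1 by (simp add: algebra_simps)
    then show ?thesis unfolding w0 w1 by (simp add: algebra_simps)
  qed
  from reg1[OF this] obtain t2 where v2: "h * a2 = (F0 * q1 - F1 * q0) + y0 * t2"
    by (auto simp: algebra_simps)
  have "y0 * h = (h * a0) * F0 + (h * a1) * F1 + (h * a2) * F2"
    unfolding y0 by (simp add: algebra_simps)
  also have "\<dots> = y0 * (t0 * F0 + t1 * F1 + t2 * F2)"
    unfolding v0 v1 v2 by (simp add: algebra_simps)
  finally have "h = t0 * F0 + t1 * F1 + t2 * F2" using \<open>y0 \<noteq> 0\<close> by simp
  then show ?thesis by blast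
qed

lemma gen_ideal_3:
  fixes F :: "3 \<Rightarrow> 'a::comm_ring_1"
  shows "p \<in> gen_ideal F \<longleftrightarrow> (\<exists>a b c. p = a * F 0 + b * F 1 + c * F 2)"
proof
  assume "\<exists>a b c. p = a * F 0 + b * F 1 + c * F 2"
  then obtain a b c where "p = a * F 0 + b * F 1 + c * F 2" by blast
  then show "p \<in> gen_ideal F"
    by (intro gen_idealI[where c = "\<lambda>i. if i = 0 then a else if i = 1 then b else c"])
      (simp add: sum_UNIV_3)
qed (auto simp: gen_ideal_def sum_UNIV_3)

lemma pow_ideal_eq_gen_ideal: "pow_ideal N UNIV = gen_ideal (\<lambda>i. Var i ^ N)"
  by (simp add: pow_ideal_def gen_ideal_def)

text \<open>The injectivity statement \<open>wiebe\<close>, applied to the regular sequence of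
  powers of the variables.\<close>

lemma det_mult_cancel:
  fixes F :: "3 \<Rightarrow> mpoly3"
  assumes A: "\<And>i. Var i ^ N = (\<Sum>j\<in>UNIV. A $ i $ j * F j)"
    and h: "det A * h \<in> pow_ideal N UNIV"
  shows "h \<in> gen_ideal F"
proof -
  obtain p0 p1 p2 where p: "det A * h = p0 * Var 0 ^ N + p1 * Var 1 ^ N + p2 * Var 2 ^ N"
    using h by (auto simp: pow_ideal_UNIV)
  show ?thesis
    unfolding gen_ideal_3
  proof (rule wiebe[OF A[of 0, unfolded sum_UNIV_3] A[of 1, unfolded sum_UNIV_3] A[of 2, unfolded sum_UNIV_3]])
    show "Var 0 ^ N \<noteq> 0" by simp
    show "Var 1 ^ N * p = Var 0 ^ N * a \<Longrightarrow> \<exists>c. p = Var 0 ^ N * c" for p a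
      by (rule Var_powers_regular)
    show "Var 2 ^ N * p = Var 0 ^ N * a + Var 1 ^ N * b \<Longrightarrow> \<exists>c d. p = Var 0 ^ N * c + Var 1 ^ N * d" for p a b
      by (rule Var_powers_regular)
    show "h * (A $ 2 $ 0 * (A $ 0 $ 1 * A $ 1 $ 2 - A $ 0 $ 2 * A $ 1 $ 1)
      + A $ 2 $ 1 * (A $ 0 $ 2 * A $ 1 $ 0 - A $ 0 $ 0 * A $ 1 $ 2)
      + A $ 2 $ 2 * (A $ 0 $ 0 * A $ 1 $ 1 - A $ 0 $ 1 * A $ 1 $ 0))
      = p0 * Var 0 ^ N + p1 * Var 1 ^ N + p2 * Var 2 ^ N"
      unfolding p[symmetric] det_UNIV_3 by (simp add: algebra_simps)
  qed
qed

text \<open>Cramer's rule: the adjugate of \<open>A\<close> expresses each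
  \<open>det A * F i\<close> through the \<open>y i\<close>. So multiplication by
  \<open>det A\<close> is well defined on the quotients.\<close>

lemma det_mult_gen_ideal:
  fixes F :: "3 \<Rightarrow> 'a::comm_ring_1"
  assumes A: "\<And>i. y i = (\<Sum>j\<in>UNIV. A $ i $ j * F j)" and "x \<in> gen_ideal F"
  shows "det A * x \<in> gen_ideal y"
proof -
  have 0: "det A * F 0 = (A$1$1 * A$2$2 - A$1$2 * A$2$1) * y 0 + (A$0$2 * A$2$1 - A$0$1 * A$2$2) * y 1
      + (A$0$1 * A$1$2 - A$0$2 * A$1$1) * y 2"
    unfolding A sum_UNIV_3 det_UNIV_3 by (simp add: algebra_simps)
  have 1: "det A * F 1 = (A$1$2 * A$2$0 - A$1$0 * A$2$2) * y 0 + (A$0$0 * A$2$2 - A$0$2 * A$2$0) * y 1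
      + (A$0$2 * A$1$0 - A$0$0 * A$1$2) * y 2"
    unfolding A sum_UNIV_3 det_UNIV_3 by (simp add: algebra_simps)
  have 2: "det A * F 2 = (A$1$0 * A$2$1 - A$1$1 * A$2$0) * y 0 + (A$0$1 * A$2$0 - A$0$0 * A$2$1) * y 1
      + (A$0$0 * A$1$1 - A$0$1 * A$1$0) * y 2"
    unfolding A sum_UNIV_3 det_UNIV_3 by (simp add: algebra_simps)
  have "\<forall>i. det A * F i \<in> gen_ideal y"
    unfolding forall_3_012 gen_ideal_3 using 0 1 2 by blast
  moreover obtain c where "x = (\<Sum>i\<in>UNIV. c i * F i)" using assms(2) by (auto simp: gen_ideal_def)
  then have "det A * x = (\<Sum>i\<in>UNIV. c i * (det A * F i))"
    by (simp add: sum_distrib_left mult_ac)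
  ultimately show ?thesis
    using is_ideal_gen_ideal[of y] by (simp add: is_ideal_sum is_ideal_mult)
qed

lemma homogeneous_det:
  assumes "\<And>i j. homogeneous d (A $ i $ j)"
  shows "homogeneous (3 * d) (det (A :: mpoly3 ^ 3 ^ 3))"
  unfolding det_UNIV_3
  by (intro homogeneous_add homogeneous_diff homogeneous_mult'[OF homogeneous_mult'[OF assms assms refl] assms])
    simp_all

definition jacobian :: "(3 \<Rightarrow> mpoly3) \<Rightarrow> mpoly3" where
  "jacobian F = det (\<chi> i j. pd j (F i))"

context
  fixes F :: "3 \<Rightarrow> mpoly3" and d :: nat
  assumes d: "d > 0" and hom: "\<And>i. homogeneous (int d) (F i)"
    and zeros: "\<And>v. v \<noteq> 0 \<Longrightarrow> \<exists>i. eval_poly (F i) v \<noteq> 0"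
begin

lemma ex_Var_power_matrix:
  "\<exists>N (A :: mpoly3 ^ 3 ^ 3). N > 0 \<and> (\<forall>i. Var i ^ N = (\<Sum>j\<in>UNIV. A $ i $ j * F j)) \<and>
    (\<forall>i j. homogeneous (int N - int d) (A $ i $ j))"
proof -
  obtain M where M: "\<And>i. Var i ^ M i \<in> gen_ideal F"
    using homogeneous_nullstellensatz[OF hom zeros] by metis
  \<comment> \<open>One exponent that serves all three variables; the successor makes it positive,
    as the socle monomial with exponent \<open>N - 1\<close> requires.\<close>
  define N where "N = Suc (\<Sum>i\<in>UNIV. M i)"
  have in_ideal: "Var i ^ N \<in> gen_ideal F" for i
  proof -
    have "M i \<le> (\<Sum>i\<in>UNIV. M i)" by (rule member_le_sum) auto
    then have "M i \<le> N" by (simp add: N_def)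
    then have "Var i ^ N = Var i ^ (N - M i) * Var i ^ M i" by (simp flip: power_add)
    then show ?thesis using is_ideal_mult[OF is_ideal_gen_ideal M[of i]] by simp
  qed
  have homN: "homogeneous (int N) (Var i ^ N)" for i
    using homogeneous_power[OF homogeneous_Var, of N i] by simp
  \<comment> \<open>Passing to the component of degree \<open>N\<close> makes the coefficients
    homogeneous.\<close>
  have "\<exists>c. (\<forall>j. homogeneous (int N - int d) (c j)) \<and> Var i ^ N = (\<Sum>j\<in>UNIV. c j * F j)" for i
    using hcomp_gen_ideal[OF hom in_ideal[of i], of "int N"] by (simp add: hcomp_homogeneous[OF homN])
  then obtain c where c: "\<And>i. (\<forall>j. homogeneous (int N - int d) (c i j)) \<and> Var i ^ N = (\<Sum>j\<in>UNIV. c i j * F j)"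
    by metis
  have "N > 0" by (simp add: N_def)
  with c show ?thesis
    by (intro exI[of _ N] exI[of _ "\<chi> i j. c i j"]) (simp only: vec_lambda_beta, blast)
qed

text \<open>Membership would allow \<open>det_mult_cancel\<close> with the variables themselves in
  the role of \<open>F\<close> and with \<open>h = 1\<close>, placing 1 in the ideal of the
  origin.\<close>

lemma det_mult_jacobian_notin:
  assumes A: "\<And>i. Var i ^ N = (\<Sum>j\<in>UNIV. A $ i $ j * F j)"
  shows "det A * jacobian F \<notin> pow_ideal N UNIV"
proof
  assume in_pow: "det A * jacobian F \<in> pow_ideal N UNIV"
  define c where "c = Const (1 / of_nat d)"
  have c: "c * of_nat d = 1" using d by (simp add: c_def flip: Const_of_nat Const_mult)
  \<comment> \<open>The Jacobian matrix divided by \<open>d\<close>: by Euler's relation it carries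
    the vector of variables to \<open>F\<close>, so \<open>A ** M\<close> carries it to the vector
    of \<open>N\<close>-th powers.\<close>
  define M :: "mpoly3 ^ 3 ^ 3" where "M = (\<chi> i j. c * pd j (F i))"
  have F: "F i = (\<Sum>k\<in>UNIV. M $ i $ k * Var k)" for i
  proof -
    have "(\<Sum>k\<in>UNIV. M $ i $ k * Var k) = c * (\<Sum>k\<in>UNIV. Var k * pd k (F i))"
      by (simp add: M_def sum_distrib_left mult_ac)
    also have "\<dots> = (c * of_nat d) * F i"
      by (simp only: euler_identity[OF hom] mult.assoc)
    finally show ?thesis by (simp add: c)
  qed
  have "Var i ^ N = (\<Sum>k\<in>UNIV. (A ** M) $ i $ k * Var k)" for i
  proof -
    have "Var i ^ N = (\<Sum>j\<in>UNIV. A $ i $ j * (\<Sum>k\<in>UNIV. M $ j $ k * Var k))"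
      unfolding A[of i] by (intro sum.cong refl arg_cong[of _ _ "(*) _"] F)
    then show ?thesis by (simp add: matrix_matrix_mult_def sum_UNIV_3 algebra_simps)
  qed
  moreover have "det (A ** M) * 1 \<in> pow_ideal N UNIV"
  proof -
    have "det M = c ^ 3 * jacobian F"
      by (simp add: M_def jacobian_def det_UNIV_3 algebra_simps power3_eq_cube)
    then have "det (A ** M) * 1 = c ^ 3 * (det A * jacobian F)"
      by (simp add: det_mul mult_ac)
    then show ?thesis using pow_ideal_mult[OF in_pow, of "c ^ 3"] by (simp only:)
  qed
  ultimately have "1 \<in> gen_ideal Var" by (rule det_mult_cancel)
  then obtain a b c where 1: "1 = a * Var 0 + b * Var 1 + c * Var 2" by (auto simp: gen_ideal_3)
  have "eval_poly 1 0 = 0" unfolding 1 by (simp add: eval_poly_add eval_poly_mult)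
  then show False by simp
qed

lemma jacobian_notin: "jacobian F \<notin> gen_ideal F"
proof
  assume J: "jacobian F \<in> gen_ideal F"
  obtain N A where A: "\<And>i. Var i ^ N = (\<Sum>j\<in>UNIV. A $ i $ j * F j)"
    using ex_Var_power_matrix by blast
  from det_mult_gen_ideal[of "\<lambda>i. Var i ^ N", OF A J] det_mult_jacobian_notin[OF A] show False
    by (simp add: pow_ideal_eq_gen_ideal)
qed

text \<open>Multiplied by \<open>det A\<close>, both \<open>h\<close> and the Jacobian have degree
  \<open>3 * N - 3\<close>, so modulo the powers of the variables each is a multiple of the socle
  monomial. The multiple belonging to the Jacobian is nonzero, and cancelling \<open>det A\<close>
  transports the proportionality back.\<close>

lemma jacobian_generates_socle:
  assumes h: "homogeneous (3 * int d - 3) h"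
  shows "\<exists>r. h - Const r * jacobian F \<in> gen_ideal F"
proof -
  obtain N A where N: "N > 0" and A: "\<And>i. Var i ^ N = (\<Sum>j\<in>UNIV. A $ i $ j * F j)"
    and homA: "\<And>i j. homogeneous (int N - int d) (A $ i $ j)"
    using ex_Var_power_matrix by blast
  let ?m = "(Var 0 * Var 1 * Var 2) ^ (N - 1)"
  note det = homogeneous_det[OF homA]
  have "homogeneous (3 * int N - 3) (det A * h)"
    by (rule homogeneous_mult'[OF det h]) simp
  then obtain c where c: "det A * h - Const c * ?m \<in> pow_ideal N UNIV"
    using pow_ideal_socle N by blast
  have "homogeneous (3 * (int d - 1)) (jacobian F)"
    unfolding jacobian_def by (rule homogeneous_det) (simp add: homogeneous_pd hom)
  then have "homogeneous (3 * int N - 3) (det A * jacobian F)"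
    by (rule homogeneous_mult'[OF det]) simp
  then obtain e where e: "det A * jacobian F - Const e * ?m \<in> pow_ideal N UNIV"
    using pow_ideal_socle N by blast
  have "e \<noteq> 0" using e det_mult_jacobian_notin[OF A] by auto
  let ?r = "Const (c / e)"
  have re: "?r * Const e = Const c" using \<open>e \<noteq> 0\<close> by (simp flip: Const_mult)
  have "det A * (h - ?r * jacobian F) = (det A * h - Const c * ?m) + (- ?r) * (det A * jacobian F - Const e * ?m)"
    by (simp add: algebra_simps flip: re)
  also have "\<dots> \<in> pow_ideal N UNIV"
    by (intro pow_ideal_add c pow_ideal_mult e)
  finally show ?thesis using det_mult_cancel[OF A] by blast
qed

end

subsection \<open>Localizations of the polynomial ring\<close>

lemma Fract_eq_divide: "Fract a b = rat a / rat b"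
  by (simp add: divide_fract)

lemma rat_add: "rat (p + q) = rat p + rat q"
  and rat_diff: "rat (p - q) = rat p - rat q"
  and rat_uminus: "rat (- p) = - rat p"
  and rat_mult: "rat (p * q) = rat p * rat q"
  by simp_all

lemma rat_0: "rat 0 = 0"
  by (simp only: Zero_fract_def)

lemma rat_1: "rat 1 = 1"
  by (simp only: One_fract_def)

declare add_fract [simp del] diff_fract [simp del] minus_fract [simp del] mult_fract [simp del]
  divide_fract [simp del] inverse_fract [simp del]

lemma rat_power: "rat (p ^ k) = rat p ^ k"
  by (induction k) (simp_all add: rat_1 rat_mult)

lemma rat_of_nat: "rat (of_nat k) = of_nat k"
  by (simp add: of_nat_fract)

lemma rat_eq_iff: "rat p = rat q \<longleftrightarrow> p = q"
  by (simp add: eq_fract)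

lemma rat_eq_0_iff: "rat p = 0 \<longleftrightarrow> p = 0"
  by (metis rat_0 rat_eq_iff)

lemma rat_sum: "rat (sum f I) = (\<Sum>i\<in>I. rat (f i))"
  by (induction I rule: infinite_finite_induct) (simp_all add: rat_0 rat_add)

lemmas rat_hom = rat_add rat_diff rat_uminus rat_mult rat_0 rat_1 rat_power rat_of_nat

lemma pd_rat_divide:
  assumes "b \<noteq> 0"
  shows "pd_rat i (rat a / rat b) = (rat (pd i a) * rat b - rat a * rat (pd i b)) / rat b ^ 2"
proof -
  have "pd_rat i (Fract a b) = Fract (pd i a * b - a * pd i b) (b * b)"
    using assms by (transfer fixing: a b i) simp
  then show ?thesis
    unfolding Fract_eq_divide[of a b] Fract_eq_divide[of "pd i a * b - a * pd i b" "b * b"]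
    by (simp only: rat_hom power2_eq_square)
qed

text \<open>\<open>loc\<close> quantifies over the degree of \<open>h\<close>; a nonzero
  \<open>h\<close> has only one degree, so it can be fixed as \<open>e\<close>.\<close>

lemma loc_iff:
  assumes "homogeneous e h" "h \<noteq> 0"
  shows "r \<in> loc h m \<longleftrightarrow> (\<exists>a k. r = rat a / rat h ^ k \<and> homogeneous (m + int k * e) a)"
proof
  assume "r \<in> loc h m"
  then obtain a k e' where r: "r = rat a / rat h ^ k" "homogeneous e' h" "homogeneous (m + int k * e') a"
    by (auto simp: loc_def)
  with assms homogeneous_unique have "e' = e" by blast
  with r show "\<exists>a k. r = rat a / rat h ^ k \<and> homogeneous (m + int k * e) a" by blast
qed (use assms in \<open>auto simp: loc_def\<close>)

lemma locI:
  "r = rat a / rat h ^ k \<Longrightarrow> homogeneous e h \<Longrightarrow> homogeneous (m + int k * e) a \<Longrightarrow> r \<in> loc h m"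
  by (auto simp: loc_def)

context
  fixes h :: mpoly3 and e :: int
  assumes h: "homogeneous e h" "h \<noteq> 0"
begin

lemma loc_add:
  assumes "r \<in> loc h m" "s \<in> loc h m" shows "r + s \<in> loc h m"
proof -
  obtain a k where a: "r = rat a / rat h ^ k" "homogeneous (m + int k * e) a"
    using assms(1) loc_iff[OF h] by blast
  obtain b l where b: "s = rat b / rat h ^ l" "homogeneous (m + int l * e) b"
    using assms(2) loc_iff[OF h] by blast
  show ?thesis
  proof (rule locI)
    show "r + s = rat (a * h ^ l + b * h ^ k) / rat h ^ (k + l)"
      using h(2) by (simp add: a b rat_hom rat_eq_0_iff field_simps power_add)
    show "homogeneous (m + int (k + l) * e) (a * h ^ l + b * h ^ k)"
      by (intro homogeneous_add homogeneous_mult'[OF a(2) homogeneous_power[OF h(1)]]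
          homogeneous_mult'[OF b(2) homogeneous_power[OF h(1)]]) (simp_all add: algebra_simps)
  qed (rule h)
qed

lemma loc_mult:
  assumes "r \<in> loc h m" "s \<in> loc h m'" shows "r * s \<in> loc h (m + m')"
proof -
  obtain a k where a: "r = rat a / rat h ^ k" "homogeneous (m + int k * e) a"
    using assms(1) loc_iff[OF h] by blast
  obtain b l where b: "s = rat b / rat h ^ l" "homogeneous (m' + int l * e) b"
    using assms(2) loc_iff[OF h] by blast
  show ?thesis
  proof (rule locI)
    show "r * s = rat (a * b) / rat h ^ (k + l)"
      by (simp add: a b rat_hom power_add)
    show "homogeneous (m + m' + int (k + l) * e) (a * b)"
      by (rule homogeneous_mult'[OF a(2) b(2)]) (simp add: algebra_simps)
  qed (rule h)
qed

lemma loc_mult': "r \<in> loc h m \<Longrightarrow> s \<in> loc h m' \<Longrightarrow> m + m' = m'' \<Longrightarrow> r * s \<in> loc h m''"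
  using loc_mult by blast

lemma loc_rat: "homogeneous m a \<Longrightarrow> rat a \<in> loc h m"
  using h by (intro locI[where k = 0]) auto

lemma loc_0: "0 \<in> loc h m"
  using loc_rat[of m 0] by (simp add: rat_0)

lemma loc_uminus: "r \<in> loc h m \<Longrightarrow> - r \<in> loc h m"
  using loc_mult'[OF loc_rat[of 0 "- 1"]] homogeneous_uminus[OF homogeneous_1]
  by (simp add: rat_uminus rat_1)

lemma loc_diff: "r \<in> loc h m \<Longrightarrow> s \<in> loc h m \<Longrightarrow> r - s \<in> loc h m"
  using loc_add[of r m "- s"] loc_uminus[of s m] by simp

lemma loc_mono:
  assumes "r \<in> loc h m" "homogeneous f g" "g \<noteq> 0"
  shows "r \<in> loc (h * g) m" and "r \<in> loc (g * h) m"
proof -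
  obtain a k where a: "r = rat a / rat h ^ k" "homogeneous (m + int k * e) a"
    using assms(1) loc_iff[OF h] by blast
  show "r \<in> loc (h * g) m"
  proof (rule locI)
    show "r = rat (a * g ^ k) / rat (h * g) ^ k"
      using assms(3) by (simp add: a rat_hom rat_eq_0_iff power_mult_distrib)
    show "homogeneous (e + f) (h * g)" by (rule homogeneous_mult[OF h(1) assms(2)])
    show "homogeneous (m + int k * (e + f)) (a * g ^ k)"
      by (rule homogeneous_mult'[OF a(2) homogeneous_power[OF assms(2)]]) (simp add: algebra_simps)
  qed
  then show "r \<in> loc (g * h) m" by (simp add: mult.commute)
qed

lemma loc_divide_self: 
  assumes "homogeneous d a" shows "rat a / rat h \<in> loc h (d - e)"
proof (rule locI)
  show "rat a / rat h = rat a / rat h ^ 1" by simp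
qed (use h assms in auto)

lemma loc_divide_Var:
  "rat a / rat (Var k) \<in> loc (h * Var k) m" if "homogeneous (m + 1) a"
proof (rule locI)
  show "rat a / rat (Var k) = rat (a * h) / rat (h * Var k) ^ 1"
    using h by (simp add: rat_hom rat_eq_0_iff)
  show "homogeneous (e + 1) (h * Var k)" by (rule homogeneous_mult[OF h(1) homogeneous_Var])
  show "homogeneous (m + int 1 * (e + 1)) (a * h)"
    by (rule homogeneous_mult'[OF that h(1)]) simp
qed

text \<open>Repeating a factor does not change the open set. The repetition arises because a
  logarithmic form over one chart has its residue tested in every chart, the same one
  included.\<close>

lemma loc_Var_square:
  assumes "r \<in> loc (h * Var k * Var k) m" shows "r \<in> loc (h * Var k) m"
proof -
  have h2: "homogeneous (e + 1 + 1) (h * Var k * Var k)" "h * Var k * Var k \<noteq> 0"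
    using h(2) by (intro homogeneous_mult homogeneous_Var h(1), simp)
  obtain a l where a: "r = rat a / rat (h * Var k * Var k) ^ l" "homogeneous (m + int l * (e + 1 + 1)) a"
    using assms loc_iff[OF h2] by blast
  show ?thesis
  proof (rule locI)
    show "r = rat (a * h ^ l) / rat (h * Var k) ^ (2 * l)"
      using h by (simp add: a rat_hom rat_eq_0_iff power_mult_distrib power_mult power2_eq_square)
    show "homogeneous (e + 1) (h * Var k)" by (rule homogeneous_mult[OF h(1) homogeneous_Var])
    show "homogeneous (m + int (2 * l) * (e + 1)) (a * h ^ l)"
      by (rule homogeneous_mult'[OF a(2) homogeneous_power[OF h(1)]]) (simp add: algebra_simps)
  qed
qed

text \<open>Sections over \<open>{h x\<^sub>i \<noteq> 0} \<union> {h x\<^sub>j \<noteq> 0}\<close> extend to \<open>{h \<noteq> 0}\<close>, the complement having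
  codimension two.\<close>

lemma loc_glue:
  assumes "r \<in> loc (h * Var i) m" "r \<in> loc (h * Var j) m" "i \<noteq> j"
  shows "r \<in> loc h m"
proof -
  have hv: "homogeneous (e + 1) (h * Var i)" "h * Var i \<noteq> 0" for i
    using h(2) by (intro homogeneous_mult homogeneous_Var h(1), simp)
  obtain a k where a: "r = rat a / rat (h * Var i) ^ k" "homogeneous (m + int k * (e + 1)) a"
    using assms(1) loc_iff[OF hv] by blast
  obtain b l where b: "r = rat b / rat (h * Var j) ^ l" "homogeneous (m + int l * (e + 1)) b"
    using assms(2) loc_iff[OF hv] by blast
  have "rat (Var j ^ l * (a * h ^ l)) = rat (Var i ^ k * (b * h ^ k))"
    using a(1) b(1) h by (simp add: rat_hom rat_eq_0_iff field_simps)
  then have "Var j ^ l * (a * h ^ l) = Var i ^ k * (b * h ^ k)" by (simp only: rat_eq_iff)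
  from Var_power_dvd[OF this] assms(3) obtain c where c: "a * h ^ l = Var i ^ k * c" by metis
  show ?thesis
  proof (rule locI)
    have "rat a * rat h ^ l = rat (Var i) ^ k * rat c"
      using arg_cong[OF c, of rat] by (simp add: rat_hom)
    then show "r = rat c / rat h ^ (k + l)"
      using h unfolding a(1) by (simp add: rat_hom rat_eq_0_iff field_simps power_add)
    have "homogeneous (m + int k * (e + 1) + int l * e) (a * h ^ l)"
      by (rule homogeneous_mult[OF a(2) homogeneous_power[OF h(1)]])
    then have "homogeneous ((m + int (k + l) * e) + int k) (Var i ^ k * c)"
      unfolding c by (simp add: algebra_simps)
    then show "homogeneous (m + int (k + l) * e) c" by (rule homogeneous_Var_power_cancel)
  qed (rule h)
qed

end

subsection \<open>Differential forms in coordinates\<close>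

lemma forall_3_set:
  "(\<forall>I :: 3 set. P I) \<longleftrightarrow> P {} \<and> P {0} \<and> P {1} \<and> P {2} \<and> P {0,1} \<and> P {0,2} \<and> P {1,2} \<and> P {0,1,2}"
proof -
  have "(UNIV :: 3 set set) = Pow {0, 1, 2}" by (simp flip: UNIV_3_012)
  then have "(\<forall>I :: 3 set. P I) \<longleftrightarrow> (\<forall>I \<in> Pow {0, 1, 2}. P I)" by simp
  then show ?thesis by (simp only: Pow_insert Pow_empty) (auto simp: insert_commute)
qed

definition form0 :: "ratfun \<Rightarrow> form" where
  "form0 f = (\<chi> I. if I = {} then f else 0)"

definition form1 :: "(3 \<Rightarrow> ratfun) \<Rightarrow> form" where
  "form1 a = (\<chi> I. if card I = 1 then a (the_elem I) else 0)"

text \<open>The sign at \<open>{0, 2}\<close> makes \<open>form2 w\<close> correspond to the vector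
  \<open>w\<close>: the wedge of two 1-forms becomes the cross product, and \<open>Omega\<close> is
  the coordinate vector.\<close>

definition form2 :: "(3 \<Rightarrow> ratfun) \<Rightarrow> form" where
  "form2 w = (\<chi> I. if I = {1, 2} then w 0 else if I = {0, 2} then - w 1 else if I = {0, 1} then w 2 else 0)"

lemma set_neqs_3: "{1, 2::3} \<noteq> {0, 2}" "{1, 2::3} \<noteq> {0, 1}" "{0, 2::3} \<noteq> {0, 1}"
  "{0, 2::3} \<noteq> {1, 2}" "{0, 1::3} \<noteq> {1, 2}" "{0, 1::3} \<noteq> {0, 2}"
  "{0, 1, 2::3} \<noteq> {0, 1}" "{0, 1, 2::3} \<noteq> {0, 2}" "{0, 1, 2::3} \<noteq> {1, 2}"
  by (simp_all add: set_eq_iff forall_3_012)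

lemma insert_commute_3: "{1, 0::3} = {0, 1}" "{2, 0::3} = {0, 2}" "{2, 1::3} = {1, 2}"
  "{1, 0, 2::3} = {0, 1, 2}" "{2, 0, 1::3} = {0, 1, 2}"
  by auto

lemma form_eq_iff:
  "(\<alpha> :: form) = \<beta> \<longleftrightarrow> \<alpha> $ {} = \<beta> $ {} \<and> \<alpha> $ {0} = \<beta> $ {0} \<and> \<alpha> $ {1} = \<beta> $ {1} \<and> \<alpha> $ {2} = \<beta> $ {2}
    \<and> \<alpha> $ {0,1} = \<beta> $ {0,1} \<and> \<alpha> $ {0,2} = \<beta> $ {0,2} \<and> \<alpha> $ {1,2} = \<beta> $ {1,2} \<and> \<alpha> $ {0,1,2} = \<beta> $ {0,1,2}"
  unfolding vec_eq_iff forall_3_set ..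

lemma form0_nth [simp]: "form0 f $ I = (if I = {} then f else 0)"
  by (simp add: form0_def)

lemma form1_nth [simp]: "form1 a $ {} = 0" "form1 a $ {i} = a i" "card I \<noteq> 1 \<Longrightarrow> form1 a $ I = 0"
  by (simp_all add: form1_def)

lemma form2_nth [simp]: "form2 w $ {} = 0" "form2 w $ {i} = 0" "form2 w $ {1, 2} = w 0"
  "form2 w $ {0, 2} = - w 1" "form2 w $ {0, 1} = w 2" "form2 w $ {0, 1, 2} = 0"
  by (auto simp: form2_def set_neqs_3)

lemma form1_simps: "r *s form1 a = form1 (\<lambda>i. r * a i)" "form1 a + form1 b = form1 (\<lambda>i. a i + b i)"
  "form1 a - form1 b = form1 (\<lambda>i. a i - b i)" "- form1 a = form1 (\<lambda>i. - a i)"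
  by (simp_all add: form_eq_iff)

lemma form2_simps: "r *s form2 a = form2 (\<lambda>i. r * a i)" "form2 a + form2 b = form2 (\<lambda>i. a i + b i)"
  "form2 a - form2 b = form2 (\<lambda>i. a i - b i)" "- form2 a = form2 (\<lambda>i. - a i)"
  by (simp_all add: form_eq_iff)

lemma form0_scale: "r *s form0 f = form0 (r * f)"
  by (simp add: form_eq_iff)

lemma wedge_form0_right: "\<alpha> \<and>\<^sub>f form0 f = f *s \<alpha>"
proof -
  have "(\<alpha> \<and>\<^sub>f form0 f) $ I = f * \<alpha> $ I" for I
  proof -
    have "(\<alpha> \<and>\<^sub>f form0 f) $ I = (\<Sum>J\<in>{I}. (-1) ^ card {(a, b). a \<in> J \<and> b \<in> I - J \<and> b < a} * \<alpha> $ J * form0 f $ (I - J))"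
      unfolding wedge_def vec_lambda_beta by (rule sum.mono_neutral_right) auto
    then show ?thesis by (simp add: mult.commute)
  qed
  then show ?thesis by (simp add: vec_eq_iff)
qed

lemma wedge_form0_left: "form0 f \<and>\<^sub>f \<alpha> = f *s \<alpha>"
proof -
  have "(form0 f \<and>\<^sub>f \<alpha>) $ I = f * \<alpha> $ I" for I
  proof -
    have "(form0 f \<and>\<^sub>f \<alpha>) $ I = (\<Sum>J\<in>{{}}. (-1) ^ card {(a, b). a \<in> J \<and> b \<in> I - J \<and> b < a} * form0 f $ J * \<alpha> $ (I - J))"
      unfolding wedge_def vec_lambda_beta by (rule sum.mono_neutral_right) auto
    then show ?thesis by simp
  qed
  then show ?thesis by (simp add: vec_eq_iff)
qed

lemma sum_pair: "x \<noteq> y \<Longrightarrow> sum f {x, y} = f x + f y"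
  by simp

lemma wedge_form1_pair:
  assumes "p < q"
  shows "(form1 a \<and>\<^sub>f form1 b) $ {p, q} = a p * b q - a q * b p"
proof -
  have pq: "p \<noteq> q" "\<not> q < p" using assms by auto
  let ?f = "\<lambda>J. (-1) ^ card {(a, b). a \<in> J \<and> b \<in> {p, q} - J \<and> b < a} * form1 a $ J * form1 b $ ({p, q} - J)"
  have "(form1 a \<and>\<^sub>f form1 b) $ {p, q} = (\<Sum>J\<in>{{p}, {q}}. ?f J)"
    unfolding wedge_def vec_lambda_beta
  proof (rule sum.mono_neutral_right)
    show "\<forall>J\<in>Pow {p, q} - {{p}, {q}}. ?f J = 0"
      by (auto simp: Pow_insert)
  qed auto
  also have "\<dots> = ?f {p} + ?f {q}"
    by (rule sum_pair) (use pq in simp)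
  also have "?f {p} = a p * b q"
  proof -
    have "{(a, b). a \<in> {p} \<and> b \<in> {p, q} - {p} \<and> b < a} = {}" "{p, q} - {p} = {q}"
      using pq by auto
    then show ?thesis by (simp only:) simp
  qed
  also have "?f {q} = - (a q * b p)"
  proof -
    have "{(a, b). a \<in> {q} \<and> b \<in> {p, q} - {q} \<and> b < a} = {(q, p)}" "{p, q} - {q} = {p}"
      using pq assms by auto
    then show ?thesis by (simp only:) simp
  qed
  finally show ?thesis by simp
qed

lemma wedge_form1_other:
  assumes "card I \<noteq> 2" shows "(form1 a \<and>\<^sub>f form1 b) $ I = 0"
  unfolding wedge_def vec_lambda_beta
proof (rule sum.neutral, rule ballI)
  fix J assume "J \<in> Pow I"
  then have "card (I - J) = card I - card J" "card J \<le> card I" by (auto intro: card_Diff_subset card_mono)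
  with assms have "card J \<noteq> 1 \<or> card (I - J) \<noteq> 1" by linarith
  then show "(-1) ^ card {(a, b). a \<in> J \<and> b \<in> I - J \<and> b < a} * form1 a $ J * form1 b $ (I - J) = 0"
    by (auto simp del: One_nat_def)
qed

lemma card_sets_3: "card {0, 1, 2::3} = 3" "p \<noteq> q \<Longrightarrow> card {p, q::3} = 2"
  by auto

lemma wedge_form1:
  "form1 a \<and>\<^sub>f form1 b = form2 (\<lambda>i. if i = 0 then a 1 * b 2 - a 2 * b 1
     else if i = 1 then a 2 * b 0 - a 0 * b 2 else a 0 * b 1 - a 1 * b 0)"
  by (simp add: form_eq_iff wedge_form1_pair wedge_form1_other card_sets_3)

lemma d_fun_form1: "d_fun f = form1 (\<lambda>i. pd_rat i f)"
  by (simp add: d_fun_def form1_def)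

lemma pd_rat_Var: "pd_rat i (rat (Var j)) = (if i = j then 1 else 0)"
proof -
  have "pd i 1 = 0" using pd_power[of i 1 0] by simp
  then have "pd_rat i (rat (Var j) / rat 1) = rat (pd i (Var j))"
    by (subst pd_rat_divide) (simp_all add: rat_hom)
  then show ?thesis by (simp add: rat_hom pd_Var split: if_splits)
qed

lemma Omega_form2: "Omega = form2 (\<lambda>i. rat (Var i))"
  by (simp add: Omega_def d_fun_form1 wedge_form1 form_eq_iff pd_rat_Var)

lemma contraction_form2:
  "contraction 0 (form2 w) = form1 (\<lambda>i. if i = 0 then 0 else if i = 1 then w 2 else - w 1)"
  "contraction 1 (form2 w) = form1 (\<lambda>i. if i = 0 then - w 2 else if i = 1 then 0 else w 0)"
  "contraction 2 (form2 w) = form1 (\<lambda>i. if i = 0 then w 1 else if i = 1 then - w 0 else 0)"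
  by (simp_all add: form_eq_iff contraction_def card_sets_3 insert_commute_3 Collect_conv_if)

lemma contraction_form1: "contraction j (form1 a) = form0 (a j)"
proof -
  have "contraction j (form1 a) $ I = form0 (a j) $ I" for I
  proof (cases "j \<in> I")
    case False
    then have "card (insert j I) \<noteq> 1" if "I \<noteq> {}" using that by simp
    with False show ?thesis
      unfolding contraction_def vec_lambda_beta form0_nth by (cases "I = {}") (simp_all only: form1_nth, simp_all)
  next
    case True
    then show ?thesis unfolding contraction_def vec_lambda_beta form0_nth by auto
  qed
  then show ?thesis by (simp add: vec_eq_iff)
qed

lemma euler_contraction_form1: "euler_contraction (form1 a) = form0 (\<Sum>j\<in>UNIV. rat (Var j) * a j)"
  by (simp add: euler_contraction_def contraction_form1 form0_scale sum_UNIV_3 form_eq_iff)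

lemma euler_contraction_form2:
  "euler_contraction (form2 w) = 0 \<longleftrightarrow>
     rat (Var 2) * w 1 = rat (Var 1) * w 2 \<and> rat (Var 0) * w 2 = rat (Var 2) * w 0 \<and> rat (Var 1) * w 0 = rat (Var 0) * w 1"
  by (auto simp: euler_contraction_def contraction_form2 sum_UNIV_3 form_eq_iff)

lemma wedge_add_left: "(\<alpha> + \<beta>) \<and>\<^sub>f \<gamma> = \<alpha> \<and>\<^sub>f \<gamma> + \<beta> \<and>\<^sub>f \<gamma>"
  by (simp add: wedge_def vec_eq_iff sum.distrib algebra_simps)

lemma wedge_diff_left: "(\<alpha> - \<beta>) \<and>\<^sub>f \<gamma> = \<alpha> \<and>\<^sub>f \<gamma> - \<beta> \<and>\<^sub>f \<gamma>"
  by (simp add: wedge_def vec_eq_iff sum_subtractf algebra_simps)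

lemma wedge_diff_right: "\<gamma> \<and>\<^sub>f (\<alpha> - \<beta>) = \<gamma> \<and>\<^sub>f \<alpha> - \<gamma> \<and>\<^sub>f \<beta>"
  by (simp add: wedge_def vec_eq_iff sum_subtractf algebra_simps)

lemma wedge_scale_left: "(r *s \<alpha>) \<and>\<^sub>f \<beta> = r *s (\<alpha> \<and>\<^sub>f \<beta>)"
  by (simp add: wedge_def vec_eq_iff sum_distrib_left algebra_simps)

lemma wedge_scale_right: "\<alpha> \<and>\<^sub>f (r *s \<beta>) = r *s (\<alpha> \<and>\<^sub>f \<beta>)"
  by (simp add: wedge_def vec_eq_iff sum_distrib_left algebra_simps)

lemma wedge_form1_self: "form1 a \<and>\<^sub>f form1 a = 0"
  by (simp add: wedge_form1 form_eq_iff)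

lemma Omega_nth: "Omega $ {1, 2} = rat (Var 0)"
  by (simp add: Omega_form2)

lemma Omega_scale_cancel: "r *s Omega = s *s Omega \<longleftrightarrow> r = s"
proof
  assume "r *s Omega = s *s Omega"
  from arg_cong[OF this, of "\<lambda>\<omega>. \<omega> $ {1, 2}"] show "r = s"
    by (simp only: vector_smult_component Omega_nth) (simp add: rat_eq_0_iff)
qed simp

lemma Forms_0D:
  assumes "\<omega> \<in> Forms h 0" obtains f where "\<omega> = form0 f" "f \<in> loc h 0"
proof
  show "\<omega> = form0 (\<omega> $ {})" using assms by (simp add: Forms_def vec_eq_iff)
  have "\<omega> $ {} \<in> loc h (- int (card ({} :: 3 set)))" using assms unfolding Forms_def by blast
  then show "\<omega> $ {} \<in> loc h 0" by simp
qed

lemma Forms_1D: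
  assumes "\<omega> \<in> Forms h 1"
  shows "\<exists>a. \<omega> = form1 a \<and> (\<forall>i. a i \<in> loc h (-1)) \<and> (\<Sum>j\<in>UNIV. rat (Var j) * a j) = 0"
proof (intro exI conjI allI)
  show \<omega>: "\<omega> = form1 (\<lambda>i. \<omega> $ {i})"
    using assms by (simp add: Forms_def form_eq_iff card_sets_3)
  show "\<omega> $ {i} \<in> loc h (-1)" for i
  proof -
    have "\<omega> $ {i} \<in> loc h (- int (card {i}))" using assms unfolding Forms_def by blast
    then show ?thesis by simp
  qed
  have "euler_contraction (form1 (\<lambda>i. \<omega> $ {i})) $ {} = 0"
    using assms \<omega> by (simp add: Forms_def)
  then show "(\<Sum>j\<in>UNIV. rat (Var j) * \<omega> $ {j}) = 0"
    by (simp add: euler_contraction_form1)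
qed

context
  fixes h :: mpoly3 and e :: int
  assumes h: "homogeneous e h" "h \<noteq> 0"
begin

lemma zero_in_Forms: "0 \<in> Forms h p"
  using loc_0[OF h]
  by (auto simp: Forms_def euler_contraction_def contraction_def vec_eq_iff intro!: sum.neutral)

lemma form1_in_Forms:
  assumes "\<And>i. a i \<in> loc h (-1)" "(\<Sum>j\<in>UNIV. rat (Var j) * a j) = 0"
  shows "form1 a \<in> Forms h 1"
proof -
  have "form1 a $ I \<in> loc h (- int (card I))" for I
  proof (cases "card I = 1")
    case True
    then obtain i where "I = {i}" by (auto simp: card_1_singleton_iff)
    then show ?thesis using assms by simp
  qed (simp add: loc_0[OF h])
  then show ?thesis using assms(2) by (simp add: Forms_def euler_contraction_form1 vec_eq_iff)
qed

lemma form2_in_Forms: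
  assumes "\<And>i. w i \<in> loc h (-2)"
    "rat (Var 2) * w 1 = rat (Var 1) * w 2" "rat (Var 0) * w 2 = rat (Var 2) * w 0"
    "rat (Var 1) * w 0 = rat (Var 0) * w 1"
  shows "form2 w \<in> Forms h 2"
proof -
  have "\<forall>I. form2 w $ I \<in> loc h (- int (card I)) \<and> (card I \<noteq> 2 \<longrightarrow> form2 w $ I = 0)"
    unfolding forall_3_set using assms(1) loc_uminus[OF h assms(1)[of 1]] loc_0[OF h]
    by (simp add: card_sets_3)
  then show ?thesis using assms(2-4) by (simp add: Forms_def euler_contraction_form2)
qed

lemma Forms_2D:
  assumes "\<omega> \<in> Forms h 2"
  shows "\<exists>w. \<omega> = form2 w \<and> (\<forall>i. w i \<in> loc h (-2)) \<and>
    rat (Var 2) * w 1 = rat (Var 1) * w 2 \<and> rat (Var 0) * w 2 = rat (Var 2) * w 0 \<and>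
    rat (Var 1) * w 0 = rat (Var 0) * w 1"
proof -
  define w where "w i = (if i = 0 then \<omega> $ {1, 2} else if i = 1 then - \<omega> $ {0, 2} else \<omega> $ {0, 1})" for i :: 3
  have \<omega>: "\<omega> = form2 w"
    using assms by (simp add: Forms_def form_eq_iff card_sets_3 w_def)
  have "euler_contraction (form2 w) = 0" using assms \<omega> by (simp add: Forms_def)
  note rel = this[unfolded euler_contraction_form2]
  have loc: "\<omega> $ I \<in> loc h (- int (card I))" for I using assms unfolding Forms_def by blast
    have "\<forall>i. w i \<in> loc h (-2)"
      unfolding forall_3_012 w_def using loc[of "{1, 2}"] loc[of "{0, 1}"] loc_uminus[OF h loc[of "{0, 2}"]]
      by (simp add: card_sets_3)
    with \<omega> rel show ?thesis by blast
qed

text \<open>Euler contraction kills \<open>form2 w\<close> exactly if \<open>w\<close> is parallel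
  to the coordinate vector, so \<open>w = f x\<close>. The quotients \<open>w i / Var i\<close> all
  equal \<open>f\<close>, so \<open>f\<close> is regular on each chart, and gluing two charts
  removes the poles along the coordinate lines.\<close>

lemma Forms_2_iff: "\<omega> \<in> Forms h 2 \<longleftrightarrow> (\<exists>f\<in>loc h (-3). \<omega> = f *s Omega)"
proof
  assume "\<exists>f\<in>loc h (-3). \<omega> = f *s Omega"
  then obtain f where f: "f \<in> loc h (-3)" "\<omega> = form2 (\<lambda>i. f * rat (Var i))"
    by (auto simp: Omega_form2 form2_simps)
  show "\<omega> \<in> Forms h 2"
    unfolding f(2)
    by (rule form2_in_Forms) (simp_all add: loc_mult'[OF h f(1) loc_rat[OF h homogeneous_Var]])
next
  assume "\<omega> \<in> Forms h 2"
  then obtain w where w: "\<omega> = form2 w" "\<And>i. w i \<in> loc h (-2)"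
    "rat (Var 2) * w 1 = rat (Var 1) * w 2" "rat (Var 0) * w 2 = rat (Var 2) * w 0"
    "rat (Var 1) * w 0 = rat (Var 0) * w 1"
    using Forms_2D by blast
  define f where "f = w 0 / rat (Var 0)"
  have "\<forall>i. w i = f * rat (Var i)"
    unfolding forall_3_012 f_def using w(3-5) by (simp add: rat_eq_0_iff field_simps)
  then have wf: "w i = f * rat (Var i)" for i by blast
  have hv: "homogeneous (e + 1) (h * Var i)" "h * Var i \<noteq> 0" for i
    using h(2) by (intro homogeneous_mult homogeneous_Var h(1), simp)
  have "f \<in> loc (h * Var i) (-3)" for i
  proof -
    have "f = w i * (rat 1 / rat (Var i))" by (simp add: wf rat_1 rat_eq_0_iff)
    also have "\<dots> \<in> loc (h * Var i) (-3)"
      by (rule loc_mult'[OF hv loc_mono(1)[OF h w(2) homogeneous_Var Var_neq_0] loc_divide_Var[OF h, of "-1"]]) simp_all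
    finally show ?thesis .
  qed
  then have "f \<in> loc h (-3)" using loc_glue[OF h, of f 0 _ 1] by simp
  moreover have "\<omega> = f *s Omega"
    by (simp add: w(1) Omega_form2 form2_simps wf[symmetric])
  ultimately show "\<exists>f\<in>loc h (-3). \<omega> = f *s Omega" by blast
qed

lemma Forms_2_add_diff:
  assumes "\<omega> \<in> Forms h 2" "\<eta> \<in> Forms h 2"
  shows "\<omega> + \<eta> \<in> Forms h 2" "\<omega> - \<eta> \<in> Forms h 2"
proof -
  obtain f g where fg: "f \<in> loc h (-3)" "g \<in> loc h (-3)" "\<omega> = f *s Omega" "\<eta> = g *s Omega"
    using assms by (auto simp: Forms_2_iff)
  have "\<omega> + \<eta> = (f + g) *s Omega" "\<omega> - \<eta> = (f - g) *s Omega"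
    using fg by (simp_all add: vec_eq_iff algebra_simps)
  then show "\<omega> + \<eta> \<in> Forms h 2" "\<omega> - \<eta> \<in> Forms h 2"
    using fg loc_add[OF h] loc_diff[OF h] unfolding Forms_2_iff by blast+
qed

text \<open>The cross product of two vectors orthogonal to the coordinate vector is parallel to
  it.\<close>

lemma wedge_in_Forms_2:
  assumes "\<alpha> \<in> Forms h 1" "\<beta> \<in> Forms h 1" shows "\<alpha> \<and>\<^sub>f \<beta> \<in> Forms h 2"
proof -
  obtain a where a: "\<alpha> = form1 a" "\<And>i. a i \<in> loc h (-1)" "(\<Sum>j\<in>UNIV. rat (Var j) * a j) = 0"
    using Forms_1D[OF assms(1)] by blast
  obtain b where b: "\<beta> = form1 b" "\<And>i. b i \<in> loc h (-1)" "(\<Sum>j\<in>UNIV. rat (Var j) * b j) = 0"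
    using Forms_1D[OF assms(2)] by blast
  have ab: "a i * b j - a k * b l \<in> loc h (-2)" for i j k l
    by (rule loc_diff[OF h]; rule loc_mult'[OF h a(2) b(2)]; simp)
  note dot = a(3)[unfolded sum_UNIV_3] b(3)[unfolded sum_UNIV_3]
  show ?thesis
    unfolding a(1) b(1) wedge_form1
  proof (rule form2_in_Forms, goal_cases)
    case 1
    then show ?case using ab by simp
  next
    case 2
    then show ?case using dot by simp algebra
  next
    case 3
    then show ?case using dot by simp algebra
  next
    case 4
    then show ?case using dot by simp algebra
  qed
qed

end

lemma Forms_1_mono:
  assumes h: "homogeneous e h" "h \<noteq> 0" and g: "homogeneous d g" "g \<noteq> 0" and "\<omega> \<in> Forms h 1"
  shows "\<omega> \<in> Forms (h * g) 1"
proof -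
  obtain a where a: "\<omega> = form1 a" "\<And>i. a i \<in> loc h (-1)" "(\<Sum>j\<in>UNIV. rat (Var j) * a j) = 0"
    using Forms_1D[OF \<open>\<omega> \<in> Forms h 1\<close>] by blast
  have hg: "homogeneous (e + d) (h * g)" "h * g \<noteq> 0"
    using h g by (auto intro: homogeneous_mult)
  show ?thesis
    unfolding a(1) by (rule form1_in_Forms[OF hg loc_mono(1)[OF h a(2) g] a(3)])
qed

lemma hom_mult_Var:
  assumes "homogeneous e h" "h \<noteq> 0"
  shows "homogeneous (e + 1) (h * Var i)" "h * Var i \<noteq> 0" 
  using assms(2) by (intro homogeneous_mult homogeneous_Var assms(1), simp)

lemma Forms_2_glue:
  assumes h: "homogeneous e h" "h \<noteq> 0" and \<omega>: "\<And>k. \<omega> \<in> Forms (h * Var k) 2"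
  shows "\<omega> \<in> Forms h 2"
proof -
  obtain f where f: "f \<in> loc (h * Var 0) (-3)" "\<omega> = f *s Omega"
    using \<omega>[of 0] Forms_2_iff[OF hom_mult_Var[OF h]] by blast
  obtain f' where f': "f' \<in> loc (h * Var 1) (-3)" "\<omega> = f' *s Omega"
    using \<omega>[of 1] Forms_2_iff[OF hom_mult_Var[OF h]] by blast
  have "f' = f" using f(2) f'(2) Omega_scale_cancel by metis
  then have "f \<in> loc h (-3)" using f f' loc_glue[OF h, of f 0 _ 1] by simp
  then show ?thesis using f(2) Forms_2_iff[OF h] by blast
qed

lemma Forms_2_Var_square:
  assumes h: "homogeneous e h" "h \<noteq> 0" and \<omega>: "\<omega> \<in> Forms (h * Var k * Var k) 2"
  shows "\<omega> \<in> Forms (h * Var k) 2"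
  using \<omega> loc_Var_square[OF h]
  unfolding Forms_2_iff[OF hom_mult_Var[OF h]] Forms_2_iff[OF hom_mult_Var[OF hom_mult_Var[OF h]]] by blast

lemma form2_eqI: "v 0 = w 0 \<Longrightarrow> v 1 = w 1 \<Longrightarrow> v 2 = w 2 \<Longrightarrow> form2 v = form2 w"
  by (simp add: form_eq_iff)

text \<open>The 3-form \<open>Omega \<and>\<^sub>f form1 b\<close> has coefficient x.b = 0.
  Contracting it with the i-th coordinate field gives \<open>contraction i Omega \<and>\<^sub>f
  form1 b + b i *s Omega = 0\<close>.\<close>

lemma contraction_Omega_wedge:
  assumes "(\<Sum>j\<in>UNIV. rat (Var j) * b j) = 0"
  shows "contraction i Omega \<and>\<^sub>f form1 b = (- b i) *s Omega"
proof -
  note b = assms[unfolded sum_UNIV_3]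
  have "\<forall>i. contraction i Omega \<and>\<^sub>f form1 b = (- b i) *s Omega"
    unfolding forall_3_012 Omega_form2 contraction_form2 wedge_form1 form2_simps
    by (intro conjI form2_eqI; simp; (use b in algebra)?)
  then show ?thesis by blast
qed

lemma Forms_1_add:
  assumes h: "homogeneous e h" "h \<noteq> 0" and "\<alpha> \<in> Forms h 1" "\<beta> \<in> Forms h 1"
  shows "\<alpha> + \<beta> \<in> Forms h 1"
proof -
  obtain a where a: "\<alpha> = form1 a" "\<And>i. a i \<in> loc h (-1)" "(\<Sum>j\<in>UNIV. rat (Var j) * a j) = 0"
    using Forms_1D[OF assms(3)] by blast
  obtain b where b: "\<beta> = form1 b" "\<And>i. b i \<in> loc h (-1)" "(\<Sum>j\<in>UNIV. rat (Var j) * b j) = 0"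
    using Forms_1D[OF assms(4)] by blast
  show ?thesis unfolding a(1) b(1) form1_simps
    by (rule form1_in_Forms[OF h loc_add[OF h a(2) b(2)]]) (use a(3) b(3) in \<open>simp add: distrib_left sum.distrib\<close>)
qed

lemma contraction_Omega_in_Forms:
  assumes h: "homogeneous e h" "h \<noteq> 0" and c: "c \<in> loc h (-2)"
  shows "c *s contraction i Omega \<in> Forms h 1"
proof -
  note x = loc_mult'[OF h c loc_rat[OF h homogeneous_Var]]
  have m: "- (c * rat (Var i)) \<in> loc h (-1)" "c * rat (Var i) \<in> loc h (-1)" for i
    using loc_uminus[OF h x[of "-1" i]] x[of "-1" i] by simp_all
  have "\<forall>i. c *s contraction i Omega \<in> Forms h 1"
    unfolding forall_3_012 Omega_form2 contraction_form2 form1_simps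
    by (intro conjI form1_in_Forms[OF h]) (auto simp: m sum_UNIV_3 loc_0[OF h])
  then show ?thesis by blast
qed

subsection \<open>Cech cochains\<close>

lemma cech_delta_pair: "cech_delta c [i, j] = c [j] - c [i]"
  by (simp add: cech_delta_def numeral_2_eq_2 vec_eq_iff)

lemma cech_delta_triple: "cech_delta c [i, j, k] = c [j, k] - c [i, k] + c [i, j]"
  by (simp add: cech_delta_def numeral_3_eq_3 vec_eq_iff)

lemma UNIV_3_cases: "(i::3) = 0 \<or> i = 1 \<or> i = 2"
  using UNIV_3_012 by auto

lemma simplices_0: "simplices 0 = {[0], [1], [2]}"
  using UNIV_3_cases by (auto simp: simplices_def length_Suc_conv)

lemma simplices_1: "simplices 1 = {[0, 1], [0, 2], [1, 2]}"
proof -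
  have "s \<in> {[0, 1], [0, 2], [1, 2]}" if "s \<in> simplices 1" for s
  proof -
    have "length s = Suc (Suc 0)" "sorted_wrt (<) s" using that by (simp_all add: simplices_def)
    then obtain i j where s: "s = [i, j]" "i < j" by (auto simp: length_Suc_conv)
    then show ?thesis using UNIV_3_cases[of i] UNIV_3_cases[of j] by auto
  qed
  then show ?thesis by (auto simp: simplices_def)
qed

lemma simplices_2: "simplices 2 = {[0, 1, 2]}"
proof -
  have "s = [0, 1, 2]" if "s \<in> simplices 2" for s
  proof -
    have "length s = Suc (Suc (Suc 0))" "sorted_wrt (<) s" using that by (simp_all add: simplices_def)
    then obtain i j k where s: "s = [i, j, k]" "i < j" "j < k" "i < k" by (auto simp: length_Suc_conv)
    then show ?thesis using UNIV_3_cases[of i] UNIV_3_cases[of j] UNIV_3_cases[of k] by auto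
  qed
  then show ?thesis by (auto simp: simplices_def)
qed

text \<open>The coefficients of \<open>dg/g\<close> for the local equation
  \<open>g = G / Var k ^ n\<close>.\<close>

definition dlog :: "nat \<Rightarrow> mpoly3 \<Rightarrow> 3 \<Rightarrow> 3 \<Rightarrow> ratfun" where
  "dlog n G k i = rat (pd i G) / rat G - (if i = k then of_nat n / rat (Var k) else 0)"

subsection \<open>Partial derivatives of a smooth curve\<close>

lemma sq_ideal_eq: "sq_ideal G = gen_ideal (\<lambda>i. pd i G ^ 2)"
  by (simp add: sq_ideal_def gen_ideal_def)

lemma Det_G_eq: "Det_G G = jacobian (\<lambda>i. pd i G ^ 2)"
  by (simp add: Det_G_def jacobian_def)

text \<open>By the chain rule, row \<open>i\<close> acquires the factor
  \<open>K * F i ^ (K - 1)\<close>. This relates \<open>Det_G\<close> to the Jacobians of all higher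
  powers of the partial derivatives.\<close>

lemma jacobian_power:
  "jacobian (\<lambda>i. F i ^ K) = (of_nat K ^ 3 * (F 0 * F 1 * F 2) ^ (K - 1)) * jacobian F"
proof -
  have "jacobian (\<lambda>i. F i ^ K) = det (\<chi> i. (of_nat K * F i ^ (K - 1)) *s (\<chi> j. pd j (F i)))"
    unfolding jacobian_def
    by (rule arg_cong[of _ _ det]) (simp add: vec_eq_iff pd_power)
  also have "\<dots> = (\<Prod>i\<in>UNIV. of_nat K * F i ^ (K - 1)) * jacobian F"
    unfolding jacobian_def by (rule det_rows_mul)
  finally show ?thesis
    by (simp add: prod_UNIV_3 power_mult_distrib power3_eq_cube mult_ac)
qed

context
  fixes n :: nat and G :: mpoly3
  assumes n: "n \<ge> 2" and hom: "homogeneous (int n) G" and smooth: "smooth_curve G"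
begin

lemma homogeneous_partial: "homogeneous (int (n - 1)) (pd i G)"
  using homogeneous_pd[OF hom] n by (simp add: of_nat_diff)

lemma homogeneous_partial_power: "homogeneous (int (K * (n - 1))) (pd i G ^ K)"
  using homogeneous_power[OF homogeneous_partial, of K i] by simp

text \<open>Smoothness covers the points of the curve; off the curve Euler's relation
  applies.\<close>

lemma partials_no_common_zero:
  assumes "v \<noteq> 0" shows "\<exists>i. eval_poly (pd i G) v \<noteq> 0"
proof (cases "eval_poly G v = 0")
  case False
  have *: "of_nat n * eval_poly G v = (\<Sum>i\<in>UNIV. v $ i * eval_poly (pd i G) v)"
    using arg_cong[OF euler_identity[OF hom], of "\<lambda>p. eval_poly p v"]
    by (simp add: eval_poly_sum eval_poly_mult flip: Const_of_nat)
  show ?thesis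
  proof (rule ccontr)
    assume "\<not> ?thesis"
    with * False n show False by simp
  qed
qed (use assms smooth in \<open>auto simp: smooth_curve_def\<close>)

lemma partial_powers_no_common_zero:
  assumes "v \<noteq> 0" shows "\<exists>i. eval_poly (pd i G ^ K) v \<noteq> 0"
  using partials_no_common_zero[OF assms] by (auto simp: eval_poly_power)

lemma jacobian_partial_power_notin:
  assumes "K > 0" shows "jacobian (\<lambda>i. pd i G ^ K) \<notin> gen_ideal (\<lambda>i. pd i G ^ K)"
proof (rule jacobian_notin)
  show "K * (n - 1) > 0" using n assms by simp
qed (rule homogeneous_partial_power partial_powers_no_common_zero, assumption?)+

text \<open>A vanishing partial derivative would give the Jacobian matrix a zero row, but its
  determinant lies outside an ideal.\<close>

lemma partial_neq_0: "pd i G \<noteq> 0"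
proof -
  have "jacobian (\<lambda>i. pd i G) \<noteq> 0"
    using jacobian_partial_power_notin[of 1] is_ideal_0[OF is_ideal_gen_ideal, of "\<lambda>i. pd i G"] by auto
  then have "\<forall>i. pd i G \<noteq> 0"
    unfolding forall_3_012 by (auto simp: jacobian_def det_UNIV_3 pd_zero)
  then show ?thesis by blast
qed

lemma ex_residue:
  assumes "homogeneous (6 * int n - 9) F"
  shows "\<exists>r. F - Const r * Det_G G \<in> sq_ideal G"
  unfolding sq_ideal_eq Det_G_eq
proof (rule jacobian_generates_socle)
  show "2 * (n - 1) > 0" using n by simp
  show "homogeneous (3 * int (2 * (n - 1)) - 3) F" using n assms by (simp add: of_nat_diff)
qed (rule homogeneous_partial_power partial_powers_no_common_zero, assumption?)+

text \<open>By \<open>jacobian_power\<close>, \<open>Det_G\<close> times the \<open>k\<close>-th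
  power of the product of the partials is a nonzero constant times the Jacobian of the powers with
  exponent \<open>k + 2\<close>, and that lies outside their ideal. The 8 below is the cube of the
  exponent 2.\<close>

lemma Det_G_power_notin:
  assumes "Const r * Det_G G * (pd 0 G * pd 1 G * pd 2 G) ^ k \<in> gen_ideal (\<lambda>i. pd i G ^ (k + 2))"
  shows "r = 0"
proof (rule ccontr)
  assume "r \<noteq> 0"
  let ?I = "gen_ideal (\<lambda>i. pd i G ^ (k + 2))"
  let ?H = "jacobian (\<lambda>i. pd i G)" and ?P = "pd 0 G * pd 1 G * pd 2 G"
  have I: "is_ideal ?I" by (rule is_ideal_gen_ideal)
  have 8: "Const r * Det_G G * ?P ^ k = Const (8 * r) * (?P ^ (k + 1) * ?H)"
    using Const_of_nat[of 8] unfolding Det_G_eq jacobian_power by (simp add: Const_mult mult_ac)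
  have "Const (of_nat (k + 2) ^ 3 / (8 * r)) * (Const r * Det_G G * ?P ^ k) \<in> ?I"
    by (rule is_ideal_mult[OF I assms])
  also have "Const (of_nat (k + 2) ^ 3 / (8 * r)) * (Const r * Det_G G * ?P ^ k)
      = (Const (of_nat (k + 2) ^ 3 / (8 * r)) * Const (8 * r)) * (?P ^ (k + 1) * ?H)"
    unfolding 8 by (simp only: mult.assoc)
  also have "Const (of_nat (k + 2) ^ 3 / (8 * r)) * Const (8 * r) = of_nat (k + 2) ^ 3"
    using \<open>r \<noteq> 0\<close> Const_of_nat[of "(k + 2) ^ 3"] by (simp flip: Const_mult)
  also have "of_nat (k + 2) ^ 3 * (?P ^ (k + 1) * ?H) = jacobian (\<lambda>i. pd i G ^ (k + 2))"
    unfolding jacobian_power by (simp add: mult_ac)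
  finally show False using jacobian_partial_power_notin[of "k + 2"] by simp
qed

section \<open>Logarithmic differential of a local equation and logarithmic lifts\<close>

lemma partial_hom: "homogeneous (int n - 1) (pd i G)"
  by (rule homogeneous_pd[OF hom])

lemma G_neq_0: "G \<noteq> 0"
  using partial_neq_0[of 0] by (auto simp: pd_zero)

lemma euler_rat: "(\<Sum>j\<in>UNIV. rat (Var j) * rat (pd j G)) = of_nat n * rat G"
  using arg_cong[OF euler_identity[OF hom], of rat] by (simp add: rat_hom rat_sum)

lemma local_eq_neq_0: "local_eq n G k \<noteq> 0"
  using G_neq_0 by (simp add: local_eq_def rat_eq_0_iff)

lemma d_local_eq: "d_fun (local_eq n G k) = local_eq n G k *s form1 (dlog n G k)"
proof -
  obtain m where m: "n = Suc m" using n by (cases n) auto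
  have "pd_rat i (local_eq n G k) = local_eq n G k * dlog n G k i" for i
  proof -
    have "local_eq n G k = rat G / rat (Var k ^ n)" by (simp add: local_eq_def rat_power)
    then have "pd_rat i (local_eq n G k)
      = (rat (pd i G) * rat (Var k ^ n) - rat G * rat (pd i (Var k ^ n))) / rat (Var k ^ n) ^ 2"
      by (simp add: pd_rat_divide)
    also have "pd i (Var k ^ n) = (if i = k then of_nat n * Var k ^ m else 0)"
      unfolding pd_power pd_Var by (simp add: m)
    also have "(rat (pd i G) * rat (Var k ^ n) - rat G * rat (if i = k then of_nat n * Var k ^ m else 0)) / rat (Var k ^ n) ^ 2
        = local_eq n G k * dlog n G k i"
      using G_neq_0 by (simp add: m local_eq_def dlog_def rat_hom rat_eq_0_iff field_simps power2_eq_square)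
    finally show ?thesis .
  qed
  then show ?thesis by (simp add: d_fun_form1 form1_simps)
qed

lemma dlog_eq: "inverse (local_eq n G k) *s d_fun (local_eq n G k) = form1 (dlog n G k)"
  using local_eq_neq_0 by (simp add: d_local_eq vec_eq_iff)

text \<open>The local equation has degree 0, so the Euler field annihilates it.\<close>

lemma dlog_euler: "(\<Sum>j\<in>UNIV. rat (Var j) * dlog n G k j) = 0"
proof -
  have "(\<Sum>j\<in>UNIV. rat (Var j) * dlog n G k j)
    = (\<Sum>j\<in>UNIV. rat (Var j) * rat (pd j G) / rat G - (if j = k then of_nat n else 0))"
    by (rule sum.cong) (auto simp: dlog_def right_diff_distrib rat_eq_0_iff)
  also have "\<dots> = (\<Sum>j\<in>UNIV. rat (Var j) * rat (pd j G)) / rat G - of_nat n"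
    by (simp add: sum_subtractf flip: sum_divide_distrib)
  finally show ?thesis using G_neq_0 by (simp add: euler_rat rat_eq_0_iff)
qed

lemma d_local_eq_in_Forms:
  assumes h: "homogeneous e h" "h \<noteq> 0"
  shows "d_fun (local_eq n G k) \<in> Forms (h * Var k) 1"
  unfolding d_local_eq form1_simps
proof (rule form1_in_Forms[OF hom_mult_Var[OF h]])
  fix i
  have "local_eq n G k * dlog n G k i
    = rat (pd i G * Var k - (if i = k then of_nat n * G else 0)) / rat (Var k) ^ (n + 1)"
    using G_neq_0 by (simp add: local_eq_def dlog_def rat_hom rat_eq_0_iff field_simps)
  then have "local_eq n G k * dlog n G k i \<in> loc (Var k) (-1)"
  proof (rule locI[OF _ homogeneous_Var])
    have "homogeneous (int n) (of_nat n * G)"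
      using homogeneous_mult[OF homogeneous_Const[of "of_nat n"] hom] by (simp add: Const_of_nat)
    then show "homogeneous (- 1 + int (n + 1) * 1) (pd i G * Var k - (if i = k then of_nat n * G else 0))"
      using homogeneous_mult'[OF partial_hom homogeneous_Var, of "int n" i k] by (auto intro: homogeneous_diff)
  qed
  then show "local_eq n G k * dlog n G k i \<in> loc (h * Var k) (-1)"
    by (rule loc_mono(2)[OF homogeneous_Var Var_neq_0 _ h])
next
  show "(\<Sum>j\<in>UNIV. rat (Var j) * (local_eq n G k * dlog n G k j)) = 0"
    using dlog_euler[of k] by (simp add: mult.left_commute flip: sum_distrib_left)
qed

text \<open>For \<open>\<omega> = g \<alpha> + f dg\<close>, wedging with \<open>dg/g\<close>
  cancels the pole in the first term and kills the second, leaving \<open>\<alpha>\<close> wedge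
  \<open>dg\<close>.\<close>

lemma restricts_to_zero_wedge_dlog:
  assumes h: "homogeneous e h" "h \<noteq> 0" and "restricts_to_zero n G h 1 \<omega>"
  shows "\<omega> \<and>\<^sub>f form1 (dlog n G k) \<in> Forms (h * Var k) 2"
proof -
  obtain \<alpha> \<beta> where ab: "\<alpha> \<in> Forms (h * Var k) 1" "\<beta> \<in> Forms (h * Var k) 0"
    "\<omega> = local_eq n G k *s \<alpha> + d_fun (local_eq n G k) \<and>\<^sub>f \<beta>"
    using assms(3)[unfolded restricts_to_zero_def, rule_format, of k] by auto
  obtain f where f: "\<beta> = form0 f" using Forms_0D[OF ab(2)] by blast
  have "\<omega> \<and>\<^sub>f form1 (dlog n G k) = \<alpha> \<and>\<^sub>f d_fun (local_eq n G k)"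
    unfolding ab(3) f wedge_form0_right d_local_eq wedge_add_left wedge_scale_left wedge_scale_right
      wedge_form1_self by simp
  also have "\<dots> \<in> Forms (h * Var k) 2"
    by (rule wedge_in_Forms_2[OF hom_mult_Var[OF h] ab(1) d_local_eq_in_Forms[OF h]])
  finally show ?thesis .
qed

lemma log_form_minus_wedge_dlog:
  assumes h: "homogeneous e h" "h \<noteq> 0" and "log_form_with_residue n G h 1 \<psi> \<phi>"
  shows "\<psi> - \<phi> \<and>\<^sub>f form1 (dlog n G k) \<in> Forms (h * Var k) 2"
proof -
  obtain \<omega> \<eta> where *: "\<eta> \<in> Forms (h * Var k) 2" "\<psi> = \<omega> \<and>\<^sub>f form1 (dlog n G k) + \<eta>"
    "restricts_to_zero n G (h * Var k) 1 (\<omega> - \<phi>)"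
    using assms(3) unfolding log_form_with_residue_def dlog_eq by (metis Suc_1)
  \<comment> \<open>Replacing \<open>\<omega>\<close> by \<open>\<phi>\<close> costs only a regular
    form; the factor \<open>Var k\<close> occurs twice because the chart \<open>k\<close> is chosen
    again.\<close>
  have "(\<omega> - \<phi>) \<and>\<^sub>f form1 (dlog n G k) \<in> Forms (h * Var k) 2"
    by (rule Forms_2_Var_square[OF h restricts_to_zero_wedge_dlog[OF hom_mult_Var[OF h] *(3)]])
  from Forms_2_add_diff(1)[OF hom_mult_Var[OF h] this *(1)] show ?thesis
    unfolding *(2) wedge_diff_left by (simp add: algebra_simps)
qed

lemma restricts_to_zero_0:
  assumes h: "homogeneous e h" "h \<noteq> 0" shows "restricts_to_zero n G h 1 0"
proof -
  have "\<omega> \<and>\<^sub>f 0 = 0" for \<omega> by (simp add: wedge_def vec_eq_iff)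
  then show ?thesis
    using zero_in_Forms[OF hom_mult_Var[OF h]]
    by (auto simp: restricts_to_zero_def intro!: bexI[of _ 0])
qed

lemma log_form_lift:
  assumes h: "homogeneous e h" "h \<noteq> 0" and c: "c \<in> loc h (-2)" "c' \<in> loc h (-2)"
  shows "log_form_with_residue n G h 1 (- ((c * rat (pd i G) + c' * rat (pd j G)) / rat G) *s Omega)
     (c *s contraction i Omega + c' *s contraction j Omega)"
  unfolding log_form_with_residue_def dlog_eq
proof (intro allI bexI conjI)
  fix k
  let ?\<phi> = "c *s contraction i Omega + c' *s contraction j Omega"
  \<comment> \<open>The difference between \<open>dG/G\<close> and \<open>dg/g\<close> is
    \<open>n\<close> times the logarithmic differential of \<open>Var k\<close>; it meets the
    contraction by \<open>i\<close> or \<open>j\<close> only if that index is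
    \<open>k\<close>.\<close>
  let ?f = "- (((if i = k then c else 0) + (if j = k then c' else 0)) * (rat (of_nat n) / rat (Var k)))"
  note hk = hom_mult_Var[OF h, of k]
  show "?\<phi> \<in> Forms (h * Var k) 1"
    by (intro Forms_1_mono[OF h homogeneous_Var Var_neq_0] Forms_1_add[OF h] contraction_Omega_in_Forms[OF h] c)
  have "?f \<in> loc (h * Var k) (-3)"
  proof (rule loc_uminus[OF hk loc_mult'[OF hk]])
    show "(if i = k then c else 0) + (if j = k then c' else 0) \<in> loc (h * Var k) (-2)"
      by (intro loc_mono(1)[OF h _ homogeneous_Var Var_neq_0] loc_add[OF h]) (auto simp: c loc_0[OF h])
    show "rat (of_nat n) / rat (Var k) \<in> loc (h * Var k) (-1)"
      using loc_divide_Var[OF h, of "-1" "of_nat n" k] homogeneous_Const[of "of_nat n"] by (simp add: Const_of_nat)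
  qed simp
  then show "?f *s Omega \<in> Forms (h * Var k) (Suc 1)"
    unfolding Suc_1 using Forms_2_iff[OF hk] by blast
  have "?\<phi> \<and>\<^sub>f form1 (dlog n G k) = (- (c * dlog n G k i + c' * dlog n G k j)) *s Omega"
    unfolding wedge_add_left wedge_scale_left contraction_Omega_wedge[OF dlog_euler]
    by (simp add: vec_eq_iff algebra_simps)
  moreover have "- ((c * rat (pd i G) + c' * rat (pd j G)) / rat G) = - (c * dlog n G k i + c' * dlog n G k j) + ?f"
    using G_neq_0 by (simp add: dlog_def rat_hom rat_eq_0_iff field_simps)
  ultimately show "- ((c * rat (pd i G) + c' * rat (pd j G)) / rat G) *s Omega
    = ?\<phi> \<and>\<^sub>f form1 (dlog n G k) + ?f *s Omega"
    by (simp only: flip: vector_sadd_rdistrib)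
  show "restricts_to_zero n G (h * Var k) 1 (?\<phi> - ?\<phi>)"
    using restricts_to_zero_0[OF hk] by simp
qed

subsection \<open>The connecting map and the residue\<close>

lemma cover_poly_hom: "homogeneous (int (length s) * (int n - 1)) (cover_poly G s)"
  and cover_poly_nz: "cover_poly G s \<noteq> 0"
proof (induction s)
  case (Cons i s)
  { case 1
    show ?case
      using homogeneous_mult'[OF partial_hom[of i] Cons(1), of "int (length (i # s)) * (int n - 1)"]
      by (simp add: cover_poly_def algebra_simps) }
  { case 2
    show ?case using Cons(2) partial_neq_0 by (simp add: cover_poly_def) }
qed (simp_all add: cover_poly_def)

lemma H2_class_eqI:
  assumes \<eta>: "\<eta> \<in> Cochains G 2 1" "c [0, 1, 2] - c' [0, 1, 2] = cech_delta \<eta> [0, 1, 2]"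
  shows "H2_class G c = H2_class G c'"
proof -
  have sub: "H2_class G c \<subseteq> H2_class G c'"
    if \<eta>: "\<eta> \<in> Cochains G 2 1" "c [0, 1, 2] - c' [0, 1, 2] = cech_delta \<eta> [0, 1, 2]" for \<eta> c c'
  proof
    fix b assume "b \<in> H2_class G c"
    then obtain \<theta> where b: "b \<in> Cochains G 2 2" "\<theta> \<in> Cochains G 2 1"
      "b [0, 1, 2] - c [0, 1, 2] = cech_delta \<theta> [0, 1, 2]"
      by (auto simp: H2_class_def simplices_2)
    let ?\<eta> = "\<lambda>s. \<theta> s + \<eta> s"
    have "?\<eta> \<in> Cochains G 2 1"
      using b(2) \<eta>(1) Forms_2_add_diff(1)[OF cover_poly_hom cover_poly_nz] by (simp add: Cochains_def)
    moreover have "b [0, 1, 2] - c' [0, 1, 2] = cech_delta ?\<eta> [0, 1, 2]"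
      using b(3) \<eta>(2) by (simp add: cech_delta_triple algebra_simps)
    ultimately show "b \<in> H2_class G c'"
      using b(1) by (auto simp: H2_class_def simplices_2)
  qed
  let ?\<eta> = "\<lambda>s. 0 - \<eta> s"
  have "?\<eta> \<in> Cochains G 2 1"
    using \<eta>(1) Forms_2_add_diff(2)[OF cover_poly_hom cover_poly_nz zero_in_Forms[OF cover_poly_hom cover_poly_nz]]
    by (simp add: Cochains_def)
  moreover have "c' [0, 1, 2] - c [0, 1, 2] = cech_delta ?\<eta> [0, 1, 2]"
    using \<eta>(2) by (simp add: cech_delta_triple algebra_simps)
  ultimately show ?thesis using sub \<eta> by blast
qed

text \<open>
  The form \<open>dG/G - n/(n-1) dG\<^sub>i/G\<^sub>i\<close> is the logarithmic differential, up to the factor \<open>n-1\<close>, of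
  \<open>G\<^bsup>n-1\<^esup>/G\<^sub>i\<^sup>n\<close>, a regular function on \<open>U\<^sub>i\<close>. Unlike \<open>dg/g\<close> for a local equation, it is
  available on all of \<open>U\<^sub>i\<close>.
\<close>

definition cover_dlog :: "3 \<Rightarrow> 3 \<Rightarrow> ratfun" where
  "cover_dlog i l = rat (pd l G) / rat G - rat (Const (of_nat n / of_nat (n - 1)) * pd l (pd i G)) / rat (pd i G)"

text \<open>The difference is \<open>n/(n-1)\<close> times the logarithmic differential of
  \<open>pd i G / Var k ^ (n-1)\<close>, a unit of degree 0 on this open set.\<close>

lemma dlog_minus_cover_dlog_in_Forms:
  "form1 (dlog n G k) - form1 (cover_dlog i) \<in> Forms (pd i G * Var k) 1"
proof -
  let ?c = "of_nat n / of_nat (n - 1) :: complex"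
  let ?a = "\<lambda>l. rat (Const ?c * pd l (pd i G)) / rat (pd i G) - (if l = k then rat (of_nat n) / rat (Var k) else 0)"
  note hk = hom_mult_Var[OF partial_hom partial_neq_0]
  have "form1 (dlog n G k) - form1 (cover_dlog i) = form1 ?a"
    unfolding form1_simps
    by (intro arg_cong[of _ _ form1] ext) (simp add: dlog_def cover_dlog_def rat_of_nat)
  also have "form1 ?a \<in> Forms (pd i G * Var k) 1"
  proof (rule form1_in_Forms[OF hk])
    fix l
    have "rat (Const ?c * pd l (pd i G)) / rat (pd i G) \<in> loc (pd i G) (int n - 1 - 1 - (int n - 1))"
      by (rule loc_divide_self[OF partial_hom partial_neq_0])
        (rule homogeneous_mult'[OF homogeneous_Const homogeneous_pd[OF partial_hom]], simp)
    then have 1: "rat (Const ?c * pd l (pd i G)) / rat (pd i G) \<in> loc (pd i G * Var k) (-1)"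
      using loc_mono(1)[OF partial_hom partial_neq_0 _ homogeneous_Var Var_neq_0] by simp
    have 2: "rat (of_nat n) / rat (Var k) \<in> loc (pd i G * Var k) (-1)"
      using loc_divide_Var[OF partial_hom partial_neq_0, of "-1" "of_nat n" k i] homogeneous_Const[of "of_nat n"]
      by (simp add: Const_of_nat)
    show "?a l \<in> loc (pd i G * Var k) (-1)"
      by (rule loc_diff[OF hk 1]) (simp add: 2 loc_0[OF hk])
  next
    have "(\<Sum>l\<in>UNIV. rat (Var l) * ?a l)
      = (\<Sum>l\<in>UNIV. rat (Const ?c * (Var l * pd l (pd i G))) / rat (pd i G) - (if l = k then of_nat n else 0))"
      by (rule sum.cong) (auto simp: right_diff_distrib rat_hom rat_eq_0_iff mult_ac)
    also have "\<dots> = rat (Const ?c * (\<Sum>l\<in>UNIV. Var l * pd l (pd i G))) / rat (pd i G) - of_nat n"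
      by (simp add: sum_subtractf rat_sum sum_distrib_left flip: sum_divide_distrib)
    also have "(\<Sum>l\<in>UNIV. Var l * pd l (pd i G)) = of_nat (n - 1) * pd i G"
      by (rule euler_identity[OF homogeneous_partial])
    also have "Const ?c * (of_nat (n - 1) * pd i G) = of_nat n * pd i G"
    proof -
      have "Const ?c * of_nat (n - 1) = of_nat n"
        using n by (simp flip: Const_of_nat Const_mult)
      then show ?thesis by (simp only: mult.assoc[symmetric])
    qed
    also have "rat (of_nat n * pd i G) / rat (pd i G) - of_nat n = 0"
      using partial_neq_0 by (simp add: rat_hom rat_eq_0_iff)
    finally show "(\<Sum>l\<in>UNIV. rat (Var l) * ?a l) = 0" .
  qed
  finally show ?thesis .
qed

text \<open>Independence of both the representative and the lift. The difference of the lifts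
  becomes regular after subtracting the coboundary of \<open>\<tau>\<close>, and subtracting a
  coboundary does not affect the second coboundary.\<close>

lemma connecting_well_defined:
  assumes \<phi>: "\<phi> \<in> H1_class_on_curve n G \<phi>0" and lift: "log_lift n G \<phi>0 \<psi>0" "log_lift n G \<phi> \<psi>"
  shows "H2_class G (cech_delta \<psi>) = H2_class G (cech_delta \<psi>0)"
proof -
  obtain \<beta> where \<beta>: "\<beta> \<in> Cochains G 1 0"
    "\<And>s. s \<in> simplices 1 \<Longrightarrow> restricts_to_zero n G (cover_poly G s) 1 (\<phi> s - \<phi>0 s - cech_delta \<beta> s)"
    using \<phi> by (auto simp: H1_class_on_curve_def)
  \<comment> \<open>A logarithmic lift of \<open>\<beta>\<close> on each whole set of the cover, so
    that its Cech coboundary makes sense without a choice of chart.\<close>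
  define \<tau> where "\<tau> s = \<beta> s \<and>\<^sub>f form1 (cover_dlog (hd s))" for s
  define \<eta> where "\<eta> s = \<psi> s - \<psi>0 s - cech_delta \<tau> s" for s
  have \<beta>\<tau>: "\<beta> [i] \<and>\<^sub>f form1 (dlog n G k) - \<tau> [i] \<in> Forms (pd i G * pd j G * Var k) 2"
    and \<beta>\<tau>': "\<beta> [i] \<and>\<^sub>f form1 (dlog n G k) - \<tau> [i] \<in> Forms (pd j G * pd i G * Var k) 2" for i j k
  proof -
    note hk = hom_mult_Var[OF partial_hom partial_neq_0, of i k]
    have "[i] \<in> simplices 0" using UNIV_3_cases[of i] by (auto simp: simplices_0)
    then have "\<beta> [i] \<in> Forms (pd i G) 1" using \<beta>(1) by (auto simp: Cochains_def cover_poly_def)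
    then have b: "\<beta> [i] \<in> Forms (pd i G * Var k * pd j G) 1"
      by (intro Forms_1_mono[OF hk partial_hom partial_neq_0] Forms_1_mono[OF partial_hom partial_neq_0 homogeneous_Var Var_neq_0])
    have "\<beta> [i] \<and>\<^sub>f (form1 (dlog n G k) - form1 (cover_dlog i)) \<in> Forms (pd i G * Var k * pd j G) 2"
      by (rule wedge_in_Forms_2[OF homogeneous_mult[OF hk(1) partial_hom] _ b
            Forms_1_mono[OF hk partial_hom partial_neq_0 dlog_minus_cover_dlog_in_Forms]])
        (use hk(2) partial_neq_0 in simp)
    then show "\<beta> [i] \<and>\<^sub>f form1 (dlog n G k) - \<tau> [i] \<in> Forms (pd i G * pd j G * Var k) 2"
      and "\<beta> [i] \<and>\<^sub>f form1 (dlog n G k) - \<tau> [i] \<in> Forms (pd j G * pd i G * Var k) 2"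
      by (simp_all add: \<tau>_def wedge_diff_right mult_ac)
  qed
  have "\<eta> s \<in> Forms (cover_poly G s) 2" if s: "s \<in> simplices 1" for s
  proof (rule Forms_2_glue[OF cover_poly_hom cover_poly_nz])
    fix k
    let ?\<theta> = "form1 (dlog n G k)"
    obtain i j where ij: "s = [i, j]" using s unfolding simplices_1 by auto
    have h: "cover_poly G s = pd i G * pd j G" by (simp add: ij cover_poly_def)
    note hs = cover_poly_hom[of s] cover_poly_nz[of s]
    have "log_form_with_residue n G (cover_poly G s) 1 (\<psi> s) (\<phi> s)"
      "log_form_with_residue n G (cover_poly G s) 1 (\<psi>0 s) (\<phi>0 s)"
      using lift s by (auto simp: log_lift_def)
    note log = this[THEN log_form_minus_wedge_dlog[OF hs], of k]
    note add = Forms_2_add_diff(1)[OF hom_mult_Var[OF hs]] and sub = Forms_2_add_diff(2)[OF hom_mult_Var[OF hs]]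
    note res = restricts_to_zero_wedge_dlog[OF hs \<beta>(2)[OF s], of k]
    \<comment> \<open>All terms wedged with \<open>dg/g\<close> cancel, and each bracket is regular
      on the chart \<open>k\<close>.\<close>
    have "\<eta> s = (\<psi> s - \<phi> s \<and>\<^sub>f ?\<theta>) - (\<psi>0 s - \<phi>0 s \<and>\<^sub>f ?\<theta>) + (\<phi> s - \<phi>0 s - cech_delta \<beta> s) \<and>\<^sub>f ?\<theta>
      + ((\<beta> [j] \<and>\<^sub>f ?\<theta> - \<tau> [j]) - (\<beta> [i] \<and>\<^sub>f ?\<theta> - \<tau> [i]))"
      unfolding \<eta>_def ij cech_delta_pair wedge_diff_left by simp
    also have "\<dots> \<in> Forms (cover_poly G s * Var k) 2"
      by (intro add[OF add[OF sub[OF log] res] sub]) (simp_all only: h \<beta>\<tau> \<beta>\<tau>')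
    finally show "\<eta> s \<in> Forms (cover_poly G s * Var k) 2" .
  qed
  then have "\<eta> \<in> Cochains G 2 1" by (simp add: Cochains_def)
  moreover have "cech_delta \<psi> [0, 1, 2] - cech_delta \<psi>0 [0, 1, 2] = cech_delta \<eta> [0, 1, 2]"
    by (simp add: \<eta>_def cech_delta_triple cech_delta_pair algebra_simps)
  ultimately show ?thesis by (rule H2_class_eqI)
qed

lemma connecting_eq:
  assumes "\<phi> \<in> Cochains G 1 1" and lift: "log_lift n G \<phi> \<psi>"
  shows "connecting n G (H1_class_on_curve n G \<phi>) = H2_class G (cech_delta \<psi>)"
proof -
  have "(\<lambda>_. 0) \<in> Cochains G 1 0"
    using zero_in_Forms[OF cover_poly_hom cover_poly_nz] by (simp add: Cochains_def)
  moreover have "cech_delta (\<lambda>_. 0) s = 0" for s by (simp add: cech_delta_def)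
  ultimately have "\<phi> \<in> H1_class_on_curve n G \<phi>"
    using assms(1) restricts_to_zero_0[OF cover_poly_hom cover_poly_nz]
    by (auto simp: H1_class_on_curve_def intro!: bexI[of _ "\<lambda>_. 0"])
  then show ?thesis
    unfolding connecting_def
    using lift connecting_well_defined by (intro the_equality) blast+
qed

text \<open>The degree is forgotten here, since the argument that follows concerns ideal membership
  only.\<close>

lemma numerator_in_gen_ideal:
  assumes "f \<in> loc (pd i G * pd j G) m"
  shows "\<exists>a k. f = rat a / rat (pd i G * pd j G) ^ k"
  using assms loc_iff[OF homogeneous_mult[OF partial_hom partial_hom], of i j f m]
    partial_neq_0 by auto

text \<open>Each of the three terms of a coboundary lacks one partial derivative in its denominator.
  After multiplication by a high power of the product of all three, each term is divisible by that
  power of the missing one.\<close>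

lemma coboundary_numerator_in_ideal:
  assumes \<eta>: "\<eta> \<in> Cochains G 2 1"
    and eq: "(rat F / rat (cover_poly G [0, 1, 2]) ^ 2) *s Omega = cech_delta \<eta> [0, 1, 2]"
  shows "\<exists>K. F * (pd 0 G * pd 1 G * pd 2 G) ^ K \<in> gen_ideal (\<lambda>i. pd i G ^ (K + 2))"
proof -
  let ?P = "pd 0 G * pd 1 G * pd 2 G"
  note nz = partial_neq_0
  have ex: "\<exists>a k. \<eta> [i, j] = (rat a / rat (pd i G * pd j G) ^ k) *s Omega" if "[i, j] \<in> simplices 1" for i j
  proof -
    have "\<eta> [i, j] \<in> Forms (cover_poly G [i, j]) 2" using \<eta> that by (auto simp: Cochains_def)
    then obtain f where f: "f \<in> loc (cover_poly G [i, j]) (-3)" "\<eta> [i, j] = f *s Omega"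
      using Forms_2_iff[OF cover_poly_hom cover_poly_nz] by blast
    then show ?thesis using numerator_in_gen_ideal[of f i j "-3"] by (auto simp: cover_poly_def)
  qed
  obtain a0 k0 where a0: "\<eta> [1, 2] = (rat a0 / rat (pd 1 G * pd 2 G) ^ k0) *s Omega"
    using ex[of 1 2] by (auto simp: simplices_1[unfolded One_nat_def])
  obtain a1 k1 where a1: "\<eta> [0, 2] = (rat a1 / rat (pd 0 G * pd 2 G) ^ k1) *s Omega"
    using ex[of 0 2] by (auto simp: simplices_1[unfolded One_nat_def])
  obtain a2 k2 where a2: "\<eta> [0, 1] = (rat a2 / rat (pd 0 G * pd 1 G) ^ k2) *s Omega"
    using ex[of 0 1] by (auto simp: simplices_1[unfolded One_nat_def])
  \<comment> \<open>A common bound for the three pole orders.\<close>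
  define K where "K = k0 + k1 + k2"
  have "(rat F / rat ?P ^ 2) *s Omega = (rat a0 / rat (pd 1 G * pd 2 G) ^ k0
      - rat a1 / rat (pd 0 G * pd 2 G) ^ k1 + rat a2 / rat (pd 0 G * pd 1 G) ^ k2) *s Omega"
    using eq unfolding cech_delta_triple a0 a1 a2
    by (simp add: cover_poly_def mult.assoc vector_sadd_rdistrib vector_ssub_ldistrib vec_eq_iff algebra_simps)
  then have *: "rat F / rat ?P ^ 2 = rat a0 / rat (pd 1 G * pd 2 G) ^ k0
      - rat a1 / rat (pd 0 G * pd 2 G) ^ k1 + rat a2 / rat (pd 0 G * pd 1 G) ^ k2"
    by (rule iffD1[OF Omega_scale_cancel])
  have clear: "rat a / rat q ^ k * rat (p * q) ^ (K + 2) = rat (a * q ^ (K + 2 - k) * p ^ (K + 2))"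
    if "q \<noteq> 0" "k \<le> K" for a p q k
  proof -
    have e: "rat q ^ (K + 2) = rat q ^ k * rat q ^ (K + 2 - k)" using that by (simp flip: power_add)
    show ?thesis
      unfolding rat_mult rat_power power_mult_distrib e using that(1) by (simp add: rat_eq_0_iff)
  qed
  have q: "pd 1 G * pd 2 G \<noteq> 0" "pd 0 G * pd 2 G \<noteq> 0" "pd 0 G * pd 1 G \<noteq> 0" using nz by simp_all
  have k: "k0 \<le> K" "k1 \<le> K" "k2 \<le> K" by (simp_all add: K_def)
  have "rat (F * ?P ^ K) = rat F / rat ?P ^ 2 * rat ?P ^ (K + 2)"
    using nz by (simp add: rat_hom rat_eq_0_iff power_add power2_eq_square)
  also have "\<dots> = rat a0 / rat (pd 1 G * pd 2 G) ^ k0 * rat (pd 0 G * (pd 1 G * pd 2 G)) ^ (K + 2)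
     - rat a1 / rat (pd 0 G * pd 2 G) ^ k1 * rat (pd 1 G * (pd 0 G * pd 2 G)) ^ (K + 2)
     + rat a2 / rat (pd 0 G * pd 1 G) ^ k2 * rat (pd 2 G * (pd 0 G * pd 1 G)) ^ (K + 2)"
    unfolding * by (simp add: algebra_simps)
  also have "\<dots> = rat (a0 * (pd 1 G * pd 2 G) ^ (K + 2 - k0) * pd 0 G ^ (K + 2)
    - a1 * (pd 0 G * pd 2 G) ^ (K + 2 - k1) * pd 1 G ^ (K + 2)
    + a2 * (pd 0 G * pd 1 G) ^ (K + 2 - k2) * pd 2 G ^ (K + 2))"
    by (simp only: rat_add rat_diff clear[OF q(1) k(1)] clear[OF q(2) k(2)] clear[OF q(3) k(3)])
  finally have "F * ?P ^ K = a0 * (pd 1 G * pd 2 G) ^ (K + 2 - k0) * pd 0 G ^ (K + 2)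
    + (- a1 * (pd 0 G * pd 2 G) ^ (K + 2 - k1)) * pd 1 G ^ (K + 2)
    + a2 * (pd 0 G * pd 1 G) ^ (K + 2 - k2) * pd 2 G ^ (K + 2)"
    unfolding rat_eq_iff by simp
  then show ?thesis unfolding gen_ideal_3 by blast
qed

lemma sq_ideal_mult_power:
  assumes "x \<in> sq_ideal G"
  shows "x * (pd 0 G * pd 1 G * pd 2 G) ^ K \<in> gen_ideal (\<lambda>i. pd i G ^ (K + 2))"
proof -
  obtain a b c where "x = a * pd 0 G ^ 2 + b * pd 1 G ^ 2 + c * pd 2 G ^ 2"
    using assms by (auto simp: sq_ideal_eq gen_ideal_3)
  then have "x * (pd 0 G * pd 1 G * pd 2 G) ^ K = (a * (pd 1 G * pd 2 G) ^ K) * pd 0 G ^ (K + 2)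
    + (b * (pd 0 G * pd 2 G) ^ K) * pd 1 G ^ (K + 2) + (c * (pd 0 G * pd 1 G) ^ K) * pd 2 G ^ (K + 2)"
    by (simp add: power_add power_mult_distrib power2_eq_square algebra_simps)
  then show ?thesis unfolding gen_ideal_3 by blast
qed

text \<open>The numerator \<open>F\<close> gives existence. For uniqueness, the difference of two
  admissible numerators is the numerator of a coboundary, so it enters the ideal of higher powers,
  where no nonzero multiple of \<open>Det_G\<close> can follow.\<close>

lemma Res0_eq:
  assumes F: "homogeneous (6 * int n - 9) F"
    and c: "c [0, 1, 2] = (rat F / rat (cover_poly G [0, 1, 2]) ^ 2) *s Omega"
    and r: "F - Const r * Det_G G \<in> sq_ideal G"
  shows "Res0 n G (H2_class G c) = r"
  unfolding Res0_def
proof (rule the_equality)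
  let ?h = "cover_poly G [0, 1, 2]"
  have h: "homogeneous (3 * (int n - 1)) ?h" "?h \<noteq> 0"
    using cover_poly_hom[of "[0, 1, 2]"] cover_poly_nz by simp_all
  let ?c = "\<lambda>s. (rat F / rat (cover_poly G s) ^ 2) *s Omega"
  have "rat F / rat ?h ^ 2 \<in> loc ?h (-3)"
    by (rule locI[OF refl h(1)]) (use F in simp)
  then have "?c \<in> Cochains G 2 2"
    using Forms_2_iff[OF h] by (auto simp: Cochains_def simplices_2)
  moreover have "(\<lambda>_. 0) \<in> Cochains G 2 1"
    using zero_in_Forms[OF cover_poly_hom cover_poly_nz]
    by (simp add: Cochains_def)
  ultimately have "?c \<in> H2_class G c"
    using c by (auto simp: H2_class_def simplices_2 cech_delta_triple intro!: bexI[of _ "\<lambda>_. 0"])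
  then show "\<exists>F. homogeneous (6 * int n - 9) F \<and>
     (\<lambda>s. (rat F / rat (cover_poly G s) ^ 2) *s Omega) \<in> H2_class G c \<and>
     F - Const r * Det_G G \<in> sq_ideal G"
    using F r by blast
next
  fix r' assume "\<exists>F. homogeneous (6 * int n - 9) F \<and>
     (\<lambda>s. (rat F / rat (cover_poly G s) ^ 2) *s Omega) \<in> H2_class G c \<and>
     F - Const r' * Det_G G \<in> sq_ideal G"
  then obtain F' where F': "(\<lambda>s. (rat F' / rat (cover_poly G s) ^ 2) *s Omega) \<in> H2_class G c"
    "F' - Const r' * Det_G G \<in> sq_ideal G" by blast
  then obtain \<eta> where \<eta>: "\<eta> \<in> Cochains G 2 1"
    "(rat F' / rat (cover_poly G [0, 1, 2]) ^ 2) *s Omega - c [0, 1, 2] = cech_delta \<eta> [0, 1, 2]"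
    by (auto simp: H2_class_def simplices_2)
  have "(rat (F' - F) / rat (cover_poly G [0, 1, 2]) ^ 2) *s Omega = cech_delta \<eta> [0, 1, 2]"
    using \<eta>(2) unfolding c by (simp add: rat_diff diff_divide_distrib vector_sub_rdistrib)
  from coboundary_numerator_in_ideal[OF \<eta>(1) this] obtain K where
    K: "(F' - F) * (pd 0 G * pd 1 G * pd 2 G) ^ K \<in> gen_ideal (\<lambda>i. pd i G ^ (K + 2))" by blast
  let ?I = "gen_ideal (\<lambda>i. pd i G ^ (K + 2))" and ?P = "(pd 0 G * pd 1 G * pd 2 G) ^ K"
  have I: "is_ideal ?I" by (rule is_ideal_gen_ideal)
  \<comment> \<open>Only after multiplication by \<open>?P\<close> do all three contributions lie in
    one ideal.\<close>
  have "Const (r' - r) * Det_G G * ?P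
    = (F' - F) * ?P - ((F' - Const r' * Det_G G) * ?P - (F - Const r * Det_G G) * ?P)"
    by (simp add: Const_diff algebra_simps)
  also have "\<dots> \<in> ?I"
    by (intro is_ideal_diff[OF I] K sq_ideal_mult_power F'(2) r)
  finally have "r' - r = 0" by (rule Det_G_power_notin)
  then show "r' = r" by simp
qed

end

section \<open>The Massey cocycle and its coboundary\<close>

lemma Omega_at_single: "Omega_at [i] = contraction i Omega"
  by (simp add: Omega_at_def)

text \<open>The polynomial \<open>\<Omega>\<close> with indices \<open>i < j\<close>; the values at
  other pairs are immaterial.\<close>

definition Omega_pair :: "3 \<Rightarrow> 3 \<Rightarrow> mpoly3" where
  "Omega_pair i j = (if i = 0 then (if j = 1 then Var 2 else - Var 1) else Var 0)"

lemma Omega_at_pair: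
  assumes "[i, j] \<in> simplices 1" shows "Omega_at [i, j] = form0 (rat (Omega_pair i j))"
proof -
  have "(i = 0 \<and> j = 1) \<or> (i = 0 \<and> j = 2) \<or> (i = 1 \<and> j = 2)"
    using assms unfolding simplices_1 by auto
  then show ?thesis
    by (auto simp: Omega_at_def Omega_form2 contraction_form2 contraction_form1 Omega_pair_def rat_uminus)
qed

lemma massey_numerator_identity:
  fixes G0 G1 G2 x0 x1 x2 N :: "'a::idom"
  assumes euler: "x0 * G0 + x1 * G1 + x2 * G2 = N * G"
    and R: "U0 * U1 = R0 * G0 + R1 * G1 + R2 * G2" and S: "U1 * U2 = S0 * G0 + S1 * G1 + S2 * G2"
    and A: "A = U0 * x1 * S0 * G0 * G1 + U2 * x0 * R2 * G0 * G2 + U0 * x0 * S0 * G0 ^ 2"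
    and B: "B = (x1 * R2 - x2 * R1) * U2 * G1 * G2 + U0 * (- x0 * S2 + x2 * S0) * G0 * G2 + U0 * U1 * U2 * x0 * G0"
  shows "N * (A - B) * G = - (U2 * (x0 * (- x0 * R2 + x2 * R0) * G0 ^ 2 * G2
      + x1 * (x1 * R2 - x2 * R1) * G1 ^ 2 * G2 + x2 * (x1 * R2 - x2 * R1) * G1 * G2 ^ 2)
    + U0 * (x0 * (x0 * S1 - x1 * S0) * G0 ^ 2 * G1 + x1 * (x0 * S1 - x1 * S0) * G0 * G1 ^ 2
      + x2 * (- x0 * S2 + x2 * S0) * G0 * G2 ^ 2))"
proof -
  \<comment> \<open>Expanding \<open>U1 * U2\<close> in the last term of \<open>B\<close> cancels
    the summands containing \<open>x0 * S0\<close> and \<open>x0 * S2\<close>.\<close>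
  have AB: "A - B = U0 * x1 * S0 * G0 * G1 + U2 * x0 * R2 * G0 * G2
    - (x1 * R2 - x2 * R1) * U2 * G1 * G2 - U0 * x0 * S1 * G0 * G1 - U0 * x2 * S0 * G0 * G2"
    unfolding A B using S by algebra
  have "N * (A - B) * G = (A - B) * (x0 * G0 + x1 * G1 + x2 * G2)"
    unfolding euler by (simp add: mult_ac)
  \<comment> \<open>The two sides differ by \<open>x0 * x2 * G0 * G2\<close> times \<open>U2 * (R0 *
    G0 + R1 * G1 + R2 * G2) - U0 * (S0 * G0 + S1 * G1 + S2 * G2)\<close>, and both of these products
    equal \<open>U0 * U1 * U2\<close>.\<close>
  then show ?thesis unfolding AB using R S by algebra
qed

text \<open>The summands are the lift on the pairs 12, 02 and 01. Over the common denominator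
  \<open>g * (g0 * g1 * g2) ^ 2\<close> their numerator is divisible by \<open>g\<close>, by
  \<open>fg\<close>.\<close>

lemma massey_coboundary_coefficient:
  fixes f g g0 g1 g2 :: "'a::field"
  assumes nz: "g \<noteq> 0" "g0 \<noteq> 0" "g1 \<noteq> 0" "g2 \<noteq> 0"
    and fg: "f * g = - (U2 * (x0 * A1 * g0 ^ 2 * g2 + x1 * A0 * g1 ^ 2 * g2 + x2 * A0 * g1 * g2 ^ 2)
      + U0 * (x0 * B2 * g0 ^ 2 * g1 + x1 * B2 * g0 * g1 ^ 2 + x2 * B1 * g0 * g2 ^ 2))"
  shows "- ((A1 / g1 ^ 2 * (U2 / (g1 * g2) * x0) * g1 + U0 / (g1 * g2) * x0 * (B2 / g2 ^ 2) * g2) / g)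
      - (- ((A0 / g0 ^ 2 * (U2 / (g0 * g2) * (- x1)) * g0 + U0 / (g0 * g2) * (- x1) * (B2 / g2 ^ 2) * g2) / g))
      + (- ((A0 / g0 ^ 2 * (U2 / (g0 * g1) * x2) * g0 + U0 / (g0 * g1) * x2 * (B1 / g1 ^ 2) * g1) / g))
    = f / (g0 * g1 * g2) ^ 2"
proof -
  have "- ((A1 / g1 ^ 2 * (U2 / (g1 * g2) * x0) * g1 + U0 / (g1 * g2) * x0 * (B2 / g2 ^ 2) * g2) / g)
      - (- ((A0 / g0 ^ 2 * (U2 / (g0 * g2) * (- x1)) * g0 + U0 / (g0 * g2) * (- x1) * (B2 / g2 ^ 2) * g2) / g))
      + (- ((A0 / g0 ^ 2 * (U2 / (g0 * g1) * x2) * g0 + U0 / (g0 * g1) * x2 * (B1 / g1 ^ 2) * g1) / g))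
    = - (U2 * (x0 * A1 * g0 ^ 2 * g2 + x1 * A0 * g1 ^ 2 * g2 + x2 * A0 * g1 * g2 ^ 2)
      + U0 * (x0 * B2 * g0 ^ 2 * g1 + x1 * B2 * g0 * g1 ^ 2 + x2 * B1 * g0 * g2 ^ 2)) / (g * (g0 * g1 * g2) ^ 2)"
    using nz by (simp add: field_simps power2_eq_square)
  then show ?thesis unfolding fg[symmetric] using nz by simp
qed

lemma homogeneous_cong: "homogeneous d p \<Longrightarrow> d = e \<Longrightarrow> homogeneous e p"
  by simp

lemma homogeneous_A_poly:
  assumes "\<And>i. homogeneous d (R i)" shows "homogeneous (1 + d) (A_poly R i)"
  unfolding A_poly_def
  by (auto intro!: homogeneous_add homogeneous_diff homogeneous_mult homogeneous_Var homogeneous_uminus assms)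

lemma homogeneous_Omega_pair: "homogeneous 1 (Omega_pair i j)"
  by (simp add: Omega_pair_def homogeneous_Var homogeneous_uminus)

theorem corollary3p2:
  fixes n :: nat and G U0 U1 U2 A B :: mpoly3 and R01 R12 :: "3 \<Rightarrow> mpoly3"
  assumes "n \<ge> 2" and "homogeneous (int n) G" and "smooth_curve G"
    and "homogeneous (2 * int n - 3) U0"
    and "homogeneous (int n - 3) U1"
    and "homogeneous (2 * int n - 3) U2"
    and "\<And>i. homogeneous (2 * int n - 5) (R01 i)"
    and "\<And>i. homogeneous (2 * int n - 5) (R12 i)"
    and "U0 * U1 = (\<Sum>i\<in>UNIV. R01 i * pd i G)"
    and "U1 * U2 = (\<Sum>i\<in>UNIV. R12 i * pd i G)"
    and "A = U0 * Var 1 * R12 0 * pd 0 G * pd 1 G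
           + U2 * Var 0 * R01 2 * pd 0 G * pd 2 G
           + U0 * Var 0 * R12 0 * (pd 0 G)\<^sup>2"
    and "B = A_poly R01 0 * U2 * pd 1 G * pd 2 G
           + U0 * A_poly R12 1 * pd 0 G * pd 2 G
           + U0 * U1 * U2 * Var 0 * pd 0 G"
  shows "massey_triple n G (W G U0) (W G U1) (W G U2) (W01 G R01) (W12 G R12) = 0
         \<longleftrightarrow> A - B \<in> sq_ideal G"
proof -
  note curve = assms(1-3)
  note pnz = partial_neq_0[OF curve] and phom = partial_hom[OF curve]
  note chom = cover_poly_hom[OF curve] and cnz = cover_poly_nz[OF curve]
  note Ahom = homogeneous_A_poly[of "2 * int n - 5", OF assms(7)] homogeneous_A_poly[of "2 * int n - 5", OF assms(8)]
  \<comment> \<open>\<open>c\<close> comes from the product of \<open>W01\<close> with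
    \<open>U2\<close> and multiplies the first contraction, \<open>d\<close> from the product of
    \<open>U0\<close> with \<open>W12\<close> and multiplies the second. In \<open>d\<close> the
    sign of \<open>bullet 1 1\<close> cancels the sign in \<open>W12\<close>.\<close>
  define c where "c i j = rat (A_poly R01 i) / rat (pd i G) ^ 2 * (rat U2 / rat (pd i G * pd j G) * rat (Omega_pair i j))" for i j
  define d where "d i j = rat U0 / rat (pd i G * pd j G) * rat (Omega_pair i j) * (rat (A_poly R12 j) / rat (pd j G) ^ 2)" for i j
  define \<phi> where "\<phi> s = bullet 0 0 (W01 G R01) (W G U2) s + bullet 1 1 (W G U0) (W12 G R12) s" for s
  define k where "k i j = - ((c i j * rat (pd i G) + d i j * rat (pd j G)) / rat G)" for i j
  define \<psi> :: cochain where "\<psi> s = k (hd s) (last s) *s Omega" for s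
  \<comment> \<open>The factor \<open>n\<close> is the one from Euler's relation.\<close>
  define F where "F = of_nat n * (A - B)"
  have \<phi>: "\<phi> [i, j] = c i j *s contraction i Omega + d i j *s contraction j Omega"
    if "[i, j] \<in> simplices 1" for i j
    by (simp add: \<phi>_def bullet_def cochain_wedge_def W01_def W_def W12_def Omega_at_single cover_poly_def
        Omega_at_pair[OF that] form0_scale wedge_form0_left wedge_form0_right c_def d_def)
      (simp add: vec_eq_iff mult_ac)
  have cd: "c i j \<in> loc (cover_poly G [i, j]) (-2)" "d i j \<in> loc (cover_poly G [i, j]) (-2)" for i j
  proof -
    have h: "cover_poly G [i, j] = pd i G * pd j G" by (simp add: cover_poly_def)
    have h2: "homogeneous (2 * (int n - 1)) (pd i G * pd j G)"
      using chom[of "[i, j]"] by (simp add: h)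
    show "c i j \<in> loc (cover_poly G [i, j]) (-2)"
      unfolding h
    proof (rule locI[OF _ h2])
      \<comment> \<open>The denominator of \<open>c\<close> is \<open>pd i G ^ 3 * pd j G\<close>;
        the extra square makes it a power of the cover polynomial. For \<open>d\<close> the roles of
        \<open>i\<close> and \<open>j\<close> are exchanged.\<close>
      show "c i j = rat (A_poly R01 i * U2 * Omega_pair i j * pd j G ^ 2) / rat (pd i G * pd j G) ^ 3"
        using pnz by (simp add: c_def rat_hom rat_eq_0_iff field_simps power2_eq_square power3_eq_cube)
      show "homogeneous (- 2 + int 3 * (2 * (int n - 1))) (A_poly R01 i * U2 * Omega_pair i j * pd j G ^ 2)"
        by (rule homogeneous_cong, (rule homogeneous_mult homogeneous_power Ahom assms homogeneous_Omega_pair phom)+) simp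
    qed
    show "d i j \<in> loc (cover_poly G [i, j]) (-2)"
      unfolding h
    proof (rule locI[OF _ h2])
      show "d i j = rat (U0 * Omega_pair i j * A_poly R12 j * pd i G ^ 2) / rat (pd i G * pd j G) ^ 3"
        using pnz by (simp add: d_def rat_hom rat_eq_0_iff field_simps power2_eq_square power3_eq_cube)
      show "homogeneous (- 2 + int 3 * (2 * (int n - 1))) (U0 * Omega_pair i j * A_poly R12 j * pd i G ^ 2)"
        by (rule homogeneous_cong, (rule homogeneous_mult homogeneous_power Ahom assms homogeneous_Omega_pair phom)+) simp
    qed
  qed
  have pair: "\<exists>i j. s = [i, j]" if "s \<in> simplices 1" for s
    using that unfolding simplices_1 by auto
  have "\<phi> \<in> Cochains G 1 1"
    unfolding Cochains_def
  proof (intro CollectI ballI)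
    fix s assume s: "s \<in> simplices 1"
    then obtain i j where "s = [i, j]" using pair by blast
    with s show "\<phi> s \<in> Forms (cover_poly G s) 1"
      using Forms_1_add[OF chom cnz contraction_Omega_in_Forms[OF chom cnz cd(1)] contraction_Omega_in_Forms[OF chom cnz cd(2)]]
      by (simp only: \<phi>)
  qed
  moreover have "log_lift n G \<phi> \<psi>"
    unfolding log_lift_def
  proof
    fix s assume s: "s \<in> simplices 1"
    then obtain i j where ij: "s = [i, j]" using pair by blast
    have "\<psi> s = - ((c i j * rat (pd i G) + d i j * rat (pd j G)) / rat G) *s Omega"
      by (simp add: \<psi>_def ij k_def)
    then show "log_form_with_residue n G (cover_poly G s) 1 (\<psi> s) (\<phi> s)"
      using s log_form_lift[OF curve chom cnz cd] by (simp only: ij \<phi>)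
  qed
  ultimately have "connecting n G (H1_class_on_curve n G \<phi>) = H2_class G (cech_delta \<psi>)"
    by (rule connecting_eq[OF curve])
  then have massey: "massey_triple n G (W G U0) (W G U1) (W G U2) (W01 G R01) (W12 G R12)
      = Res0 n G (H2_class G (cech_delta \<psi>))"
    by (simp add: massey_triple_def \<phi>_def[abs_def])
  have Fhom: "homogeneous (6 * int n - 9) F"
  proof -
    have "homogeneous (6 * int n - 9) A"
      unfolding assms(11)
      by (intro homogeneous_add; rule homogeneous_cong, (rule homogeneous_mult homogeneous_power assms homogeneous_Var phom)+) simp_all
    moreover have "homogeneous (6 * int n - 9) B"
      unfolding assms(12)
      by (intro homogeneous_add; rule homogeneous_cong, (rule homogeneous_mult homogeneous_power Ahom assms homogeneous_Var phom)+) simp_all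
    ultimately show ?thesis
      unfolding F_def Const_of_nat[symmetric]
      by (intro homogeneous_mult'[OF homogeneous_Const homogeneous_diff]) simp_all
  qed
  have "F * G = - (U2 * (Var 0 * (- Var 0 * R01 2 + Var 2 * R01 0) * pd 0 G ^ 2 * pd 2 G
      + Var 1 * (Var 1 * R01 2 - Var 2 * R01 1) * pd 1 G ^ 2 * pd 2 G
      + Var 2 * (Var 1 * R01 2 - Var 2 * R01 1) * pd 1 G * pd 2 G ^ 2)
    + U0 * (Var 0 * (Var 0 * R12 1 - Var 1 * R12 0) * pd 0 G ^ 2 * pd 1 G
      + Var 1 * (Var 0 * R12 1 - Var 1 * R12 0) * pd 0 G * pd 1 G ^ 2
      + Var 2 * (- Var 0 * R12 2 + Var 2 * R12 0) * pd 0 G * pd 2 G ^ 2))"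
    unfolding F_def
  proof (rule massey_numerator_identity)
    show "Var 0 * pd 0 G + Var 1 * pd 1 G + Var 2 * pd 2 G = of_nat n * G"
      using euler_identity[OF assms(2)] by (simp only: sum_UNIV_3)
    show "U0 * U1 = R01 0 * pd 0 G + R01 1 * pd 1 G + R01 2 * pd 2 G"
      "U1 * U2 = R12 0 * pd 0 G + R12 1 * pd 1 G + R12 2 * pd 2 G"
      using assms(9,10) by (simp_all only: sum_UNIV_3)
    show "B = (Var 1 * R01 2 - Var 2 * R01 1) * U2 * pd 1 G * pd 2 G
      + U0 * (- Var 0 * R12 2 + Var 2 * R12 0) * pd 0 G * pd 2 G + U0 * U1 * U2 * Var 0 * pd 0 G"
      using assms(12) by (simp only: A_poly_def) simp
  qed (rule assms(11))
  from arg_cong[OF this, of rat]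
  have FG: "rat F * rat G = - (rat U2 * (rat (Var 0) * rat (A_poly R01 1) * rat (pd 0 G) ^ 2 * rat (pd 2 G)
      + rat (Var 1) * rat (A_poly R01 0) * rat (pd 1 G) ^ 2 * rat (pd 2 G)
      + rat (Var 2) * rat (A_poly R01 0) * rat (pd 1 G) * rat (pd 2 G) ^ 2)
    + rat U0 * (rat (Var 0) * rat (A_poly R12 2) * rat (pd 0 G) ^ 2 * rat (pd 1 G)
      + rat (Var 1) * rat (A_poly R12 2) * rat (pd 0 G) * rat (pd 1 G) ^ 2
      + rat (Var 2) * rat (A_poly R12 1) * rat (pd 0 G) * rat (pd 2 G) ^ 2))"
    by (simp add: rat_hom A_poly_def)
  have "cech_delta \<psi> [0, 1, 2] = (k 1 2 - k 0 2 + k 0 1) *s Omega"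
    by (simp add: cech_delta_triple \<psi>_def vec_eq_iff algebra_simps)
  \<comment> \<open>The pole along the curve has disappeared, and the coboundary is already in the
    normal form required by \<open>Res0\<close>.\<close>
  also have "k 1 2 - k 0 2 + k 0 1 = rat F / rat (cover_poly G [0, 1, 2]) ^ 2"
    unfolding k_def c_def d_def
    using massey_coboundary_coefficient[OF _ _ _ _ FG] pnz G_neq_0[OF curve]
    by (simp add: Omega_pair_def rat_mult rat_uminus rat_eq_0_iff cover_poly_def mult.assoc)
  finally have \<delta>\<psi>: "cech_delta \<psi> [0, 1, 2] = (rat F / rat (cover_poly G [0, 1, 2]) ^ 2) *s Omega" .
  obtain r where r: "F - Const r * Det_G G \<in> sq_ideal G"
    using ex_residue[OF curve Fhom] by blast
  have massey_r: "massey_triple n G (W G U0) (W G U1) (W G U2) (W01 G R01) (W12 G R12) = r"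
    unfolding massey by (rule Res0_eq[where c = "cech_delta \<psi>", OF curve Fhom \<delta>\<psi> r])
  have I: "is_ideal (sq_ideal G)" unfolding sq_ideal_eq by (rule is_ideal_gen_ideal)
  show ?thesis
    unfolding massey_r
  proof
    assume "r = 0"
    \<comment> \<open>For residue 0, \<open>r\<close> says that \<open>F\<close> lies in the ideal,
      and the factor \<open>n\<close> is invertible.\<close>
    then have "Const (1 / of_nat n) * F \<in> sq_ideal G" using r is_ideal_mult[OF I] by simp
    moreover have "Const (1 / of_nat n) * of_nat n = 1"
      using assms(1) by (simp flip: Const_of_nat Const_mult)
    ultimately show "A - B \<in> sq_ideal G" by (simp add: F_def mult.assoc[symmetric])
  next
    assume "A - B \<in> sq_ideal G"
    then have "F \<in> sq_ideal G" unfolding F_def by (rule is_ideal_mult[OF I])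
    from is_ideal_diff[OF I this r] have "Const r * Det_G G \<in> sq_ideal G" by simp
    then show "r = 0"
      \<comment> \<open>The case of exponent 0: no multiplier, and the ideal of the squares
        themselves.\<close>
      using Det_G_power_notin[OF curve, of r 0] by (simp add: sq_ideal_eq numeral_2_eq_2)
  qed
qed

end
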